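(* Let $f$, $\sigma$ and the deterministic initial values $(q_0^\epsilon,p_0^\epsilon)_{\epsilon\in(0,\epsilon_0)}$ satisfy the assumptions listed in the context. For $\epsilon\in(0,\epsilon_0)$ let $(q^\epsilon(t),p^\epsilon(t))_{t\ge 0}$ be the solution of $$dq^\epsilon(t)=\frac{p^\epsilon(t)}{\epsilon}dt,\qquad dp^\epsilon(t)=-\frac{p^\epsilon(t)}{\epsilon^2}dt+\frac{f(q^\epsilon(t))}{\epsilon}dt+\frac{\sigma(q^\epsilon(t))}{\epsilon}d\beta(t),$$ with $q^\epsilon(0)=q_0^\epsilon$, $p^\epsilon(0)=p_0^\epsilon$, and let $(q_n^{\epsilon,\Delta t},p_n^{\epsilon,\Delta t})_{0\le n\le N}$ be given by the numerical scheme $$q_{n+1}^{\epsilon,\Delta t}=q_n^{\epsilon,\Delta t}+\frac{\Delta t}{\epsilon}p_{n+1}^{\epsilon,\Delta t},\qquad p_{n+1}^{\epsilon,\Delta t}=p_n^{\epsilon,\Delta t}-\frac{\Delta t}{\epsilon^2}p_{n+1}^{\epsilon,\Delta t}+\frac{\Delta t\, f(q_n^{\epsilon,\Delta t})}{\epsilon}+\frac{\sigma(q_n^{\epsilon,\Delta t})}{\epsilon}\Delta\beta_n,$$ with $q_0^{\epsilon,\Delta t}=q_0^\epsilon$, $p_0^{\epsilon,\Delta t}=p_0^\epsilon$. Then for all $T\in(0,\infty)$ there exists $C(T)\in(0,\infty)$ such that for all $\Delta t=T/N\in(0,\Delta t_0)$ and all $n\in\{1,\ldots,N\}$, $$\sup_{\epsilon\in(0,\epsilon_0)}\mathbb{E}\bigl[|q_n^{\epsilon,\Delta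 t}-q^\epsilon(n\Delta t)|^2\bigr]\le C(T)(1+|q_0^0|^2)\Delta t+\frac{C(T)}{(n+1)^2}.$$
   Context: $d\in\mathbb{N}$; $|\cdot|$ is the Euclidean norm; $\mathcal{M}_d(\mathbb{R})$ is the set of real $d\times d$ matrices. $(\beta(t))_{t\ge0}$ is a standard $\mathbb{R}^d$-valued Wiener process on a probability space satisfying the usual conditions, with expectation $\mathbb{E}$; stochastic integrals are in the Itô sense. $\epsilon_0>0$ and $\Delta t_0>0$ are arbitrary fixed numbers; $\Delta t=T/N$ with $N$ a positive integer, $t_n=n\Delta t$, $\Delta\beta_n=\beta(t_{n+1})-\beta(t_n)$. Assumption on coefficients: $f:\mathbb{R}^d\to\mathbb{R}^d$ and $\sigma:\mathbb{R}^d\to\mathcal{M}_d(\mathbb{R})$ are of class $\mathcal{C}^3$ with bounded derivatives of order $1,2,3$, and $\sigma$ is bounded. Assumption on initial values: $q_0^\epsilon,p_0^\epsilon\in\mathbb{R}^d$ are deterministic; there exists $q_0^0\in\mathbb{R}^d$ with $q_0^\epsilon\to q_0^0$ as $\epsilon\to0$; and $\sup_{\epsilon\in(0,\epsilon_0)}|p_0^\epsilon|<\infty$. The estimate depends on the value of $\sup_{\epsilon\in(0,\epsilon_0)}|p_0^\epsilon|$; this dependence is not indicated explicitly in $C(T)$.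
   Formalization: The initial positions are also assumed bounded, |q_0^ε| ≤ K(1+|q_0^0|) for all ε in (0,ε_0), with C(T) depending on K; convergence as ε→0 alone does not bound them on (0,ε_0), and the supremum over ε can then be infinite. *)

theory Defs
  imports "HOL-Probability.Probability"
begin

text \<open>Time is real-valued; all conditions on filtrations and processes only concern times
  \<open>t \<ge> 0\<close>. Processes have the type \<open>real \<Rightarrow> 'a \<Rightarrow> _\<close>, time first.\<close>

locale usual_filtered_prob_space = prob_space M for M :: "'a measure" +
  fixes F :: "real \<Rightarrow> 'a measure"
  assumes subalgebra_F: "0 \<le> t \<Longrightarrow> subalgebra M (F t)"
    and mono_F: "0 \<le> s \<Longrightarrow> s \<le> t \<Longrightarrow> sets (F s) \<subseteq> sets (F t)"
    and complete_F: "A \<in> null_sets M \<Longrightarrow> B \<subseteq> A \<Longrightarrow> B \<in> sets (F 0)"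
    and right_cont_F: "0 \<le> t \<Longrightarrow> sets (F t) = (\<Inter>u\<in>{t<..}. sets (F u))"

locale wiener_process = usual_filtered_prob_space M F
  for M :: "'a measure" and F +
  fixes \<beta> :: "real \<Rightarrow> 'a \<Rightarrow> real ^ 'd"
  assumes adapted: "0 \<le> t \<Longrightarrow> \<beta> t \<in> borel_measurable (F t)"
    and start_0: "AE \<omega> in M. \<beta> 0 \<omega> = 0"
    and cont_paths: "AE \<omega> in M. continuous_on {0..} (\<lambda>t. \<beta> t \<omega>)"
    and indep_increments: "0 \<le> s \<Longrightarrow> s \<le> t \<Longrightarrow>
      indep_set (sets (F s)) (sets (vimage_algebra (space M) (\<lambda>\<omega>. \<beta> t \<omega> - \<beta> s \<omega>) borel))"
    and normal_increments: "0 \<le> s \<Longrightarrow> s < t \<Longrightarrow>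
      distributed M lborel (\<lambda>\<omega>. \<beta> t \<omega> $ i - \<beta> s \<omega> $ i)
        (\<lambda>x. ennreal (normal_density 0 (sqrt (t - s)) x))"
    and indep_components: "0 \<le> s \<Longrightarrow> s < t \<Longrightarrow>
      indep_vars (\<lambda>_. borel) (\<lambda>i \<omega>. \<beta> t \<omega> $ i - \<beta> s \<omega> $ i) UNIV"

text \<open>The elementary process \<open>\<Sum>k<m. \<xi> k * 1_(s k, s (k+1)]\<close> with bounded
  \<open>F (s k)\<close>-measurable matrices \<open>\<xi> k\<close>, and its stochastic integral over \<open>[0,t]\<close>.\<close>

definition elementary_process ::
  "'a measure \<Rightarrow> (real \<Rightarrow> 'a measure) \<Rightarrow> nat \<Rightarrow> (nat \<Rightarrow> real) \<Rightarrow> (nat \<Rightarrow> 'a \<Rightarrow> real ^ 'd ^ 'd) \<Rightarrow> bool"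
  where "elementary_process M F m s \<xi> \<longleftrightarrow>
    0 \<le> s 0 \<and> (\<forall>k<m. s k \<le> s (Suc k)) \<and>
    (\<forall>k<m. \<xi> k \<in> borel_measurable (F (s k)) \<and> bounded (\<xi> k ` space M))"

definition elementary_value ::
  "nat \<Rightarrow> (nat \<Rightarrow> real) \<Rightarrow> (nat \<Rightarrow> 'a \<Rightarrow> real ^ 'd ^ 'd) \<Rightarrow> real \<Rightarrow> 'a \<Rightarrow> real ^ 'd ^ 'd"
  where "elementary_value m s \<xi> r \<omega> = (\<Sum>k<m. indicator {s k<..s (Suc k)} r *\<^sub>R \<xi> k \<omega>)"

definition elementary_integral ::
  "(real \<Rightarrow> 'a \<Rightarrow> real ^ 'd) \<Rightarrow> nat \<Rightarrow> (nat \<Rightarrow> real) \<Rightarrow> (nat \<Rightarrow> 'a \<Rightarrow> real ^ 'd ^ 'd) \<Rightarrow> real \<Rightarrow> 'a \<Rightarrow> real ^ 'd"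
  where "elementary_integral \<beta> m s \<xi> t \<omega> =
    (\<Sum>k<m. \<xi> k \<omega> *v (\<beta> (min (s (Suc k)) t) \<omega> - \<beta> (min (s k) t) \<omega>))"

definition progressively_measurable ::
  "(real \<Rightarrow> 'a measure) \<Rightarrow> (real \<Rightarrow> 'a \<Rightarrow> 'b::topological_space) \<Rightarrow> bool"
  where "progressively_measurable F X \<longleftrightarrow>
    (\<forall>t\<ge>0. (\<lambda>(r, \<omega>). X r \<omega>) \<in> borel_measurable (restrict_space borel {0..t} \<Otimes>\<^sub>M F t))"

text \<open>The L2 theory of the Ito integral (limits in mean square of elementary integrals) is
  sufficient here, since the diffusion coefficient is bounded. The relation determines \<open>J\<close>
  up to a null set.\<close>

definition has_ito_integral ::
  "'a measure \<Rightarrow> (real \<Rightarrow> 'a measure) \<Rightarrow> (real \<Rightarrow> 'a \<Rightarrow> real ^ 'd) \<Rightarrow>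
   (real \<Rightarrow> 'a \<Rightarrow> real ^ 'd ^ 'd) \<Rightarrow> real \<Rightarrow> ('a \<Rightarrow> real ^ 'd) \<Rightarrow> bool"
  where "has_ito_integral M F \<beta> X t J \<longleftrightarrow>
    progressively_measurable F X \<and>
    (\<integral>\<^sup>+\<omega>. (\<integral>\<^sup>+r\<in>{0..t}. ennreal ((norm (X r \<omega>))\<^sup>2) \<partial>lborel) \<partial>M) < \<infinity> \<and>
    J \<in> borel_measurable (F t) \<and>
    (\<exists>m s \<xi>. (\<forall>j. elementary_process M F (m j) (s j) (\<xi> j)) \<and>
      (\<lambda>j. \<integral>\<^sup>+\<omega>. (\<integral>\<^sup>+r\<in>{0..t}.
          ennreal ((norm (elementary_value (m j) (s j) (\<xi> j) r \<omega> - X r \<omega>))\<^sup>2) \<partial>lborel) \<partial>M)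
        \<longlonglongrightarrow> 0 \<and>
      (\<lambda>j. \<integral>\<^sup>+\<omega>.
          ennreal ((norm (elementary_integral \<beta> (m j) (s j) (\<xi> j) t \<omega> - J \<omega>))\<^sup>2) \<partial>M)
        \<longlonglongrightarrow> 0)"

definition C3_bounded_derivs :: "('a::real_normed_vector \<Rightarrow> 'b::real_normed_vector) \<Rightarrow> bool"
  where "C3_bounded_derivs g \<longleftrightarrow>
    (\<exists>(g1 :: 'a \<Rightarrow> 'a \<Rightarrow>\<^sub>L 'b) (g2 :: 'a \<Rightarrow> 'a \<Rightarrow>\<^sub>L 'a \<Rightarrow>\<^sub>L 'b)
      (g3 :: 'a \<Rightarrow> 'a \<Rightarrow>\<^sub>L 'a \<Rightarrow>\<^sub>L 'a \<Rightarrow>\<^sub>L 'b).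
      (\<forall>x. (g has_derivative blinfun_apply (g1 x)) (at x)) \<and>
      (\<forall>x. (g1 has_derivative blinfun_apply (g2 x)) (at x)) \<and>
      (\<forall>x. (g2 has_derivative blinfun_apply (g3 x)) (at x)) \<and>
      continuous_on UNIV g3 \<and>
      bounded (range g1) \<and> bounded (range g2) \<and> bounded (range g3))"

text \<open>\<open>P\<close> bounds the initial momenta. A bound on the initial positions over the whole
  interval \<open>(0, \<epsilon>\<^sub>0)\<close> does not follow from their convergence as \<open>\<epsilon> \<rightarrow> 0\<close>,
  but is needed for estimates uniform in \<open>\<epsilon>\<close>; it is expressed relative to the limit
  by the constant \<open>K\<close>. For any bounded family of positions such a \<open>K\<close> exists.\<close>

definition admissible_initial ::
  "real \<Rightarrow> real \<Rightarrow> real \<Rightarrow> (real \<Rightarrow> real ^ 'd) \<Rightarrow> (real \<Rightarrow> real ^ 'd) \<Rightarrow> real ^ 'd \<Rightarrow> bool"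
  where "admissible_initial \<epsilon>\<^sub>0 K P q0 p0 q00 \<longleftrightarrow>
    (q0 \<longlongrightarrow> q00) (at_right 0) \<and>
    (\<forall>\<epsilon>\<in>{0<..<\<epsilon>\<^sub>0}. norm (p0 \<epsilon>) \<le> P) \<and>
    (\<forall>\<epsilon>\<in>{0<..<\<epsilon>\<^sub>0}. norm (q0 \<epsilon>) \<le> K * (1 + norm q00))"

definition langevin_solution ::
  "'a measure \<Rightarrow> (real \<Rightarrow> 'a measure) \<Rightarrow> (real \<Rightarrow> 'a \<Rightarrow> real ^ 'd) \<Rightarrow>
   (real ^ 'd \<Rightarrow> real ^ 'd) \<Rightarrow> (real ^ 'd \<Rightarrow> real ^ 'd ^ 'd) \<Rightarrow> real \<Rightarrow> real ^ 'd \<Rightarrow> real ^ 'd \<Rightarrow>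
   (real \<Rightarrow> 'a \<Rightarrow> real ^ 'd) \<Rightarrow> (real \<Rightarrow> 'a \<Rightarrow> real ^ 'd) \<Rightarrow> bool"
  where "langevin_solution M F \<beta> f \<sigma> \<epsilon> a b q p \<longleftrightarrow>
    (\<forall>t\<ge>0. q t \<in> borel_measurable (F t) \<and> p t \<in> borel_measurable (F t)) \<and>
    (\<forall>\<omega>\<in>space M. continuous_on {0..} (\<lambda>t. q t \<omega>) \<and> continuous_on {0..} (\<lambda>t. p t \<omega>)) \<and>
    (\<forall>t\<ge>0. AE \<omega> in M. q t \<omega> = a + integral {0..t} (\<lambda>r. (1 / \<epsilon>) *\<^sub>R p r \<omega>)) \<and>
    (\<exists>J. (\<forall>t\<ge>0. has_ito_integral M F \<beta> (\<lambda>r \<omega>. (1 / \<epsilon>) *\<^sub>R \<sigma> (q r \<omega>)) t (J t)) \<and>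
      (\<forall>t\<ge>0. AE \<omega> in M. p t \<omega> = b
          - integral {0..t} (\<lambda>r. (1 / \<epsilon>\<^sup>2) *\<^sub>R p r \<omega>)
          + integral {0..t} (\<lambda>r. (1 / \<epsilon>) *\<^sub>R f (q r \<omega>))
          + J t \<omega>))"

text \<open>The scheme is implicit in \<open>p\<close>, but linearly so: its solution exists and is unique.\<close>

definition langevin_scheme ::
  "'a measure \<Rightarrow> (real \<Rightarrow> 'a \<Rightarrow> real ^ 'd) \<Rightarrow>
   (real ^ 'd \<Rightarrow> real ^ 'd) \<Rightarrow> (real ^ 'd \<Rightarrow> real ^ 'd ^ 'd) \<Rightarrow> real \<Rightarrow> real ^ 'd \<Rightarrow> real ^ 'd \<Rightarrow>
   real \<Rightarrow> nat \<Rightarrow> (nat \<Rightarrow> 'a \<Rightarrow> real ^ 'd) \<Rightarrow> (nat \<Rightarrow> 'a \<Rightarrow> real ^ 'd) \<Rightarrow> bool"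
  where "langevin_scheme M \<beta> f \<sigma> \<epsilon> a b \<Delta>t N Q P \<longleftrightarrow>
    (\<forall>\<omega>\<in>space M. Q 0 \<omega> = a \<and> P 0 \<omega> = b \<and>
      (\<forall>n<N.
        Q (Suc n) \<omega> = Q n \<omega> + (\<Delta>t / \<epsilon>) *\<^sub>R P (Suc n) \<omega> \<and>
        P (Suc n) \<omega> = P n \<omega> - (\<Delta>t / \<epsilon>\<^sup>2) *\<^sub>R P (Suc n) \<omega>
          + (\<Delta>t / \<epsilon>) *\<^sub>R f (Q n \<omega>)
          + (1 / \<epsilon>) *\<^sub>R (\<sigma> (Q n \<omega>) *v (\<beta> (real (Suc n) * \<Delta>t) \<omega> - \<beta> (real n * \<Delta>t) \<omega>))))"

end

theory Submission
  imports Defs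
begin

text \<open>The process \<open>Y t = \<epsilon> (p t - p 0) + q t - q 0\<close> equals
  \<open>\<integral> f(q) ds + \<integral> \<sigma>(q) d\<beta>\<close> over \<open>[0, t]\<close> almost surely, hence is Hoelder continuous of
  order \<open>1/2\<close> in mean square, uniformly in \<open>\<epsilon>\<close>. The position relaxes towards it: extending
  \<open>Y\<close> by \<open>Y 0 = 0\<close> to negative times, \<open>q t - q 0\<close> is \<open>(1 - exp (- t / \<epsilon>\<^sup>2)) \<epsilon> p 0\<close> plus the
  average of \<open>Y (t - \<epsilon>\<^sup>2 u)\<close> over a standard exponential variable \<open>u\<close>. With \<open>x = \<Delta>t / \<epsilon>\<^sup>2\<close>,
  the scheme has the same form, with \<open>1 - (1 + x)\<^sup>-\<^sup>n\<close> in front of \<open>\<epsilon> p 0\<close> and with the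
  discrete analogue of \<open>Y\<close> averaged at the index \<open>n - \<lfloor>u / ln (1 + x)\<rfloor>\<close>. With the same \<open>u\<close> in
  both representations, the two times differ by at most \<open>\<Delta>t (1 + u)\<close> whatever \<open>\<epsilon>\<close> is, so by
  Jensen the averages contribute \<open>O(\<Delta>t)\<close>, while the terms in \<open>p 0\<close> differ by \<open>O(1 / (n + 1))\<close>.
  The Ito isometry and a discrete Gronwall argument conclude.\<close>

section \<open>Elementary inequalities\<close>

text \<open>The obstacle is stiffness: the momentum equation has coefficients of order
  \<open>1 / \<epsilon>\<^sup>2\<close>, so a direct comparison of \<open>p\<close> with its
  discretisation, or Gronwall for the pair, has constants that explode as \<open>\<epsilon>\<close>
  tends to 0. Hence only positions are compared. One variable \<open>u\<close> can serve both
  averages because \<open>\<lfloor>u / ln (1 + x)\<rfloor>\<close> is geometric with ratio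
  \<open>1 / (1 + x)\<close>, the contraction factor of one implicit step. What remains of the
  stiffness is an initial layer, where \<open>q\<close> is not Hoelder continuous uniformly in
  \<open>\<epsilon>\<close>. The squared drops of \<open>exp (- t / \<epsilon>\<^sup>2)\<close> over
  the grid cells sum to at most 1, and the terms \<open>1 / (n + 1)\<^sup>2\<close> are summable.
  Both sums enter Gronwall with a factor \<open>\<Delta>t\<close>, so the layer costs order
  \<open>\<Delta>t\<close>, besides the term at index \<open>n\<close> itself. Finite second moments
  of \<open>q\<close> are not assumed: Gronwall is applied path by path, where continuity makes the
  time integral of the squared norm finite, and expectations are taken afterwards.\<close>

lemma exp_euler_power_diff:
  fixes x :: real
  assumes "0 \<le> x"
  shows "\<bar>exp (- (real n * x)) - (1 / (1 + x)) ^ n\<bar> \<le> 6 / (real n + 1)"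
proof -
  define a where "a = 1 / (1 + x)"
  have a01: "0 < a" "a \<le> 1" using assms by (auto simp: a_def)
  have e: "exp (- (real n * x)) = exp (-x) ^ n"
    by (simp flip: exp_of_nat_mult)
  have le: "exp (-x) \<le> a"
    using exp_ge_add_one_self[of x] assms by (simp add: a_def exp_minus field_simps)
  then have le_n: "exp (-x) ^ n \<le> a ^ n"
    by (intro power_mono) auto
  have a_n1: "a ^ n \<le> 1" using a01 by (simp add: power_le_one)
  consider "n = 0" | "n = 1" | "n \<ge> 2" by linarith
  then have "a ^ n - exp (-x) ^ n \<le> 6 / (real n + 1)"
  proof cases
    case 3
    \<comment> \<open>Since \<open>exp (-x) \<le> a\<close>, each summand is at most
      \<open>a ^ (n - 1)\<close>; the other factor, \<open>a - exp (-x)\<close>, is of second order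
      in \<open>x\<close>.\<close>
    have "a ^ n - exp (-x) ^ n = (a - exp (-x)) * (\<Sum>i<n. exp (-x) ^ (n - Suc i) * a ^ i)"
      by (rule power_diff_sumr2)
    also have "\<dots> \<le> (a - exp (-x)) * (\<Sum>i<n. a ^ (n - 1))"
    proof (intro mult_left_mono sum_mono)
      fix i assume i: "i \<in> {..<n}"
      have "exp (-x) ^ (n - Suc i) * a ^ i \<le> a ^ (n - Suc i) * a ^ i"
        using le a01 by (intro mult_right_mono power_mono) auto
      also have "\<dots> = a ^ (n - 1)"
        using i by (simp flip: power_add)
      finally show "exp (-x) ^ (n - Suc i) * a ^ i \<le> a ^ (n - 1)" .
    qed (use le in auto)
    also have "\<dots> = real n * a ^ (n - 1) * (a - exp (-x))" by simp
    also have "\<dots> \<le> real n * a ^ (n - 1) * (a * x\<^sup>2)"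
    proof (intro mult_left_mono)
      have "a - exp (-x) \<le> a - (1 - x)"
        using exp_ge_add_one_self[of "-x"] by simp
      also have "\<dots> = a * x\<^sup>2"
        using assms by (simp add: a_def field_simps power2_eq_square)
      finally show "a - exp (-x) \<le> a * x\<^sup>2" .
    qed (use a01 in auto)
    also have "\<dots> = real n * x\<^sup>2 * a ^ n"
      using 3 by (cases n) auto
    also have "\<dots> \<le> 2 / (real n - 1)"
    proof -
      \<comment> \<open>The quadratic term of the binomial expansion bounds
        \<open>(1 + x) ^ n\<close> from below. It cancels \<open>x\<^sup>2\<close>, so the estimate
        holds for all \<open>x\<close>, small or large.\<close>
      have "real n * (real n - 1) / 2 * x\<^sup>2 = real (n choose 2) * x\<^sup>2"
        using 3 by (simp add: choose_two real_of_nat_div)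
      also have "\<dots> = (\<Sum>k\<in>{2}. real (n choose k) * x ^ k)" by simp
      also have "\<dots> \<le> (\<Sum>k\<le>n. real (n choose k) * x ^ k)"
        using 3 assms by (intro sum_mono2) auto
      also have "\<dots> = (1 + x) ^ n"
        using binomial_ring[of x 1 n] by (simp add: add.commute)
      finally have "real n * (real n - 1) / 2 * x\<^sup>2 * a ^ n \<le> (1 + x) ^ n * a ^ n"
        using a01 by (intro mult_right_mono) auto
      also have "\<dots> = 1" using assms by (simp add: a_def flip: power_mult_distrib)
      finally show ?thesis using 3 by (simp add: field_simps)
    qed
    \<comment> \<open>The constant 6 is attained at \<open>n = 2\<close>, where both sides equal
      2.\<close>
    also have "\<dots> \<le> 6 / (real n + 1)" using 3 by (simp add: field_simps)
    finally show ?thesis .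
  next
    case 2
    then have "a ^ n - exp (-x) ^ n \<le> 1"
      using a01 exp_ge_zero[of "-x"] unfolding 2 power_one_right by linarith
    then show ?thesis using 2 by simp
  qed simp
  then show ?thesis using le_n by (simp add: e a_def)
qed

text \<open>From \<open>x / (1 + x) \<le> ln (1 + x) \<le> x\<close>, the reciprocal of the
  logarithm lies between \<open>1 / x\<close> and \<open>1 / x + 1\<close>; the floor costs another
  1. Both quantities may be huge when \<open>x\<close> is small, yet their gap does not see
  \<open>x\<close>. Multiplied by the step, this is the distance of the two coupled times.\<close>

lemma abs_floor_div_ln_diff:
  fixes x u :: real
  assumes "0 < x" "0 \<le> u"
  shows "\<bar>u / x - \<lfloor>u / ln (1 + x)\<rfloor>\<bar> \<le> 1 + u"
proof -
  define l where "l = ln (1 + x)"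
  have l: "0 < l" "l \<le> x" using assms by (auto simp: l_def ln_add_one_self_le_self)
  have "1 - 1 / (1 + x) \<le> l"
    using ln_le_minus_one[of "1 / (1 + x)"] assms by (simp add: l_def ln_div)
  then have "x \<le> l * (1 + x)" using assms by (simp add: field_simps)
  then have "1 / l \<le> 1 / x + 1" using l assms by (simp add: field_simps)
  then have "u * (1 / l) \<le> u * (1 / x + 1)" using assms by (intro mult_left_mono)
  then have 1: "u / l \<le> u / x + u" by (simp add: algebra_simps)
  have 2: "u / x \<le> u / l" using l assms by (simp add: frac_le)
  show ?thesis using 1 2 assms(2) unfolding l_def[symmetric] by linarith
qed

lemma lipschitz_imp_continuous:
  fixes g :: "'a::real_normed_vector \<Rightarrow> 'b::real_normed_vector"
  assumes "\<And>x y. norm (g x - g y) \<le> L * norm (x - y)" "0 \<le> L"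
  shows "continuous_on UNIV g"
  using assms by (intro lipschitz_on_continuous_on[of L] lipschitz_onI) (auto simp: dist_norm)

lemma norm_add_sq_le:
  fixes x y :: "'a::real_normed_vector"
  shows "(norm (x + y))\<^sup>2 \<le> 2 * (norm x)\<^sup>2 + 2 * (norm y)\<^sup>2"
proof -
  have "(norm (x + y))\<^sup>2 \<le> (norm x + norm y)\<^sup>2"
    by (intro power_mono norm_triangle_ineq) auto
  also have "\<dots> \<le> 2 * (norm x)\<^sup>2 + 2 * (norm y)\<^sup>2"
    using zero_le_power2[of "norm x - norm y"] by (simp add: power2_eq_square algebra_simps)
  finally show ?thesis .
qed

text \<open>Mean squares live in \<open>ennreal\<close>, so that expectations, limits and exchanges
  of integrals require measurability but no prior finiteness.\<close>

abbreviation nsq :: "'a::real_normed_vector \<Rightarrow> ennreal" where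
  "nsq x \<equiv> ennreal ((norm x)\<^sup>2)"

lemma nsq_add_le: "nsq (x + y) \<le> 2 * nsq x + 2 * nsq y"
  using ennreal_leI[OF norm_add_sq_le[of x y]]
  by (simp add: ennreal_plus ennreal_mult' ennreal_mult)

lemma nsq_triangle: "nsq (x - z) \<le> 2 * nsq (x - y) + 2 * nsq (y - z)"
  using nsq_add_le[of "x - y" "y - z"] by simp

lemma nsq_scaleR: "nsq (c *\<^sub>R x) = ennreal (c\<^sup>2) * nsq x"
  by (simp add: power_mult_distrib ennreal_mult)

text \<open>Cauchy-Schwarz against the constant 1. It serves as Jensen's inequality for probability
  measures, with a factor \<open>b - a\<close> on intervals, and with a factor \<open>j\<close> for
  sums of \<open>j\<close> terms under the counting measure.\<close>

lemma nsq_norm_integral_le: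
  fixes g :: "'a \<Rightarrow> 'b::{banach, second_countable_topology}"
  assumes [measurable]: "g \<in> borel_measurable M"
  shows "nsq (\<integral>x. g x \<partial>M) \<le> emeasure M (space M) * (\<integral>\<^sup>+x. nsq (g x) \<partial>M)"
proof (cases "integrable M g")
  case True
  have "ennreal (norm (\<integral>x. g x \<partial>M)) \<le> (\<integral>\<^sup>+x. ennreal (norm (g x)) \<partial>M)"
    using True by (rule integral_norm_bound_ennreal)
  then have "(ennreal (norm (\<integral>x. g x \<partial>M)))\<^sup>2 \<le> (\<integral>\<^sup>+x. ennreal (norm (g x)) * 1 \<partial>M)\<^sup>2"
    by (intro power_mono) auto
  also have "\<dots> \<le> (\<integral>\<^sup>+x. (ennreal (norm (g x)))\<^sup>2 \<partial>M) * (\<integral>\<^sup>+x. 1\<^sup>2 \<partial>M)"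
    by (intro Cauchy_Schwarz_nn_integral) auto
  also have "\<dots> = emeasure M (space M) * (\<integral>\<^sup>+x. nsq (g x) \<partial>M)"
    by (simp add: ennreal_power mult.commute)
  finally show ?thesis by (simp add: ennreal_power)
\<comment> \<open>A non-integrable \<open>g\<close> has Bochner integral 0 by convention, which
  makes this case trivial.\<close>
qed (simp add: not_integrable_integral_eq)

lemma (in prob_space) nsq_expectation_le:
  fixes g :: "'a \<Rightarrow> 'b::{banach, second_countable_topology}"
  assumes "g \<in> borel_measurable M"
  shows "nsq (expectation g) \<le> (\<integral>\<^sup>+x. nsq (g x) \<partial>M)"
  using nsq_norm_integral_le[OF assms] by (simp add: emeasure_space_1)

lemma nsq_integral_interval_le:
  fixes g :: "real \<Rightarrow> 'b::euclidean_space"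
  assumes "continuous_on {a..b} g" "a \<le> b"
  shows "nsq (integral {a..b} g) \<le> ennreal (b - a) * (\<integral>\<^sup>+r\<in>{a..b}. nsq (g r) \<partial>lborel)"
proof -
  have "nsq (integral {a..b} g) = nsq (\<integral>r. g r \<partial>restrict_space lborel {a..b})"
    using set_borel_integral_eq_integral(2)[of "{a..b}" g]
      borel_integrable_compact[of "{a..b}" g] assms
    by (simp add: integral_restrict_space set_lebesgue_integral_def set_integrable_def)
  also have "\<dots> \<le> emeasure (restrict_space lborel {a..b}) (space (restrict_space lborel {a..b}))
      * (\<integral>\<^sup>+r. nsq (g r) \<partial>restrict_space lborel {a..b})"
    using borel_measurable_continuous_on_restrict[OF assms(1)]
    by (intro nsq_norm_integral_le)
      (subst measurable_cong_sets[OF sets_restrict_space_cong[of lborel borel] refl], simp_all)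
  also have "\<dots> = ennreal (b - a) * (\<integral>\<^sup>+r\<in>{a..b}. nsq (g r) \<partial>lborel)"
    using assms(2) by (simp add: space_restrict_space emeasure_restrict_space nn_integral_restrict_space)
  finally show ?thesis .
qed

section \<open>Gronwall inequalities, discrete and pathwise\<close>

lemma discrete_gronwall_ennreal:
  fixes e :: "nat \<Rightarrow> ennreal" and c :: real
  assumes "\<And>n. n \<le> N \<Longrightarrow> e n \<le> ennreal (b n) + ennreal c * (\<Sum>k<n. e k)"
    and "0 \<le> c" "\<And>n. 0 \<le> b n" "n \<le> N"
  shows "e n \<le> ennreal (b n + c * exp (c * real n) * (\<Sum>k<n. b k))"
proof -
  \<comment> \<open>The induction runs over partial sums, for which the hypothesis reads
    \<open>S (m + 1) \<le> (1 + c) * S m + b m\<close>. Keeping the sum of the \<open>b k\<close>,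
    not a maximum, is what later exploits the summability of
    \<open>1 / (k + 1)\<^sup>2\<close>.\<close>
  have S: "(\<Sum>k<m. e k) \<le> ennreal ((1 + c) ^ m * (\<Sum>k<m. b k))" if "m \<le> N" for m
    using that
  proof (induction m)
    case (Suc m)
    let ?s = "(1 + c) ^ m * (\<Sum>k<m. b k)"
    have s0: "0 \<le> ?s" using assms by (simp add: sum_nonneg)
    have IH: "(\<Sum>k<m. e k) \<le> ennreal ?s" using Suc by simp
    have "(\<Sum>k<Suc m. e k) \<le> ennreal ?s + (ennreal (b m) + ennreal c * ennreal ?s)"
      unfolding sum.lessThan_Suc using IH Suc.prems
      by (intro add_mono order_trans[OF assms(1)] order_refl mult_left_mono) auto
    also have "\<dots> = ennreal ((1 + c) * ?s + 1 * b m)"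
      using s0 assms by (simp add: ennreal_plus[symmetric] ennreal_mult[symmetric] algebra_simps
        del: ennreal_plus)
    also have "\<dots> \<le> ennreal ((1 + c) ^ Suc m * (\<Sum>k<Suc m. b k))"
    proof (intro ennreal_leI)
      have "1 * b m \<le> (1 + c) ^ Suc m * b m"
        using assms by (intro mult_right_mono one_le_power) auto
      then show "(1 + c) * ?s + 1 * b m \<le> (1 + c) ^ Suc m * (\<Sum>k<Suc m. b k)"
        by (simp add: algebra_simps)
    qed
    finally show ?case .
  qed simp
  have e: "(1 + c) ^ n \<le> exp (c * real n)"
    using assms(2) exp_ge_add_one_self[of c] power_mono[of "1 + c" "exp c" n]
    by (simp add: exp_of_nat2_mult)
  have "e n \<le> ennreal (b n) + ennreal c * ennreal ((1 + c) ^ n * (\<Sum>k<n. b k))"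
    using S[of n] assms(4) by (intro order_trans[OF assms(1)] add_mono order_refl mult_left_mono) auto
  also have "\<dots> = ennreal (b n + c * ((1 + c) ^ n * (\<Sum>k<n. b k)))"
    using assms by (subst ennreal_plus) (auto simp: ennreal_mult sum_nonneg)
  also have "\<dots> \<le> ennreal (b n + c * exp (c * real n) * (\<Sum>k<n. b k))"
    using e assms by (intro ennreal_leI) (simp add: mult.assoc mult_left_mono mult_right_mono sum_nonneg)
  finally show ?thesis .
qed

text \<open>\<open>ennreal\<close> sends negative values to 0, so the right-hand side is the
  integral of the positive part of \<open>g\<close>.\<close>

lemma ennreal_integral_le_nn_integral:
  fixes g :: "'a \<Rightarrow> real"
  assumes "integrable M g"
  shows "ennreal (\<integral>x. g x \<partial>M) \<le> (\<integral>\<^sup>+x. ennreal (g x) \<partial>M)"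
proof -
  have i: "integrable M (\<lambda>x. max 0 (g x))" using assms by simp
  have "ennreal (\<integral>x. g x \<partial>M) \<le> ennreal (\<integral>x. max 0 (g x) \<partial>M)"
    using assms i by (intro ennreal_leI integral_mono) auto
  also have "\<dots> = (\<integral>\<^sup>+x. ennreal (max 0 (g x)) \<partial>M)"
    using i by (intro nn_integral_eq_integral[symmetric]) auto
  finally show ?thesis by (simp add: ennreal_max_0)
qed

text \<open>The derivative of \<open>exp (- (c * r)) * integral {0..r} u\<close> is at most
  \<open>A r\<close>, and integrating this gives the claim. The function \<open>A\<close> will be a
  random noise term along one path, not monotone in time; hence a bound of the integral of
  \<open>u\<close> by the integral of \<open>A\<close> instead of a pointwise exponential
  bound.\<close>

lemma gronwall_nn_integral:
  fixes u :: "real \<Rightarrow> real" and A :: "real \<Rightarrow> ennreal"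
  assumes cont: "continuous_on {0..t} u" and "0 \<le> c" "0 \<le> t"
    and le: "\<And>r. r \<in> {0..t} \<Longrightarrow> ennreal (u r) \<le> A r + ennreal (c * integral {0..r} u)"
    and nn: "\<And>r. r \<in> {0..t} \<Longrightarrow> 0 \<le> u r"
  shows "ennreal (integral {0..t} u) \<le> ennreal (exp (c * t)) * (\<integral>\<^sup>+r\<in>{0..t}. A r \<partial>lborel)"
proof -
  define y where "y r = integral {0..r} u" for r
  define g where "g r = exp (- (c * r)) * (u r - c * y r)" for r
  have y_cont: "continuous_on {0..t} y"
    unfolding y_def using cont by (intro indefinite_integral_continuous_1 integrable_continuous_real)
  have y0: "0 \<le> y r" if "r \<in> {0..t}" for r
    unfolding y_def using that nn
    by (intro integral_nonneg integrable_continuous_real continuous_on_subset[OF cont]) auto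
  have "((\<lambda>r. exp (- (c * r)) * y r) has_vector_derivative g r) (at r within {0..t})"
    if "r \<in> {0..t}" for r
  proof -
    have "(y has_vector_derivative u r) (at r within {0..t})"
      unfolding y_def using cont that by (rule integral_has_vector_derivative)
    then have "(y has_real_derivative u r) (at r within {0..t})"
      by (simp add: has_real_derivative_iff_has_vector_derivative)
    then have "((\<lambda>r. exp (- (c * r)) * y r) has_real_derivative g r) (at r within {0..t})"
      by (auto intro!: derivative_eq_intros simp: g_def algebra_simps)
    then show ?thesis by (simp add: has_real_derivative_iff_has_vector_derivative)
  qed
  then have "(g has_integral exp (- (c * t)) * y t - exp (- (c * 0)) * y 0) {0..t}"
    using \<open>0 \<le> t\<close> by (intro fundamental_theorem_of_calculus) auto
  then have gi: "integral {0..t} g = exp (- (c * t)) * y t"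
    by (simp add: y_def integral_unique)
  have g_cont: "continuous_on {0..t} g"
    unfolding g_def using cont y_cont by (intro continuous_intros)
  have si: "set_integrable lborel {0..t} g"
    using borel_integrable_compact[of "{0..t}" g] g_cont by (simp add: set_integrable_def)
  have "ennreal (exp (- (c * t)) * y t) = ennreal (LINT r:{0..t}|lborel. g r)"
    using set_borel_integral_eq_integral(2)[OF si] gi by simp
  also have "\<dots> \<le> (\<integral>\<^sup>+r. ennreal (indicator {0..t} r *\<^sub>R g r) \<partial>lborel)"
    unfolding set_lebesgue_integral_def
    using si[unfolded set_integrable_def] by (rule ennreal_integral_le_nn_integral)
  also have "\<dots> \<le> (\<integral>\<^sup>+r\<in>{0..t}. A r \<partial>lborel)"
  proof (intro nn_integral_mono)
    fix r
    show "ennreal (indicator {0..t} r *\<^sub>R g r) \<le> A r * indicator {0..t} r"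
    proof (cases "r \<in> {0..t}")
      case True
      \<comment> \<open>The exponential factor lies between 0 and 1: it may be dropped where the
        bracket is nonnegative, and elsewhere \<open>g r\<close> is at most 0.\<close>
      have "g r \<le> max 0 (u r - c * y r)"
        unfolding g_def using True \<open>0 \<le> c\<close>
        by (cases "0 \<le> u r - c * y r") (auto intro: mult_left_le_one_le mult_nonneg_nonpos)
      then have "ennreal (g r) \<le> ennreal (u r - c * y r)"
        by (metis ennreal_leI ennreal_max_0)
      also have "\<dots> = ennreal (u r) - ennreal (c * y r)"
        using y0[OF True] \<open>0 \<le> c\<close> by (simp add: ennreal_minus)
      also have "\<dots> \<le> A r"
        using le[OF True] by (simp add: y_def ennreal_minus_le_iff add.commute)
      finally show ?thesis using True by simp
    qed simp
  qed
  finally have *: "ennreal (exp (- (c * t)) * y t) \<le> (\<integral>\<^sup>+r\<in>{0..t}. A r \<partial>lborel)" .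
  have "ennreal (y t) = ennreal (exp (c * t)) * ennreal (exp (- (c * t)) * y t)"
    using y0[of t] \<open>0 \<le> t\<close> by (simp flip: ennreal_mult add: exp_minus)
  also have "\<dots> \<le> ennreal (exp (c * t)) * (\<integral>\<^sup>+r\<in>{0..t}. A r \<partial>lborel)"
    using * by (rule mult_left_mono) simp
  finally show ?thesis by (simp add: y_def)
qed

section \<open>Ito integrals of elementary processes\<close>

lemma borel_measurable_vec_nth [measurable]:
  fixes X :: "'a \<Rightarrow> real ^ 'n"
  shows "X \<in> borel_measurable M \<Longrightarrow> (\<lambda>x. X x $ i) \<in> borel_measurable M"
  by (rule borel_measurable_continuous_on[where f="\<lambda>x. x $ i"]) (auto intro: continuous_intros)

lemma borel_measurable_mat_nth [measurable]:
  fixes X :: "'a \<Rightarrow> real ^ 'n ^ 'm"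
  shows "X \<in> borel_measurable M \<Longrightarrow> (\<lambda>x. X x $ i $ j) \<in> borel_measurable M"
  by (rule borel_measurable_continuous_on[where f="\<lambda>x. x $ i $ j"])
    (auto intro!: linear_continuous_on bounded_linear_compose[OF bounded_linear_vec_nth bounded_linear_vec_nth])

lemma borel_measurable_vecI:
  fixes X :: "'a \<Rightarrow> real ^ 'n"
  assumes "\<And>i. (\<lambda>x. X x $ i) \<in> borel_measurable M"
  shows "X \<in> borel_measurable M"
  unfolding borel_measurable_euclidean_space[of X]
  using assms by (auto simp: Basis_vec_def inner_axis)

lemma borel_measurable_matrix_vector_mult [measurable]:
  fixes A :: "'a \<Rightarrow> real ^ 'n ^ 'm" and x :: "'a \<Rightarrow> real ^ 'n"
  assumes [measurable]: "A \<in> borel_measurable M" "x \<in> borel_measurable M"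
  shows "(\<lambda>w. A w *v x w) \<in> borel_measurable M"
  by (intro borel_measurable_vecI) (simp add: matrix_vector_mult_def)

lemma bounded_mat_nth:
  fixes A :: "'a \<Rightarrow> real ^ 'n ^ 'm"
  assumes "bounded (A ` S)"
  obtains c where "0 \<le> c" "\<And>x i j. x \<in> S \<Longrightarrow> \<bar>A x $ i $ j\<bar> \<le> c"
proof -
  obtain c where c: "0 < c" "\<And>x. x \<in> S \<Longrightarrow> norm (A x) \<le> c"
    using assms by (auto simp: bounded_pos)
  have "\<bar>A x $ i $ j\<bar> \<le> c" if "x \<in> S" for x i j
  proof -
    have "\<bar>A x $ i $ j\<bar> \<le> norm (A x $ i)" by (rule component_le_norm_cart)
    also have "\<dots> \<le> norm (A x)" by (rule Finite_Cartesian_Product.norm_nth_le)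
    finally show ?thesis using c(2)[OF that] by simp
  qed
  then show thesis using that[of c] c by auto
qed

text \<open>Separates the matrix entries, known when an interval begins, from the coordinates of the
  increments, whose joint moments are available.\<close>

lemma inner_matrix_vector_mult:
  fixes A B :: "real ^ 'n ^ 'm" and x y :: "real ^ 'n"
  shows "(A *v x) \<bullet> (B *v y) = (\<Sum>k\<in>UNIV. \<Sum>i\<in>UNIV. \<Sum>j\<in>UNIV. A $ k $ i * B $ k $ j * (x $ i * y $ j))"
  by (simp add: inner_vec_def matrix_vector_mult_def sum_product mult_ac)

lemma (in finite_measure) integrable_mult_bounded:
  fixes g h :: "'a \<Rightarrow> real"
  assumes h: "integrable M h" and [measurable]: "g \<in> borel_measurable M"
    and bd: "\<And>x. x \<in> space M \<Longrightarrow> \<bar>g x\<bar> \<le> c"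
  shows "integrable M (\<lambda>x. g x * h x)"
proof (rule Bochner_Integration.integrable_bound)
  show "integrable M (\<lambda>x. c * h x)" using h by simp
  show "(\<lambda>x. g x * h x) \<in> borel_measurable M" using h by measurable
  show "AE x in M. norm (g x * h x) \<le> norm (c * h x)"
    using bd by (auto intro!: AE_I2 mult_right_mono simp: abs_mult) (meson abs_ge_self order_trans)
qed

abbreviation (in prob_space) MT :: "('a \<times> real) measure"
  where "MT \<equiv> M \<Otimes>\<^sub>M lborel"

abbreviation (in prob_space) msq :: "('a \<Rightarrow> 'b::real_normed_vector) \<Rightarrow> ennreal"
  where "msq X \<equiv> \<integral>\<^sup>+w. nsq (X w) \<partial>M"

abbreviation (in prob_space) msq_on :: "real set \<Rightarrow> (real \<Rightarrow> 'a \<Rightarrow> 'b::real_normed_vector) \<Rightarrow> ennreal"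
  where "msq_on A X \<equiv> \<integral>\<^sup>+w. (\<integral>\<^sup>+r\<in>A. nsq (X r w) \<partial>lborel) \<partial>M"

context usual_filtered_prob_space
begin

lemma space_F: "0 \<le> t \<Longrightarrow> space (F t) = space M"
  using subalgebra_F by (auto simp: subalgebra_def)

lemma measurable_F_M: "0 \<le> t \<Longrightarrow> X \<in> measurable (F t) N \<Longrightarrow> X \<in> measurable M N"
  using subalgebra_F by (rule measurable_from_subalg)

lemma measurable_F_mono: "0 \<le> s \<Longrightarrow> s \<le> t \<Longrightarrow> X \<in> measurable (F s) N \<Longrightarrow> X \<in> measurable (F t) N"
  using mono_F[of s t] by (auto simp: measurable_def space_F)

end

context wiener_process
begin

section \<open>Joint moments of Wiener increments\<close>

lemma measurable_increment [measurable]: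
  "0 \<le> s \<Longrightarrow> s \<le> t \<Longrightarrow> (\<lambda>w. \<beta> t w - \<beta> s w) \<in> borel_measurable (F t)"
  by (intro borel_measurable_diff adapted measurable_F_mono[of s t, OF _ _ adapted]) auto

lemma integrable_increment:
  assumes "0 \<le> s" "s \<le> t"
  shows "integrable M (\<lambda>w. \<beta> t w $ i - \<beta> s w $ i)"
proof (cases "s = t")
  case False
  then show ?thesis
    using distributed_integrable_var[OF normal_increments[of s t i]] assms
      integrable_normal_moment_nz_1[of "sqrt (t - s)" 0] by simp
qed simp

lemma expectation_increment:
  assumes "0 \<le> s" "s \<le> t"
  shows "expectation (\<lambda>w. \<beta> t w $ i - \<beta> s w $ i) = 0"
proof (cases "s = t")
  case False
  then show ?thesis
    using normal_distributed_expectation[OF _ normal_increments[of s t i]] assms by simp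
qed simp

lemma
  assumes "0 \<le> s" "s \<le> t"
  shows integrable_increment_mult:
      "integrable M (\<lambda>w. (\<beta> t w $ i - \<beta> s w $ i) * (\<beta> t w $ j - \<beta> s w $ j))" (is "?I i j")
    and expectation_increment_mult:
      "expectation (\<lambda>w. (\<beta> t w $ i - \<beta> s w $ i) * (\<beta> t w $ j - \<beta> s w $ j))
        = (if i = j then t - s else 0)" (is "?E i j")
proof -
  have "?I i j \<and> ?E i j"
  proof (cases "s = t")
    case False
    then have st: "s < t" using assms by simp
    show ?thesis
    proof (cases "i = j")
      case True
      note D = normal_increments[OF \<open>0 \<le> s\<close> st, of i]
      have "?I i i"
        using distributed_integrable[OF D, of "\<lambda>x. x * x"]
          integrable_normal_moment[of "sqrt (t - s)" 0 2] st
        by (simp add: power2_eq_square)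
      moreover have "?E i i"
        using normal_distributed_variance[OF _ D] st assms
        by (simp add: expectation_increment power2_eq_square)
      ultimately show ?thesis using True by simp
    next
      case False
      have ind: "indep_vars (\<lambda>_. borel) (\<lambda>i w. \<beta> t w $ i - \<beta> s w $ i) {i, j}"
        using indep_components[OF \<open>0 \<le> s\<close> st] by (rule indep_vars_subset) auto
      show ?thesis
        using indep_vars_lebesgue_integral[OF _ ind] indep_vars_integrable[OF _ ind] False
        by (simp add: integrable_increment expectation_increment assms)
    qed
  qed simp
  then show "?I i j" "?E i j" by auto
qed

text \<open>Independence is assumed between \<open>F s\<close> and the sigma-algebra generated by
  the increment. The sigma-algebra generated by \<open>g\<close> is contained in the former, the one
  generated by \<open>h\<close> of the increment in the latter.\<close>

lemma indep_var_increment: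
  fixes g :: "'a \<Rightarrow> real" and h :: "real ^ 'd \<Rightarrow> real"
  assumes st: "0 \<le> s" "s \<le> t" and g: "g \<in> borel_measurable (F s)" and h: "h \<in> borel_measurable borel"
  shows "indep_var borel g borel (\<lambda>w. h (\<beta> t w - \<beta> s w))"
proof -
  have D: "(\<lambda>w. \<beta> t w - \<beta> s w) \<in> borel_measurable M"
    using st by (intro measurable_F_M[OF _ measurable_increment]) auto
  let ?V = "vimage_algebra (space M) (\<lambda>w. \<beta> t w - \<beta> s w) borel"
  have hV: "(\<lambda>w. h (\<beta> t w - \<beta> s w)) \<in> borel_measurable ?V"
    by (rule measurable_compose[OF _ h]) (rule measurable_vimage_algebra1, auto)
  have sub: "sigma_sets (space M) {X -` A \<inter> space M |A. A \<in> sets borel} \<subseteq> sets N"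
    if "X \<in> borel_measurable N" "space N = space M" for X :: "'a \<Rightarrow> real" and N
    using that(1) by (intro sets.sigma_sets_subset[of _ N, unfolded that(2)]) (auto simp: measurable_def that(2))
  show ?thesis
    unfolding indep_var_eq
  proof (intro conjI)
    show "random_variable borel g" using st g by (intro measurable_F_M) auto
    show "random_variable borel (\<lambda>w. h (\<beta> t w - \<beta> s w))"
      by (rule measurable_compose[OF D h])
    show "indep_set (sigma_sets (space M) {g -` A \<inter> space M |A. A \<in> sets borel})
      (sigma_sets (space M) {(\<lambda>w. h (\<beta> t w - \<beta> s w)) -` A \<inter> space M |A. A \<in> sets borel})"
      unfolding indep_set_def
    proof (rule indep_sets_mono_sets[OF indep_increments[OF st, unfolded indep_set_def]])
      fix i :: bool
      show "(case i of True \<Rightarrow> sigma_sets (space M) {g -` A \<inter> space M |A. A \<in> sets borel}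
          | False \<Rightarrow> sigma_sets (space M) {(\<lambda>w. h (\<beta> t w - \<beta> s w)) -` A \<inter> space M |A. A \<in> sets borel})
        \<subseteq> (case i of True \<Rightarrow> sets (F s) | False \<Rightarrow> sets ?V)"
        using sub[OF g] sub[OF hV] st by (cases i) (simp_all add: space_F)
    qed
  qed
qed

text \<open>Everything but the second increment is known at time \<open>c\<close>; that increment is
  independent of \<open>F c\<close> and centred, so every term of the coordinate expansion has mean
  0.\<close>

lemma
  fixes A B :: "'a \<Rightarrow> real ^ 'd ^ 'd"
  assumes t: "0 \<le> a" "a \<le> b" "b \<le> c" "c \<le> d"
    and A: "A \<in> borel_measurable (F a)" "bounded (A ` space M)"
    and B: "B \<in> borel_measurable (F c)" "bounded (B ` space M)"
  shows integrable_inner_disjoint: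
      "integrable M (\<lambda>w. (A w *v (\<beta> b w - \<beta> a w)) \<bullet> (B w *v (\<beta> d w - \<beta> c w)))" (is "integrable M ?f")
    and expectation_inner_disjoint:
      "expectation (\<lambda>w. (A w *v (\<beta> b w - \<beta> a w)) \<bullet> (B w *v (\<beta> d w - \<beta> c w))) = 0"
proof -
  obtain cA where cA: "0 \<le> cA" "\<And>x i j. x \<in> space M \<Longrightarrow> \<bar>A x $ i $ j\<bar> \<le> cA"
    using bounded_mat_nth[OF A(2)] by metis
  obtain cB where cB: "0 \<le> cB" "\<And>x i j. x \<in> space M \<Longrightarrow> \<bar>B x $ i $ j\<bar> \<le> cB"
    using bounded_mat_nth[OF B(2)] by metis
  let ?g = "\<lambda>k i j w. A w $ k $ i * B w $ k $ j * (\<beta> b w $ i - \<beta> a w $ i)"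
  let ?h = "\<lambda>j w. \<beta> d w $ j - \<beta> c w $ j"
  have Ac: "A \<in> borel_measurable (F c)" using t by (intro measurable_F_mono[OF _ _ A(1)]) auto
  have inc: "(\<lambda>w. \<beta> b w - \<beta> a w) \<in> borel_measurable (F c)"
    using t by (intro measurable_F_mono[OF _ _ measurable_increment]) auto
  have gF: "?g k i j \<in> borel_measurable (F c)" for k i j
    using borel_measurable_vec_nth[OF inc, of i] Ac B(1) by simp
  have gi: "integrable M (?g k i j)" for k i j
  proof (rule integrable_mult_bounded[where c = "cA * cB"])
    show "(\<lambda>w. A w $ k $ i * B w $ k $ j) \<in> borel_measurable M"
      using Ac B(1) t by (intro measurable_F_M[of c]) auto
  qed (use t cA cB in \<open>auto simp: integrable_increment abs_mult intro!: mult_mono\<close>)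
  have ind: "indep_var borel (?g k i j) borel (?h j)" for k i j
    using indep_var_increment[OF _ t(4) gF, of "\<lambda>x. x $ j"] t
    by (simp add: borel_measurable_vec_nth)
  have f: "?f = (\<lambda>w. \<Sum>k\<in>UNIV. \<Sum>i\<in>UNIV. \<Sum>j\<in>UNIV. ?g k i j w * ?h j w)"
    by (simp add: inner_matrix_vector_mult mult_ac)
  have I: "integrable M (\<lambda>w. ?g k i j w * ?h j w)" for k i j
    using indep_var_integrable[OF ind gi] t by (simp add: integrable_increment)
  have E: "expectation (\<lambda>w. ?g k i j w * ?h j w) = 0" for k i j
    using indep_var_lebesgue_integral[OF ind gi] t
    by (simp add: integrable_increment expectation_increment)
  show "integrable M ?f" unfolding f using I by (intro Bochner_Integration.integrable_sum) auto
  show "expectation ?f = 0" unfolding f using I E by simp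
qed

text \<open>The coefficients are known at time \<open>a\<close>, and only equal coordinates of the
  increment correlate, each with variance \<open>b - a\<close>. The surviving diagonal sum is the
  Frobenius inner product, which is the inner product of the matrix type, so the isometry holds in
  its norm.\<close>

lemma
  fixes A B :: "'a \<Rightarrow> real ^ 'd ^ 'd"
  assumes t: "0 \<le> a" "a \<le> b"
    and A: "A \<in> borel_measurable (F a)" "bounded (A ` space M)"
    and B: "B \<in> borel_measurable (F a)" "bounded (B ` space M)"
  shows integrable_inner_same:
      "integrable M (\<lambda>w. (A w *v (\<beta> b w - \<beta> a w)) \<bullet> (B w *v (\<beta> b w - \<beta> a w)))" (is "integrable M ?f")
    and expectation_inner_same:
      "expectation (\<lambda>w. (A w *v (\<beta> b w - \<beta> a w)) \<bullet> (B w *v (\<beta> b w - \<beta> a w)))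
        = (b - a) * expectation (\<lambda>w. A w \<bullet> B w)"
proof -
  obtain cA where cA: "0 \<le> cA" "\<And>x i j. x \<in> space M \<Longrightarrow> \<bar>A x $ i $ j\<bar> \<le> cA"
    using bounded_mat_nth[OF A(2)] by metis
  obtain cB where cB: "0 \<le> cB" "\<And>x i j. x \<in> space M \<Longrightarrow> \<bar>B x $ i $ j\<bar> \<le> cB"
    using bounded_mat_nth[OF B(2)] by metis
  let ?g = "\<lambda>k i j w. A w $ k $ i * B w $ k $ j"
  let ?h = "\<lambda>i j w. (\<beta> b w $ i - \<beta> a w $ i) * (\<beta> b w $ j - \<beta> a w $ j)"
  have gF: "?g k i j \<in> borel_measurable (F a)" for k i j
    using A B by simp
  have gi: "integrable M (?g k i j)" for k i j
    using measurable_F_M[OF _ gF[of k i j]] t cA cB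
    by (intro integrable_const_bound[where B = "cA * cB"])
      (auto simp: abs_mult intro!: AE_I2 mult_mono)
  have ind: "indep_var borel (?g k i j) borel (?h i j)" for k i j
    using indep_var_increment[OF _ t(2) gF, of "\<lambda>x. x $ i * x $ j" k i j] t by simp
  have f: "?f = (\<lambda>w. \<Sum>k\<in>UNIV. \<Sum>i\<in>UNIV. \<Sum>j\<in>UNIV. ?g k i j w * ?h i j w)"
    by (simp add: inner_matrix_vector_mult)
  have I: "integrable M (\<lambda>w. ?g k i j w * ?h i j w)" for k i j
    using indep_var_integrable[OF ind gi] t by (simp add: integrable_increment_mult)
  have E: "expectation (\<lambda>w. ?g k i j w * ?h i j w)
      = (if i = j then (b - a) * expectation (?g k i i) else 0)" for k i j
    using indep_var_lebesgue_integral[OF ind[of k i j] gi[of k i j]] t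
    by (simp add: integrable_increment_mult expectation_increment_mult)
  show "integrable M ?f" unfolding f using I by (intro Bochner_Integration.integrable_sum) auto
  have "expectation ?f = (\<Sum>k\<in>UNIV. \<Sum>i\<in>UNIV. (b - a) * expectation (?g k i i))"
    unfolding f using I E by simp
  also have "\<dots> = (b - a) * expectation (\<lambda>w. \<Sum>k\<in>UNIV. \<Sum>i\<in>UNIV. ?g k i i w)"
    using gi by (simp add: sum_distrib_left)
  finally show "expectation ?f = (b - a) * expectation (\<lambda>w. A w \<bullet> B w)"
    by (simp add: inner_vec_def)
qed

text \<open>Bilinearity cuts the intervals at \<open>c\<close> and at \<open>e = min b d\<close>:
  the common part \<open>(c, e]\<close> falls under the case of equal intervals, all other pairs of
  pieces are disjoint and contribute 0. Symmetry allows the assumption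
  \<open>a \<le> c\<close>.\<close>

lemma
  fixes A B :: "'a \<Rightarrow> real ^ 'd ^ 'd"
  assumes t: "0 \<le> a" "a \<le> b" "0 \<le> c" "c \<le> d"
    and A: "A \<in> borel_measurable (F a)" "bounded (A ` space M)"
    and B: "B \<in> borel_measurable (F c)" "bounded (B ` space M)"
  shows integrable_inner_increments:
      "integrable M (\<lambda>w. (A w *v (\<beta> b w - \<beta> a w)) \<bullet> (B w *v (\<beta> d w - \<beta> c w)))"
    and expectation_inner_increments:
      "expectation (\<lambda>w. (A w *v (\<beta> b w - \<beta> a w)) \<bullet> (B w *v (\<beta> d w - \<beta> c w)))
        = measure lborel ({a<..b} \<inter> {c<..d}) * expectation (\<lambda>w. A w \<bullet> B w)"
proof -
  let ?I = "\<lambda>A a b B c d. integrable M (\<lambda>w. (A w *v (\<beta> b w - \<beta> a w)) \<bullet> (B w *v (\<beta> d w - \<beta> c w)))"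
  let ?E = "\<lambda>A a b B c d. expectation (\<lambda>w. (A w *v (\<beta> b w - \<beta> a w)) \<bullet> (B w *v (\<beta> d w - \<beta> c w)))
        = measure lborel ({a<..b} \<inter> {c<..d}) * expectation (\<lambda>w. A w \<bullet> B w)"
  let ?P = "\<lambda>A a b B c d. ?I A a b B c d \<and> ?E A a b B c d"
  have ordered: "?P A a b B c d"
    if t: "0 \<le> a" "a \<le> b" "a \<le> c" "c \<le> d"
    and A: "A \<in> borel_measurable (F a)" "bounded (A ` space M)"
    and B: "B \<in> borel_measurable (F c)" "bounded (B ` space M)"
    for A B :: "'a \<Rightarrow> real ^ 'd ^ 'd" and a b c d
  proof (cases "b \<le> c")
    case True
    then have "{a<..b} \<inter> {c<..d} = {}" by auto
    then have "measure lborel ({a<..b} \<inter> {c<..d}) = 0" by (simp only: measure_empty)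
    then show ?thesis
      unfolding \<open>measure _ _ = 0\<close> using integrable_inner_disjoint[OF t(1,2) True t(4) A B]
        expectation_inner_disjoint[OF t(1,2) True t(4) A B] by simp
  next
    case False
    define e where "e = min b d"
    have e: "c \<le> e" "e \<le> b" "e \<le> d" using False t by (auto simp: e_def)
    have Ac: "A \<in> borel_measurable (F c)" using t by (intro measurable_F_mono[OF _ _ A(1)]) auto
    have Ae: "A \<in> borel_measurable (F e)" using t e by (intro measurable_F_mono[OF _ _ A(1)]) auto
    have Be: "B \<in> borel_measurable (F e)" using t e by (intro measurable_F_mono[OF _ _ B(1)]) auto
    let ?X = "\<lambda>A B a b c d w. (A w *v (\<beta> b w - \<beta> a w)) \<bullet> (B w *v (\<beta> d w - \<beta> c w))"
    have c0: "0 \<le> c" using t by simp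
    note p1 = integrable_inner_disjoint[OF t(1,3) order_refl t(4) A B]
      expectation_inner_disjoint[OF t(1,3) order_refl t(4) A B]
    note p2 = integrable_inner_same[OF c0 e(1) Ac A(2) B] expectation_inner_same[OF c0 e(1) Ac A(2) B]
    note p3 = integrable_inner_disjoint[OF c0 e(1) order_refl e(3) Ac A(2) Be B(2)]
      expectation_inner_disjoint[OF c0 e(1) order_refl e(3) Ac A(2) Be B(2)]
    \<comment> \<open>Past \<open>e\<close> either nothing of \<open>(a, b]\<close> is left, or
      \<open>e = d\<close> and the remainder begins where \<open>(c, d]\<close> ends. In the second
      case the two factors exchange roles.\<close>
    have p4: "integrable M (?X A B e b c d)" "expectation (?X A B e b c d) = 0"
    proof -
      have "?P A e b B c d"
      proof (cases "b \<le> d")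
        case True
        then have "e = b" by (simp add: e_def)
        then show ?thesis by simp
      next
        case False
        then have ed: "e = d" by (simp add: e_def)
        then show ?thesis
          using integrable_inner_disjoint[OF c0 t(4) _ _ B Ae A(2), of b]
            expectation_inner_disjoint[OF c0 t(4) _ _ B Ae A(2), of b] False
          by (simp add: inner_commute)
      qed
      moreover have "e = b \<or> {e<..b} \<inter> {c<..d} = {}" by (auto simp: e_def)
      ultimately show "integrable M (?X A B e b c d)" "expectation (?X A B e b c d) = 0" by auto
    qed
    have split: "?X A B a b c d = (\<lambda>w. ?X A B a c c d w + (?X A B c e c e w + ?X A B c e e d w) + ?X A B e b c d w)"
      by (simp add: matrix_vector_mult_diff_distrib algebra_simps inner_diff_left inner_diff_right)
    have "{a<..b} \<inter> {c<..d} = {c<..e}" using t e by (auto simp: e_def)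
    then have m: "measure lborel ({a<..b} \<inter> {c<..d}) = e - c" using e by simp
    show ?thesis
      unfolding m split using p1 p2 p3 p4 by simp
  qed
  have "?P A a b B c d"
  proof (cases "a \<le> c")
    case True
    then show ?thesis using ordered[OF t(1,2) True t(4) A B] by simp
  next
    case False
    then show ?thesis using ordered[OF t(3,4) _ t(2) B A] by (simp add: inner_commute Int_commute)
  qed
  then show "?I A a b B c d" "?E A a b B c d" by auto
qed

text \<open>The intervals may overlap, so that two elementary processes can be compared without a
  common refinement of their partitions.\<close>

lemma ito_isometry_sum:
  fixes A :: "'k \<Rightarrow> 'a \<Rightarrow> real ^ 'd ^ 'd"
  assumes "finite I"
    and t: "\<And>k. k \<in> I \<Longrightarrow> 0 \<le> a k \<and> a k \<le> b k"
    and A: "\<And>k. k \<in> I \<Longrightarrow> A k \<in> borel_measurable (F (a k))" "\<And>k. k \<in> I \<Longrightarrow> bounded (A k ` space M)"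
  shows "msq (\<lambda>w. \<Sum>k\<in>I. A k w *v (\<beta> (b k) w - \<beta> (a k) w))
    = (\<integral>\<^sup>+w. (\<integral>\<^sup>+r. nsq (\<Sum>k\<in>I. indicator {a k<..b k} r *\<^sub>R A k w) \<partial>lborel) \<partial>M)"
proof -
  let ?d = "\<lambda>k w. A k w *v (\<beta> (b k) w - \<beta> (a k) w)"
  let ?m = "\<lambda>k l. measure lborel ({a k<..b k} \<inter> {a l<..b l})"
  have AM: "A k \<in> borel_measurable M" if "k \<in> I" for k
    using t[OF that] A(1)[OF that] by (intro measurable_F_M) auto
  have Ai: "integrable M (\<lambda>w. A k w \<bullet> A l w)" if kl: "k \<in> I" "l \<in> I" for k l
  proof -
    obtain c where c: "0 < c" "\<And>w. w \<in> space M \<Longrightarrow> norm (A k w) \<le> c"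
      using A(2)[OF kl(1)] by (auto simp: bounded_pos)
    obtain c' where c': "0 < c'" "\<And>w. w \<in> space M \<Longrightarrow> norm (A l w) \<le> c'"
      using A(2)[OF kl(2)] by (auto simp: bounded_pos)
    show ?thesis
    proof (rule integrable_const_bound[where B = "c * c'"])
      show "AE w in M. norm (A k w \<bullet> A l w) \<le> c * c'"
        using c c' by (intro AE_I2) (auto intro!: order_trans[OF Cauchy_Schwarz_ineq2] mult_mono)
      show "(\<lambda>w. A k w \<bullet> A l w) \<in> borel_measurable M" using AM kl by simp
    qed
  qed
  \<comment> \<open>Both sides expand into the same double sum over pairs of intervals: the expected
    products of increments carry the overlap lengths that the integration of the indicators over
    \<open>r\<close> produces.\<close>
  have L: "(norm (\<Sum>k\<in>I. ?d k w))\<^sup>2 = (\<Sum>k\<in>I. \<Sum>l\<in>I. ?d k w \<bullet> ?d l w)" for w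
    unfolding power2_norm_eq_inner inner_sum_left inner_sum_right by (rule sum.swap)
  have Li: "integrable M (\<lambda>w. ?d k w \<bullet> ?d l w)" if "k \<in> I" "l \<in> I" for k l
    using t A that by (intro integrable_inner_increments) auto
  have LE: "expectation (\<lambda>w. ?d k w \<bullet> ?d l w) = ?m k l * expectation (\<lambda>w. A k w \<bullet> A l w)"
    if "k \<in> I" "l \<in> I" for k l
    using t A that by (intro expectation_inner_increments) auto
  have R: "(norm (\<Sum>k\<in>I. indicator {a k<..b k} r *\<^sub>R A k w))\<^sup>2
    = (\<Sum>k\<in>I. \<Sum>l\<in>I. indicator ({a k<..b k} \<inter> {a l<..b l}) r * (A k w \<bullet> A l w))" for r w
    unfolding power2_norm_eq_inner inner_sum_left inner_sum_right indicator_inter_arith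
    by (subst sum.swap) (simp add: mult_ac)
  have Ri: "integrable lborel (\<lambda>r. indicator ({a k<..b k} \<inter> {a l<..b l}) r * (x::real))" for k l x
  proof -
    have "emeasure lborel ({a k<..b k} \<inter> {a l<..b l}) < \<infinity>"
      by (rule emeasure_bounded_finite) (auto intro: bounded_Int)
    then show ?thesis by (intro integrable_mult_left integrable_real_indicator) auto
  qed
  have Rint: "integrable lborel (\<lambda>r. (norm (\<Sum>k\<in>I. indicator {a k<..b k} r *\<^sub>R A k w))\<^sup>2)" for w
    unfolding R by (intro Bochner_Integration.integrable_sum Ri)
  have Rval: "(\<integral>r. (norm (\<Sum>k\<in>I. indicator {a k<..b k} r *\<^sub>R A k w))\<^sup>2 \<partial>lborel)
      = (\<Sum>k\<in>I. \<Sum>l\<in>I. ?m k l * (A k w \<bullet> A l w))" for w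
    unfolding R using Ri by (simp del: Int_greaterThanAtMost)
  have Lint: "integrable M (\<lambda>w. (norm (\<Sum>k\<in>I. ?d k w))\<^sup>2)"
    unfolding L using Li by (intro Bochner_Integration.integrable_sum) auto
  have Aint: "integrable M (\<lambda>w. \<Sum>k\<in>I. \<Sum>l\<in>I. ?m k l * (A k w \<bullet> A l w))"
    using Ai by (intro Bochner_Integration.integrable_sum integrable_mult_right) auto
  have pos: "0 \<le> (\<Sum>k\<in>I. \<Sum>l\<in>I. ?m k l * (A k w \<bullet> A l w))" for w
    unfolding Rval[symmetric] by simp
  have "(\<integral>\<^sup>+w. (\<integral>\<^sup>+r. nsq (\<Sum>k\<in>I. indicator {a k<..b k} r *\<^sub>R A k w) \<partial>lborel) \<partial>M)
      = (\<integral>\<^sup>+w. ennreal (\<Sum>k\<in>I. \<Sum>l\<in>I. ?m k l * (A k w \<bullet> A l w)) \<partial>M)"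
    using nn_integral_eq_integral[OF Rint] by (simp add: Rval del: Int_greaterThanAtMost)
  also have "\<dots> = ennreal (expectation (\<lambda>w. \<Sum>k\<in>I. \<Sum>l\<in>I. ?m k l * (A k w \<bullet> A l w)))"
    using Aint pos by (intro nn_integral_eq_integral) auto
  also have "\<dots> = ennreal (expectation (\<lambda>w. (norm (\<Sum>k\<in>I. ?d k w))\<^sup>2))"
    unfolding L using Ai Li LE by (simp del: Int_greaterThanAtMost)
  also have "\<dots> = msq (\<lambda>w. \<Sum>k\<in>I. ?d k w)"
    using Lint by (intro nn_integral_eq_integral[symmetric]) auto
  finally show ?thesis by simp
qed

end

section \<open>Mean-square bounds for the Ito integral\<close>

text \<open>Moving both end points into \<open>[u, t]\<close> intersects a half-open interval with
  \<open>(u, t]\<close>, degenerate cases included. This restricts an elementary integral to a time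
  window.\<close>

lemma clamp_indicator:
  fixes u t a b r :: real
  shows "indicator {max u (min a t)<..max u (min b t)} r
    = (indicator {u<..t} r * indicator {a<..b} r :: real)"
  by (auto simp: indicator_def)

lemma nn_integral_nsq_triangle:
  assumes "(\<lambda>x. U x - V x) \<in> borel_measurable N" "(\<lambda>x. V x - W x) \<in> borel_measurable N"
  shows "(\<integral>\<^sup>+x. nsq (U x - W x) \<partial>N) \<le> 2 * (\<integral>\<^sup>+x. nsq (U x - V x) \<partial>N) + 2 * (\<integral>\<^sup>+x. nsq (V x - W x) \<partial>N)"
proof -
  have "(\<integral>\<^sup>+x. nsq (U x - W x) \<partial>N) \<le> (\<integral>\<^sup>+x. 2 * nsq (U x - V x) + 2 * nsq (V x - W x) \<partial>N)"
    by (intro nn_integral_mono nsq_triangle)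
  also have "\<dots> = 2 * (\<integral>\<^sup>+x. nsq (U x - V x) \<partial>N) + 2 * (\<integral>\<^sup>+x. nsq (V x - W x) \<partial>N)"
    using assms by (simp add: nn_integral_add nn_integral_cmult)
  finally show ?thesis .
qed

text \<open>Measurability is asked of the processes cut off to \<open>S\<close>, since progressive
  measurability controls a process on bounded time intervals only.\<close>

lemma nn_integral2_nsq_triangle:
  fixes U V W :: "real \<Rightarrow> 'a \<Rightarrow> 'b::{second_countable_topology, real_normed_vector}"
  assumes "(\<lambda>(w, r). indicator S r *\<^sub>R U r w) \<in> borel_measurable (N \<Otimes>\<^sub>M lborel)"
    and "(\<lambda>(w, r). indicator S r *\<^sub>R V r w) \<in> borel_measurable (N \<Otimes>\<^sub>M lborel)"
    and "(\<lambda>(w, r). indicator S r *\<^sub>R W r w) \<in> borel_measurable (N \<Otimes>\<^sub>M lborel)"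
  shows "(\<integral>\<^sup>+w. (\<integral>\<^sup>+r\<in>S. nsq (U r w - W r w) \<partial>lborel) \<partial>N)
    \<le> 2 * (\<integral>\<^sup>+w. (\<integral>\<^sup>+r\<in>S. nsq (U r w - V r w) \<partial>lborel) \<partial>N)
      + 2 * (\<integral>\<^sup>+w. (\<integral>\<^sup>+r\<in>S. nsq (V r w - W r w) \<partial>lborel) \<partial>N)"
proof -
  let ?d = "\<lambda>U V w r. indicator S r *\<^sub>R U r w - indicator S r *\<^sub>R (V r w :: 'b)"
  have eq: "nsq (U r w - V r w) * indicator S r = nsq (?d U V w r)" for U V :: "real \<Rightarrow> 'a \<Rightarrow> 'b" and r w
    by (auto simp: indicator_def)
  have m: "(\<lambda>(w, r). ?d U V w r) \<in> borel_measurable (N \<Otimes>\<^sub>M lborel)"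
    "(\<lambda>(w, r). ?d V W w r) \<in> borel_measurable (N \<Otimes>\<^sub>M lborel)"
    using borel_measurable_diff[OF assms(1,2)] borel_measurable_diff[OF assms(2,3)]
    by (simp_all add: case_prod_beta')
  have m1: "(\<lambda>r. ?d U V w r) \<in> borel_measurable lborel" "(\<lambda>r. ?d V W w r) \<in> borel_measurable lborel"
    if "w \<in> space N" for w
    using measurable_Pair2[OF m(1) that] measurable_Pair2[OF m(2) that] by simp_all
  have m2: "(\<lambda>w. \<integral>\<^sup>+r. nsq (?d U V w r) \<partial>lborel) \<in> borel_measurable N"
    "(\<lambda>w. \<integral>\<^sup>+r. nsq (?d V W w r) \<partial>lborel) \<in> borel_measurable N"
    using m[unfolded case_prod_beta'] by (intro lborel.borel_measurable_nn_integral; simp add: case_prod_beta')+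
  have "(\<integral>\<^sup>+w. (\<integral>\<^sup>+r. nsq (?d U W w r) \<partial>lborel) \<partial>N)
    \<le> (\<integral>\<^sup>+w. 2 * (\<integral>\<^sup>+r. nsq (?d U V w r) \<partial>lborel) + 2 * (\<integral>\<^sup>+r. nsq (?d V W w r) \<partial>lborel) \<partial>N)"
    using m1 by (intro nn_integral_mono nn_integral_nsq_triangle)
  also have "\<dots> = 2 * (\<integral>\<^sup>+w. (\<integral>\<^sup>+r. nsq (?d U V w r) \<partial>lborel) \<partial>N)
      + 2 * (\<integral>\<^sup>+w. (\<integral>\<^sup>+r. nsq (?d V W w r) \<partial>lborel) \<partial>N)"
    using m2 by (simp add: nn_integral_add nn_integral_cmult)
  finally show ?thesis unfolding eq .
qed

text \<open>Bookkeeping for a chain of triangle inequalities: \<open>e\<close> stands for an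
  approximation error that tends to 0 and \<open>D\<close> for the quantity that stays, so
  \<open>8 = 2 * 2 * 2\<close> becomes the constant of the increment bound.\<close>

lemma ennreal_double_triangle:
  fixes E a b c d e D :: ennreal
  assumes "E \<le> 2 * a + 2 * b" "b \<le> 2 * c + 2 * d" "c \<le> 2 * e + 2 * D" "d \<le> 4 * e"
  shows "E \<le> 2 * a + (24 * e + 8 * D)"
proof -
  have "b \<le> 2 * (2 * e + 2 * D) + 2 * (4 * e)"
    using assms(2) by (rule order_trans) (intro add_mono mult_left_mono assms; simp)
  then have "E \<le> 2 * a + 2 * (2 * (2 * e + 2 * D) + 2 * (4 * e))"
    by (intro order_trans[OF assms(1)] add_left_mono mult_left_mono) auto
  also have "2 * (2 * (2 * e + 2 * D) + 2 * (4 * e)) = 24 * e + 8 * D"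
    using distrib_right[of 8 16 e] by (simp add: distrib_left mult.assoc[symmetric] add_ac)
  finally show ?thesis .
qed

context usual_filtered_prob_space
begin

text \<open>Progressive measurability refers to \<open>F t\<close> on \<open>[0, t]\<close>.
  Enlarging \<open>F t\<close> to \<open>M\<close>, exchanging the coordinates and extending by 0
  gives a process on the whole product space, to which Fubini applies.\<close>

lemma progressively_measurable_joint:
  fixes X :: "real \<Rightarrow> 'a \<Rightarrow> 'b::{second_countable_topology, real_normed_vector}"
  assumes X: "progressively_measurable F X" and t: "0 \<le> t"
  shows "(\<lambda>(w, r). indicator {0..t} r *\<^sub>R X r w) \<in> borel_measurable MT"
proof -
  let ?\<Omega> = "space M \<times> {0..t}"
  let ?R = "restrict_space (M \<Otimes>\<^sub>M lborel) ?\<Omega>"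
  have 1: "(\<lambda>x. snd x) \<in> measurable ?R (restrict_space borel {0..t})"
    by (intro measurable_restrict_space2 measurable_restrict_space1)
      (auto simp: space_restrict_space)
  have id: "(\<lambda>w. w) \<in> measurable M (F t)"
    using subalgebra_F[OF t] by (auto simp: measurable_def subalgebra_def)
  have 2: "(\<lambda>x. fst x) \<in> measurable ?R (F t)"
    using measurable_compose[OF measurable_fst[of M lborel] id] by (rule measurable_restrict_space1)
  have P: "(\<lambda>(r, w). X r w) \<in> borel_measurable (restrict_space borel {0..t} \<Otimes>\<^sub>M F t)"
    using X t by (simp add: progressively_measurable_def)
  have "(\<lambda>(w, r). X r w) \<in> borel_measurable ?R"
    using measurable_compose[OF measurable_Pair[OF 1 2] P] by (simp add: case_prod_beta')
  then have "(\<lambda>x. indicator ?\<Omega> x *\<^sub>R (case x of (w, r) \<Rightarrow> X r w)) \<in> borel_measurable MT"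
    by (subst (asm) borel_measurable_restrict_space_iff) (auto simp: pair_measureI)
  then show ?thesis
    by (rule measurable_cong[THEN iffD1, rotated]) (auto simp: space_pair_measure indicator_def)
qed

lemma elementary_process_times:
  assumes "elementary_process M F m s \<xi>" "k \<le> m"
  shows "0 \<le> s k"
  using assms(2)
proof (induction k)
  case (Suc k)
  then have "s k \<le> s (Suc k)" using assms(1) by (auto simp: elementary_process_def)
  then show ?case using Suc by simp
qed (use assms in \<open>simp add: elementary_process_def\<close>)

lemma elementary_value_joint:
  fixes \<xi> :: "nat \<Rightarrow> 'a \<Rightarrow> real ^ 'd ^ 'd"
  assumes "elementary_process M F m s \<xi>" and [measurable]: "S \<in> sets borel"
  shows "(\<lambda>(w, r). indicator S r *\<^sub>R elementary_value m s \<xi> r w) \<in> borel_measurable MT"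
proof -
  have [measurable]: "\<xi> k \<in> borel_measurable M" if "k < m" for k
    using assms(1) that elementary_process_times[OF assms(1), of k]
    by (intro measurable_F_M[of "s k"]) (auto simp: elementary_process_def)
  show ?thesis
    unfolding elementary_value_def case_prod_beta'
    by (intro borel_measurable_scaleR borel_measurable_sum) auto
qed

lemma elementary_integral_0:
  assumes "elementary_process M F m s \<xi>"
  shows "elementary_integral \<beta> m s \<xi> 0 w = 0"
  using elementary_process_times[OF assms] by (simp add: elementary_integral_def)

end

context wiener_process
begin

lemma elementary_integral_measurable:
  assumes "elementary_process M F m s \<xi>" "0 \<le> t"
  shows "elementary_integral \<beta> m s \<xi> t \<in> borel_measurable M"
proof -
  have "\<xi> k \<in> borel_measurable M" if "k < m" for k
    using assms(1) that elementary_process_times[OF assms(1), of k]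
    by (intro measurable_F_M[of "s k"]) (auto simp: elementary_process_def)
  moreover have "\<beta> (min (s k) t) \<in> borel_measurable M" if "k \<le> m" for k
    using assms(2) elementary_process_times[OF assms(1) that]
    by (intro measurable_F_M[OF _ adapted]) auto
  ultimately show ?thesis
    unfolding elementary_integral_def
    by (intro borel_measurable_sum borel_measurable_matrix_vector_mult borel_measurable_diff) auto
qed

text \<open>Clamping the times to \<open>[u, t]\<close> removes the part before \<open>u\<close>;
  the extra summand \<open>\<beta> u\<close> drops out of each difference.\<close>

lemma elementary_integral_diff:
  assumes "u \<le> t"
  shows "elementary_integral \<beta> m s \<xi> t w - elementary_integral \<beta> m s \<xi> u w
    = (\<Sum>k<m. \<xi> k w *v (\<beta> (max u (min (s (Suc k)) t)) w - \<beta> (max u (min (s k) t)) w))"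
proof -
  have "\<beta> (max u (min x t)) w = \<beta> (min x t) w - \<beta> (min x u) w + \<beta> u w" for x
    using assms by (cases "x \<le> u") (auto simp: min_def max_def)
  then show ?thesis
    unfolding elementary_integral_def sum_subtractf[symmetric]
    by (intro sum.cong) (simp_all add: matrix_vector_mult_diff_distrib)
qed

text \<open>Both processes, restricted to \<open>(u, t]\<close>, are written as one family of
  increments indexed by the disjoint sum of their index sets, the second with opposite sign; then
  \<open>ito_isometry_sum\<close> applies.\<close>

lemma ito_isometry_elementary:
  assumes X: "elementary_process M F m s \<xi>" and Y: "elementary_process M F m' s' \<xi>'"
    and t: "0 \<le> u" "u \<le> t"
  shows "msq (\<lambda>w. (elementary_integral \<beta> m s \<xi> t w - elementary_integral \<beta> m s \<xi> u w)
      - (elementary_integral \<beta> m' s' \<xi>' t w - elementary_integral \<beta> m' s' \<xi>' u w))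
    = msq_on {u..t} (\<lambda>r w. elementary_value m s \<xi> r w - elementary_value m' s' \<xi>' r w)"
proof -
  define c where "c x = max u (min x t)" for x
  have c_mono: "c x \<le> c y" if "x \<le> y" for x y
    unfolding c_def using that by (intro max.mono min.mono order_refl)
  have c_nonneg: "0 \<le> c x" for x
    unfolding c_def using t by (simp add: le_max_iff_disj)
  have c_ge: "c x = max u t" if "t \<le> x" for x
    unfolding c_def using that by simp
  have c_le: "x \<le> c x" if "x < t" for x
    unfolding c_def using that by simp
  define I where "I = {..<m} <+> {..<m'}"
  define a where "a = case_sum (\<lambda>k. c (s k)) (\<lambda>k. c (s' k))"
  define b where "b = case_sum (\<lambda>k. c (s (Suc k))) (\<lambda>k. c (s' (Suc k)))"
  \<comment> \<open>Coefficients of intervals that start at \<open>t\<close> or later are set to 0: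
    their clamped increment vanishes, and \<open>\<xi> k\<close> need not be measurable at the
    clamped time, which may precede \<open>s k\<close>.\<close>
  define A where "A = case_sum (\<lambda>k w. if s k < t then \<xi> k w else 0) (\<lambda>k w. if s' k < t then - \<xi>' k w else 0)"
  have Xk: "s k \<le> s (Suc k)" "\<xi> k \<in> borel_measurable (F (s k))" "bounded (\<xi> k ` space M)" "0 \<le> s k"
    if "k < m" for k
    using X that elementary_process_times[OF X, of k] by (auto simp: elementary_process_def)
  have Yk: "s' k \<le> s' (Suc k)" "\<xi>' k \<in> borel_measurable (F (s' k))" "bounded (\<xi>' k ` space M)" "0 \<le> s' k"
    if "k < m'" for k
    using Y that elementary_process_times[OF Y, of k] by (auto simp: elementary_process_def)
  have I_cases: thesis
    if "k \<in> I" "\<And>i. k = Inl i \<Longrightarrow> i < m \<Longrightarrow> thesis" "\<And>i. k = Inr i \<Longrightarrow> i < m' \<Longrightarrow> thesis" for k thesis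
    using that unfolding I_def by blast
  have ab: "0 \<le> a k \<and> a k \<le> b k" if "k \<in> I" for k
    using that by (rule I_cases) (simp_all add: a_def b_def c_mono c_nonneg Xk Yk)
  have Am: "A k \<in> borel_measurable (F (a k))" if "k \<in> I" for k
    using that
  proof (rule I_cases)
    fix i assume i: "k = Inl i" "i < m"
    show ?thesis
    proof (cases "s i < t")
      case True
      then show ?thesis
        using measurable_F_mono[OF Xk(4)[OF i(2)] c_le[OF True] Xk(2)[OF i(2)]] by (simp add: A_def a_def i)
    qed (simp add: A_def i)
  next
    fix i assume i: "k = Inr i" "i < m'"
    show ?thesis
    proof (cases "s' i < t")
      case True
      then show ?thesis
        using measurable_F_mono[OF Yk(4)[OF i(2)] c_le[OF True] Yk(2)[OF i(2)]] by (simp add: A_def a_def i)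
    qed (simp add: A_def i)
  qed
  have Ab: "bounded (A k ` space M)" if "k \<in> I" for k
    using that
  proof (rule I_cases)
    fix i assume i: "k = Inl i" "i < m"
    then show ?thesis using Xk(3)[of i] by (cases "s i < t") (auto simp: A_def bounded_iff)
  next
    fix i assume i: "k = Inr i" "i < m'"
    then show ?thesis using Yk(3)[of i] by (cases "s' i < t") (auto simp: A_def bounded_iff)
  qed
  have sum_I: "(\<Sum>k\<in>I. g k) = (\<Sum>k<m. g (Inl k)) + (\<Sum>k<m'. g (Inr k))" for g :: "nat + nat \<Rightarrow> 'z::comm_monoid_add"
    unfolding I_def by (subst sum.Plus) auto
  have "(\<Sum>k\<in>I. A k w *v (\<beta> (b k) w - \<beta> (a k) w))
      = (elementary_integral \<beta> m s \<xi> t w - elementary_integral \<beta> m s \<xi> u w)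
      - (elementary_integral \<beta> m' s' \<xi>' t w - elementary_integral \<beta> m' s' \<xi>' u w)" for w
  proof -
    have "A (Inl k) w *v (\<beta> (b (Inl k)) w - \<beta> (a (Inl k)) w)
      = \<xi> k w *v (\<beta> (c (s (Suc k))) w - \<beta> (c (s k)) w)" if "k < m" for k
      using Xk(1)[OF that] by (cases "s k < t") (simp_all add: A_def a_def b_def c_ge)
    moreover have "A (Inr k) w *v (\<beta> (b (Inr k)) w - \<beta> (a (Inr k)) w)
      = - (\<xi>' k w *v (\<beta> (c (s' (Suc k))) w - \<beta> (c (s' k)) w))" if "k < m'" for k
      using Yk(1)[OF that]
      by (cases "s' k < t") (simp_all add: A_def a_def b_def c_ge vec_eq_iff matrix_vector_mult_def sum_negf)
    ultimately show ?thesis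
      unfolding elementary_integral_diff[OF t(2)] sum_I c_def[symmetric] by (simp add: sum_negf)
  qed
  moreover have "(\<Sum>k\<in>I. indicator {a k<..b k} r *\<^sub>R A k w)
      = indicator {u<..t} r *\<^sub>R (elementary_value m s \<xi> r w - elementary_value m' s' \<xi>' r w)" for r w
  proof -
    have "(indicator {a (Inl k)<..b (Inl k)} r :: real) *\<^sub>R A (Inl k) w
      = indicator {u<..t} r *\<^sub>R indicator {s k<..s (Suc k)} r *\<^sub>R \<xi> k w" for k
      unfolding a_def b_def sum.case c_def clamp_indicator A_def by (simp add: indicator_def)
    moreover have "(indicator {a (Inr k)<..b (Inr k)} r :: real) *\<^sub>R A (Inr k) w
      = - (indicator {u<..t} r *\<^sub>R indicator {s' k<..s' (Suc k)} r *\<^sub>R \<xi>' k w)" for k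
      unfolding a_def b_def sum.case c_def clamp_indicator A_def by (simp add: indicator_def)
    ultimately show ?thesis
      unfolding elementary_value_def sum_I
      by (simp only: sum_negf scaleR_sum_right scaleR_diff_right add_uminus_conv_diff)
  qed
  ultimately have "msq (\<lambda>w. (elementary_integral \<beta> m s \<xi> t w - elementary_integral \<beta> m s \<xi> u w)
      - (elementary_integral \<beta> m' s' \<xi>' t w - elementary_integral \<beta> m' s' \<xi>' u w))
    = (\<integral>\<^sup>+w. (\<integral>\<^sup>+r. nsq (indicator {u<..t} r *\<^sub>R (elementary_value m s \<xi> r w - elementary_value m' s' \<xi>' r w)) \<partial>lborel) \<partial>M)"
    using ito_isometry_sum[of I a b A] ab Am Ab by (simp add: I_def)
  also have "\<dots> = msq_on {u..t} (\<lambda>r w. elementary_value m s \<xi> r w - elementary_value m' s' \<xi>' r w)"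
  \<comment> \<open>The isometry yields \<open>(u, t]\<close>; the closed interval differs from it
    by the null set \<open>{u}\<close>.\<close>
  proof (rule nn_integral_cong, rule nn_integral_cong_AE)
    fix w
    show "AE r in lborel. nsq (indicator {u<..t} r *\<^sub>R (elementary_value m s \<xi> r w - elementary_value m' s' \<xi>' r w))
      = nsq (elementary_value m s \<xi> r w - elementary_value m' s' \<xi>' r w) * indicator {u..t} r"
      using AE_lborel_singleton[of u] by eventually_elim (auto simp: indicator_def)
  qed
  finally show ?thesis .
qed

text \<open>An approximating elementary integral of \<open>J\<close> is inserted, the isometry is
  applied to the two elementary processes, and then \<open>X\<close> is inserted between them. The
  approximation errors vanish in the limit, and two triangle inequalities leave the factor 4. A
  sharper constant would not change the rate.\<close>

lemma ito_integral_elementary_le: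
  assumes J: "has_ito_integral M F \<beta> X t J" and t: "0 \<le> t" and E: "elementary_process M F m s \<xi>"
  shows "msq (\<lambda>w. J w - elementary_integral \<beta> m s \<xi> t w)
    \<le> 4 * msq_on {0..t} (\<lambda>r w. X r w - elementary_value m s \<xi> r w)" (is "_ \<le> 4 * ?D")
proof -
  obtain mm ss x where x: "\<And>j. elementary_process M F (mm j) (ss j) (x j)"
    and "(\<lambda>j. \<integral>\<^sup>+w. (\<integral>\<^sup>+r\<in>{0..t}. nsq (elementary_value (mm j) (ss j) (x j) r w - X r w) \<partial>lborel) \<partial>M) \<longlonglongrightarrow> 0" (is "?e1 \<longlonglongrightarrow> 0")
    and "(\<lambda>j. \<integral>\<^sup>+w. nsq (elementary_integral \<beta> (mm j) (ss j) (x j) t w - J w) \<partial>M) \<longlonglongrightarrow> 0" (is "?e2 \<longlonglongrightarrow> 0")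
    using J unfolding has_ito_integral_def by blast
  have JM: "J \<in> borel_measurable M"
    using J t by (intro measurable_F_M[of t]) (auto simp: has_ito_integral_def)
  have XM: "(\<lambda>(w, r). indicator {0..t} r *\<^sub>R X r w) \<in> borel_measurable MT"
    using J t by (intro progressively_measurable_joint) (auto simp: has_ito_integral_def)
  have le: "msq (\<lambda>w. J w - elementary_integral \<beta> m s \<xi> t w) \<le> 2 * ?e2 j + (4 * ?e1 j + 4 * ?D)" for j
  proof -
    let ?I = "elementary_integral \<beta> (mm j) (ss j) (x j)" and ?K = "elementary_integral \<beta> m s \<xi>"
    let ?V = "elementary_value (mm j) (ss j) (x j)" and ?W = "elementary_value m s \<xi>"
    have "msq (\<lambda>w. J w - ?K t w)
      \<le> 2 * msq (\<lambda>w. J w - ?I t w) + 2 * msq (\<lambda>w. ?I t w - ?K t w)"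
      using JM elementary_integral_measurable[OF x t] elementary_integral_measurable[OF E t]
      by (intro nn_integral_nsq_triangle) auto
    also have "msq (\<lambda>w. J w - ?I t w) = ?e2 j"
      by (simp add: norm_minus_commute)
    also have "msq (\<lambda>w. ?I t w - ?K t w) = msq_on {0..t} (\<lambda>r w. ?V r w - ?W r w)"
      using ito_isometry_elementary[OF x[of j] E order_refl t]
      by (simp add: elementary_integral_0[OF x] elementary_integral_0[OF E])
    also have "\<dots> \<le> 2 * ?e1 j + 2 * ?D"
      using elementary_value_joint[OF x, of "{0..t}"] elementary_value_joint[OF E, of "{0..t}"] XM
      by (intro nn_integral2_nsq_triangle) auto
    finally show ?thesis
      by (simp add: distrib_left mult.assoc[symmetric] mult_left_mono)
  qed
  have "(\<lambda>j. 2 * ?e2 j + (4 * ?e1 j + 4 * ?D)) \<longlonglongrightarrow> 2 * 0 + (4 * 0 + 4 * ?D)"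
    by (intro tendsto_add tendsto_const ennreal_tendsto_cmult \<open>?e1 \<longlonglongrightarrow> 0\<close> \<open>?e2 \<longlonglongrightarrow> 0\<close>) auto
  then have "(\<lambda>j. 2 * ?e2 j + (4 * ?e1 j + 4 * ?D)) \<longlonglongrightarrow> 4 * ?D" by simp
  then show ?thesis
    by (rule LIMSEQ_le_const) (use le in blast)
qed

text \<open>\<open>Js\<close> and \<open>Jt\<close> are limits along unrelated approximations, and
  additivity in time is not built into \<open>has_ito_integral\<close>. The approximations of
  \<open>Jt\<close> therefore serve for both times, and \<open>ito_integral_elementary_le\<close>
  controls their distance from \<open>Js\<close>.\<close>

lemma ito_integral_increment_le:
  assumes Js: "has_ito_integral M F \<beta> X s Js" and Jt: "has_ito_integral M F \<beta> X t Jt"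
    and t: "0 \<le> s" "s \<le> t"
  shows "msq (\<lambda>w. Jt w - Js w) \<le> 8 * msq_on {s..t} (\<lambda>r w. X r w)"
    (is "_ \<le> 8 * ?D")
proof -
  have t0: "0 \<le> t" using t by simp
  obtain mm ss x where x: "\<And>j. elementary_process M F (mm j) (ss j) (x j)"
    and "(\<lambda>j. \<integral>\<^sup>+w. (\<integral>\<^sup>+r\<in>{0..t}. nsq (elementary_value (mm j) (ss j) (x j) r w - X r w) \<partial>lborel) \<partial>M) \<longlonglongrightarrow> 0" (is "?e1 \<longlonglongrightarrow> 0")
    and "(\<lambda>j. \<integral>\<^sup>+w. nsq (elementary_integral \<beta> (mm j) (ss j) (x j) t w - Jt w) \<partial>M) \<longlonglongrightarrow> 0" (is "?e2 \<longlonglongrightarrow> 0")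
    using Jt unfolding has_ito_integral_def by blast
  have JM: "Jt \<in> borel_measurable M" "Js \<in> borel_measurable M"
    using Jt Js t t0 by (auto simp: has_ito_integral_def intro: measurable_F_M[of t Jt] measurable_F_M[of s Js])
  have XM: "(\<lambda>(w, r). indicator {0..t} r *\<^sub>R X r w) \<in> borel_measurable MT"
    using Jt t0 by (intro progressively_measurable_joint) (auto simp: has_ito_integral_def)
  have "(\<lambda>(w, r). indicator {s..t} r *\<^sub>R (indicator {0..t} r *\<^sub>R X r w)) \<in> borel_measurable MT"
    using XM unfolding case_prod_beta' by (rule borel_measurable_scaleR[rotated]) measurable
  also have "(\<lambda>(w, r). indicator {s..t} r *\<^sub>R (indicator {0..t} r *\<^sub>R X r w)) = (\<lambda>(w, r). indicator {s..t} r *\<^sub>R X r w)"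
    using t by (auto simp: fun_eq_iff indicator_def)
  finally have XM': "(\<lambda>(w, r). indicator {s..t} r *\<^sub>R X r w) \<in> borel_measurable MT" .
  \<comment> \<open>The empty elementary process turns the isometry for differences into one for a
    single process.\<close>
  have e0: "elementary_process M F 0 (\<lambda>_. 0) (\<lambda>_ _. 0 :: real ^ 'd ^ 'd)"
    by (simp add: elementary_process_def)
  have le: "msq (\<lambda>w. Jt w - Js w) \<le> 2 * ?e2 j + (24 * ?e1 j + 8 * ?D)" for j
  proof -
    let ?I = "elementary_integral \<beta> (mm j) (ss j) (x j)"
    let ?V = "elementary_value (mm j) (ss j) (x j)"
    note I = elementary_integral_measurable[OF x]
    have 1: "msq (\<lambda>w. Jt w - Js w)
      \<le> 2 * msq (\<lambda>w. Jt w - ?I t w) + 2 * msq (\<lambda>w. ?I t w - Js w)"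
      using JM I t t0 by (intro nn_integral_nsq_triangle) auto
    have 2: "msq (\<lambda>w. ?I t w - Js w)
      \<le> 2 * msq (\<lambda>w. ?I t w - ?I s w) + 2 * msq (\<lambda>w. ?I s w - Js w)"
      using JM I t t0 by (intro nn_integral_nsq_triangle) auto
    have le_e1: "msq_on S (\<lambda>r w. ?V r w - X r w) \<le> ?e1 j"
      if "S \<subseteq> {0..t}" for S
      using that by (intro nn_integral_mono mult_left_mono) (auto simp: indicator_def)
    have "msq (\<lambda>w. ?I t w - ?I s w)
        = msq_on {s..t} (\<lambda>r w. ?V r w - 0)"
      using ito_isometry_elementary[OF x[of j] e0 t]
      by (simp add: elementary_integral_def[of _ 0] elementary_value_def[of 0])
    also have "\<dots> \<le> 2 * msq_on {s..t} (\<lambda>r w. ?V r w - X r w)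
        + 2 * msq_on {s..t} (\<lambda>r w. X r w - 0)"
      using elementary_value_joint[OF x, of "{s..t}"] XM'
      by (intro nn_integral2_nsq_triangle) auto
    also have "\<dots> \<le> 2 * ?e1 j + 2 * ?D"
      using t by (intro add_mono mult_left_mono le_e1) auto
    finally have 3: "msq (\<lambda>w. ?I t w - ?I s w) \<le> 2 * ?e1 j + 2 * ?D" .
    have "msq (\<lambda>w. ?I s w - Js w)
        \<le> 4 * msq_on {0..s} (\<lambda>r w. ?V r w - X r w)"
      using ito_integral_elementary_le[OF Js t(1) x[of j]] by (simp add: norm_minus_commute)
    also have "\<dots> \<le> 4 * ?e1 j"
      using t by (intro mult_left_mono le_e1) auto
    finally have 4: "msq (\<lambda>w. ?I s w - Js w) \<le> 4 * ?e1 j" .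
    have 5: "msq (\<lambda>w. Jt w - ?I t w) = ?e2 j"
      by (simp add: norm_minus_commute)
    show ?thesis
      using 1[unfolded 5] 2 3 4 by (rule ennreal_double_triangle)
  qed
  have "(\<lambda>j. 2 * ?e2 j + (24 * ?e1 j + 8 * ?D)) \<longlonglongrightarrow> 2 * 0 + (24 * 0 + 8 * ?D)"
    by (intro tendsto_add tendsto_const ennreal_tendsto_cmult \<open>?e1 \<longlonglongrightarrow> 0\<close> \<open>?e2 \<longlonglongrightarrow> 0\<close>) auto
  then have "(\<lambda>j. 2 * ?e2 j + (24 * ?e1 j + 8 * ?D)) \<longlonglongrightarrow> 8 * ?D" by simp
  then show ?thesis
    by (rule LIMSEQ_le_const) (use le in blast)
qed

end

section \<open>Exponential averages\<close>

text \<open>Approximation of \<open>t\<close> from below by countably many times. It underlies the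
  joint measurability of continuous processes and the passage from an equation holding almost surely
  at each time to one holding almost surely at all times.\<close>

lemma floor_grid_tendsto:
  fixes t :: real
  shows "(\<lambda>n. real_of_int \<lfloor>t * real (Suc n)\<rfloor> / real (Suc n)) \<longlonglongrightarrow> t"
proof (rule LIMSEQ_I)
  let ?s = "\<lambda>n t. real_of_int \<lfloor>t * real (Suc n)\<rfloor> / real (Suc n)"
  fix r :: real assume "0 < r"
  then obtain N where N: "inverse (real (Suc N)) < r" using reals_Archimedean by blast
  have "\<bar>?s n t - t\<bar> < r" if "N \<le> n" for n
  proof -
    have 1: "\<bar>real_of_int \<lfloor>t * real (Suc n)\<rfloor> - t * real (Suc n)\<bar> \<le> 1" by linarith
    have "?s n t - t = (real_of_int \<lfloor>t * real (Suc n)\<rfloor> - t * real (Suc n)) * inverse (real (Suc n))"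
      by (simp add: field_simps del: of_nat_Suc)
    then have "\<bar>?s n t - t\<bar> = \<bar>real_of_int \<lfloor>t * real (Suc n)\<rfloor> - t * real (Suc n)\<bar> * inverse (real (Suc n))"
      by (simp only: abs_mult) simp
    also have "\<dots> \<le> 1 * inverse (real (Suc n))"
      using 1 by (rule mult_right_mono) simp
    also have "\<dots> = inverse (real (Suc n))" by simp
    also have "\<dots> \<le> inverse (real (Suc N))" using that by (intro le_imp_inverse_le) auto
    finally show ?thesis using N by simp
  qed
  then show "\<exists>N. \<forall>n\<ge>N. norm (?s n t - t) < r" by auto
qed

text \<open>By continuity, a pointwise limit of processes read off at grid times, each of which
  involves only countably many of the variables \<open>X t\<close>.\<close>

lemma continuous_process_joint_measurable:
  fixes X :: "real \<Rightarrow> 'a \<Rightarrow> 'b::{second_countable_topology, real_normed_vector}"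
  assumes X: "\<And>t. X t \<in> borel_measurable M"
    and cont: "\<And>w. w \<in> space M \<Longrightarrow> continuous_on UNIV (\<lambda>t. X t w)"
  shows "(\<lambda>(w, t). X t w) \<in> borel_measurable (M \<Otimes>\<^sub>M lborel)"
proof (rule borel_measurable_LIMSEQ_metric)
  let ?s = "\<lambda>n t. real_of_int \<lfloor>t * real (Suc n)\<rfloor> / real (Suc n)"
  fix n :: nat
  have [measurable]: "X t \<in> borel_measurable M" for t by (rule X)
  have "(\<lambda>x. X (real_of_int \<lfloor>snd x * real (Suc n)\<rfloor> / real (Suc n)) (fst x)) \<in> borel_measurable (M \<Otimes>\<^sub>M lborel)"
    by (rule measurable_compose_countable[where f="\<lambda>i x. X (real_of_int i / real (Suc n)) (fst x)"]) measurable
  then show "(\<lambda>x. X (?s n (snd x)) (fst x)) \<in> borel_measurable (M \<Otimes>\<^sub>M lborel)" .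
next
  let ?s = "\<lambda>n t. real_of_int \<lfloor>t * real (Suc n)\<rfloor> / real (Suc n)"
  fix x :: "'a \<times> real" assume "x \<in> space (M \<Otimes>\<^sub>M lborel)"
  then have w: "fst x \<in> space M" by (auto simp: space_pair_measure)
  have "(\<lambda>n. X (?s n (snd x)) (fst x)) \<longlonglongrightarrow> X (snd x) (fst x)"
    using cont[OF w] floor_grid_tendsto[of "snd x"]
    by (intro continuous_on_tendsto_compose[where s=UNIV and f="\<lambda>t. X t (fst x)"]) (auto simp del: of_nat_Suc)
  then show "(\<lambda>n. X (?s n (snd x)) (fst x)) \<longlonglongrightarrow> (case x of (w, t) \<Rightarrow> X t w)"
    by (simp add: case_prod_beta')
qed

definition expo :: "real measure"
  where "expo = density lborel (exponential_density 1)"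

lemma sets_expo [simp, measurable_cong]: "sets expo = sets borel"
  by (simp add: expo_def)

lemma space_expo [simp]: "space expo = UNIV"
  by (simp add: expo_def)

interpretation expo: prob_space expo
  unfolding expo_def by (rule prob_space_exponential_density) simp

lemma AE_expo_nonneg: "AE u in expo. 0 \<le> u"
  unfolding expo_def by (subst AE_density) (auto simp: exponential_density_def intro!: AE_I2)

lemma integral_expo:
  fixes g :: "real \<Rightarrow> 'b::{banach, second_countable_topology}"
  assumes "g \<in> borel_measurable borel"
  shows "(\<integral>u. g u \<partial>expo) = (\<integral>u. (indicator {0..} u * exp (- u)) *\<^sub>R g u \<partial>lborel)"
proof -
  have "(\<integral>u. g u \<partial>expo) = (\<integral>u. exponential_density 1 u *\<^sub>R g u \<partial>lborel)"
    unfolding expo_def using assms by (intro integral_density) (auto simp: exponential_density_def)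
  also have "\<dots> = (\<integral>u. (indicator {0..} u * exp (- u)) *\<^sub>R g u \<partial>lborel)"
    by (intro Bochner_Integration.integral_cong) (auto simp: exponential_density_def indicator_def)
  finally show ?thesis .
qed

text \<open>The mean of the bound \<open>1 + u\<close> for the distance of the coupled times, in
  units of the step.\<close>

lemma nn_integral_expo_1_plus: "(\<integral>\<^sup>+u. ennreal (1 + u) \<partial>expo) = 2"
proof -
  have "(\<integral>\<^sup>+u. ennreal u \<partial>expo) = (\<integral>\<^sup>+u. ennreal (erlang_density 0 1 u * u ^ 1) \<partial>lborel)"
    unfolding expo_def
    by (subst nn_integral_density) (auto simp: ennreal_mult' intro!: nn_integral_cong)
  also have "\<dots> = 1" by (subst nn_integral_erlang_ith_moment) auto
  finally have 1: "(\<integral>\<^sup>+u. ennreal u \<partial>expo) = 1" .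
  have "(\<integral>\<^sup>+u. ennreal (1 + u) \<partial>expo) = (\<integral>\<^sup>+u. 1 + ennreal u \<partial>expo)"
    using AE_expo_nonneg by (intro nn_integral_cong_AE) auto
  also have "\<dots> = 2" by (subst nn_integral_add) (auto simp: 1 expo.emeasure_space_1[simplified])
  finally show ?thesis .
qed

lemma measure_expo_interval:
  assumes "0 \<le> a" "a \<le> b"
  shows "measure expo {a..<b} = exp (- a) - exp (- b)"
proof -
  have "measure expo {a..<b} = (\<integral>u. indicator {a..<b} u \<partial>expo)" by simp
  also have "\<dots> = (\<integral>u. (indicator {0..} u * exp (- u)) *\<^sub>R indicator {a..<b} u \<partial>lborel)"
    by (rule integral_expo) simp
  also have "\<dots> = (\<integral>u. exp (- u) * indicator {a..b} u \<partial>lborel)"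
    using AE_lborel_singleton[of b] assms
    by (intro integral_cong_AE) (auto simp: indicator_def elim!: eventually_mono)
  also have "\<dots> = (- exp (- b)) - (- exp (- a))"
    using assms by (intro integral_FTC_Icc_real) (auto intro!: derivative_eq_intros continuous_intros)
  finally show ?thesis by simp
qed

text \<open>By definition of \<open>Y\<close>, the equation \<open>q' = p / eps\<close> reads
  \<open>eps\<^sup>2 q' + q = a + eps b + Y\<close>, a linear relaxation. Its variation-of-constants
  formula, in the reversed and rescaled time \<open>t - eps\<^sup>2 * u\<close>, is an average over
  the exponential law.\<close>

lemma relaxation_exponential_average:
  fixes q p Y :: "real \<Rightarrow> 'b::euclidean_space"
  assumes "0 < eps" "0 \<le> t"
    and q: "continuous_on {0..} q" and p: "continuous_on {0..} p"
    and eq: "\<And>t. 0 \<le> t \<Longrightarrow> q t = a + integral {0..t} (\<lambda>r. (1 / eps) *\<^sub>R p r)"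
    and Y: "\<And>t. Y t = eps *\<^sub>R p (max t 0) - eps *\<^sub>R b + q (max t 0) - a" and Y0: "Y 0 = 0"
  shows "q t - a = (1 - exp (- (t / eps\<^sup>2))) *\<^sub>R (eps *\<^sub>R b) + (\<integral>u. Y (t - eps\<^sup>2 * u) \<partial>expo)"
proof -
  define r where "r = eps *\<^sub>R b"
  define h where "h u = t - eps\<^sup>2 * u" for u
  \<comment> \<open>In the derivative of \<open>\<Phi>\<close> the momentum recombines with the
    position into \<open>Y\<close>, leaving \<open>- exp (- u) *\<^sub>R Y (h u)\<close>.\<close>
  define \<Phi> where "\<Phi> u = exp (- u) *\<^sub>R (q (h u) - a - r)" for u
  define S where "S = t / eps\<^sup>2"
  have S: "0 \<le> S" "h S = 0" "h 0 = t" using assms by (auto simp: S_def h_def)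
  have h_range: "h u \<in> {0..t}" if "u \<in> {0..S}" for u
    using that assms by (auto simp: h_def S_def field_simps)
  have dq: "(q has_vector_derivative (1 / eps) *\<^sub>R p s) (at s within {0..t})" if "s \<in> {0..t}" for s
  proof -
    have "((\<lambda>s. integral {0..s} (\<lambda>r. (1 / eps) *\<^sub>R p r)) has_vector_derivative (1 / eps) *\<^sub>R p s) (at s within {0..t})"
      using that by (intro integral_has_vector_derivative continuous_intros continuous_on_subset[OF p]) auto
    then have "((\<lambda>s. a + integral {0..s} (\<lambda>r. (1 / eps) *\<^sub>R p r)) has_vector_derivative (1 / eps) *\<^sub>R p s) (at s within {0..t})"
      by (rule has_vector_derivative_eq_rhs[OF has_vector_derivative_add[OF has_vector_derivative_const]]) simp
    then show ?thesis
      by (rule has_vector_derivative_transform[OF that, rotated]) (use eq in auto)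
  qed
  have d\<Phi>: "(\<Phi> has_vector_derivative - (exp (- u) *\<^sub>R Y (h u))) (at u within {0..S})" if u: "u \<in> {0..S}" for u
  proof -
    have dh: "(h has_vector_derivative (- eps\<^sup>2)) (at u within {0..S})"
      unfolding h_def by (auto intro!: derivative_eq_intros simp: has_real_derivative_iff_has_vector_derivative[symmetric])
    have "(q has_vector_derivative (1 / eps) *\<^sub>R p (h u)) (at (h u) within h ` {0..S})"
      using h_range by (intro has_vector_derivative_within_subset[OF dq[OF h_range[OF u]]]) blast
    from vector_diff_chain_within[OF dh this]
    have dqh: "((\<lambda>u. q (h u)) has_vector_derivative (- eps\<^sup>2) *\<^sub>R (1 / eps) *\<^sub>R p (h u)) (at u within {0..S})"
      by (simp add: o_def)
    have de: "((\<lambda>u. exp (- u)) has_real_derivative - exp (- u)) (at u within {0..S})"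
      by (auto intro!: derivative_eq_intros)
    have "(\<Phi> has_vector_derivative exp (- u) *\<^sub>R ((- eps\<^sup>2) *\<^sub>R (1 / eps) *\<^sub>R p (h u)) + (- exp (- u)) *\<^sub>R (q (h u) - a - r)) (at u within {0..S})"
      unfolding \<Phi>_def
      using has_vector_derivative_scaleR[OF de, of "\<lambda>u. q (h u) - a - r" "(- eps\<^sup>2) *\<^sub>R (1 / eps) *\<^sub>R p (h u)"] dqh
      by (simp add: has_vector_derivative_diff_const)
    moreover have "exp (- u) *\<^sub>R ((- eps\<^sup>2) *\<^sub>R (1 / eps) *\<^sub>R p (h u)) + (- exp (- u)) *\<^sub>R (q (h u) - a - r)
        = - (exp (- u) *\<^sub>R Y (h u))"
      using h_range[OF u] assms(1) by (simp add: Y r_def power2_eq_square algebra_simps)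
    ultimately show ?thesis by simp
  qed
  have Y_cont: "continuous_on UNIV Y"
    unfolding Y by (intro continuous_intros continuous_on_compose2[OF q] continuous_on_compose2[OF p]) auto
  have Yh_cont: "continuous_on A (\<lambda>u. Y (h u))" for A
    unfolding h_def by (intro continuous_intros continuous_on_compose2[OF Y_cont]) auto
  have "(\<integral>u. indicator {0..S} u *\<^sub>R - (exp (- u) *\<^sub>R Y (h u)) \<partial>lborel) = \<Phi> S - \<Phi> 0"
    using S d\<Phi> by (intro integral_FTC_Icc continuous_intros Yh_cont) auto
  also have "\<dots> = (1 - exp (- S)) *\<^sub>R r - (q t - a)"
    using eq[of 0] S by (simp add: \<Phi>_def algebra_simps)
  finally have 1: "(\<integral>u. indicator {0..S} u *\<^sub>R - (exp (- u) *\<^sub>R Y (h u)) \<partial>lborel) = (1 - exp (- S)) *\<^sub>R r - (q t - a)" .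
  have "(\<integral>u. Y (h u) \<partial>expo) = (\<integral>u. (indicator {0..} u * exp (- u)) *\<^sub>R Y (h u) \<partial>lborel)"
    using Yh_cont[of UNIV] by (intro integral_expo borel_measurable_continuous_onI)
  also have "\<dots> = (\<integral>u. - (indicator {0..S} u *\<^sub>R - (exp (- u) *\<^sub>R Y (h u))) \<partial>lborel)"
  proof (intro Bochner_Integration.integral_cong refl)
    fix u
    \<comment> \<open>Past \<open>S\<close> the shifted time is negative, where the extension of
      \<open>Y\<close> vanishes; so the average over all \<open>u\<close> reduces to an integral
      over \<open>{0..S}\<close>.\<close>
    have "Y (h u) = 0" if "S < u"
    proof -
      have "h u < 0" using that assms by (simp add: h_def S_def field_simps)
      then have "Y (h u) = Y 0" by (simp add: Y)
      then show ?thesis using Y0 by simp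
    qed
    then show "(indicator {0..} u * exp (- u)) *\<^sub>R Y (h u) = - (indicator {0..S} u *\<^sub>R - (exp (- u) *\<^sub>R Y (h u)))"
      by (cases "u \<le> S") (auto simp: indicator_def)
  qed
  also have "\<dots> = - ((1 - exp (- S)) *\<^sub>R r - (q t - a))"
    by (simp only: Bochner_Integration.integral_minus 1)
  finally show ?thesis by (simp add: h_def S_def r_def)
qed

text \<open>Unrolling the recursion produces the weights
  \<open>\<alpha> ^ i * (1 - \<alpha>)\<close> with \<open>\<alpha> = exp (- l)\<close>, which are
  the probabilities that the floor of \<open>u / l\<close> equals \<open>i\<close>. Truncated
  subtraction sends every \<open>i \<ge> n\<close> to \<open>Y 0 = 0\<close>, the discrete
  counterpart of extending \<open>Y\<close> to negative times.\<close>

lemma euler_exponential_average: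
  fixes D Y :: "nat \<Rightarrow> 'b::{banach, second_countable_topology}"
  assumes "0 < l" "D 0 = 0" "Y 0 = 0"
    and rec: "\<And>k. k < n \<Longrightarrow> D (Suc k) = exp (- l) *\<^sub>R D k + (1 - exp (- l)) *\<^sub>R (r + Y (Suc k))"
  shows "D n = (1 - exp (- l) ^ n) *\<^sub>R r + (\<integral>u. Y (n - nat \<lfloor>u / l\<rfloor>) \<partial>expo)"
proof -
  define \<alpha> where "\<alpha> = exp (- l)"
  have sum: "D m = (1 - \<alpha> ^ m) *\<^sub>R r + (\<Sum>i<m. (\<alpha> ^ i * (1 - \<alpha>)) *\<^sub>R Y (m - i))" if "m \<le> n" for m
    using that
  proof (induction m)
    case (Suc m)
    have "D (Suc m) = \<alpha> *\<^sub>R ((1 - \<alpha> ^ m) *\<^sub>R r + (\<Sum>i<m. (\<alpha> ^ i * (1 - \<alpha>)) *\<^sub>R Y (m - i)))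
        + (1 - \<alpha>) *\<^sub>R (r + Y (Suc m))"
      using rec[of m] Suc by (simp add: \<alpha>_def)
    \<comment> \<open>The newest value \<open>Y (Suc m)\<close> belongs to \<open>i = 0\<close>, so
      the sum is extended at its lower end.\<close>
    then show ?case
      by (subst sum.lessThan_Suc_shift) (simp add: algebra_simps scaleR_sum_right)
  qed (simp add: assms)
  have meas: "measure expo {real i * l..<real (Suc i) * l} = \<alpha> ^ i * (1 - \<alpha>)" for i
    using measure_expo_interval[of "real i * l" "real (Suc i) * l"] assms(1)
    by (simp add: \<alpha>_def exp_of_nat_mult[symmetric] exp_add[symmetric] algebra_simps)
  have "(\<integral>u. Y (n - nat \<lfloor>u / l\<rfloor>) \<partial>expo)
      = (\<integral>u. (\<Sum>i<n. indicator {real i * l..<real (Suc i) * l} u *\<^sub>R Y (n - i)) \<partial>expo)"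
  proof (rule integral_cong_AE)
    show "AE u in expo. Y (n - nat \<lfloor>u / l\<rfloor>) = (\<Sum>i<n. indicator {real i * l..<real (Suc i) * l} u *\<^sub>R Y (n - i))"
      using AE_expo_nonneg
    proof eventually_elim
      case (elim u)
      define j where "j = nat \<lfloor>u / l\<rfloor>"
      have "u \<in> {real i * l..<real (Suc i) * l} \<longleftrightarrow> i = j" for i
      proof -
        have "u \<in> {real i * l..<real (Suc i) * l} \<longleftrightarrow> real i \<le> u / l \<and> u / l < real i + 1"
          using assms(1) by (auto simp: field_simps)
        also have "\<dots> \<longleftrightarrow> \<lfloor>u / l\<rfloor> = int i" by (simp add: floor_eq_iff)
        also have "\<dots> \<longleftrightarrow> i = j" using elim assms(1) by (auto simp: j_def)
        finally show ?thesis .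
      qed
      then have "(\<Sum>i<n. indicator {real i * l..<real (Suc i) * l} u *\<^sub>R Y (n - i)) = (\<Sum>i<n. if i = j then Y (n - i) else 0)"
        by (intro sum.cong) (auto simp: indicator_def simp del: of_nat_Suc atLeastLessThan_iff)
      also have "\<dots> = Y (n - j)" using assms(3) by simp
      finally show ?case by (simp add: j_def)
    qed
    show "(\<lambda>u. \<Sum>i<n. indicator {real i * l..<real (Suc i) * l} u *\<^sub>R Y (n - i)) \<in> borel_measurable expo"
      by (intro borel_measurable_sum borel_measurable_scaleR) auto
  qed auto
  also have "\<dots> = (\<Sum>i<n. (\<alpha> ^ i * (1 - \<alpha>)) *\<^sub>R Y (n - i))"
  proof -
    have int: "integrable expo (indicator {x..<y} :: real \<Rightarrow> real)" for x y
      by (intro integrable_real_indicator) (auto simp: expo.emeasure_finite less_top[symmetric])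
    have "(\<integral>u. indicator {real i * l..<real (Suc i) * l} u *\<^sub>R Y (n - i) \<partial>expo)
        = (\<alpha> ^ i * (1 - \<alpha>)) *\<^sub>R Y (n - i)" for i
      using int by (subst integral_scaleR_left) (auto simp: meas simp del: of_nat_Suc)
    moreover have "integrable expo (\<lambda>u. indicator {real i * l..<real (Suc i) * l} u *\<^sub>R Y (n - i))" for i
      using int by (intro integrable_scaleR_left) auto
    ultimately show ?thesis
      by (simp only: Bochner_Integration.integral_sum)
  qed
  finally show ?thesis using sum[of n] by (simp add: \<alpha>_def)
qed

section \<open>The Langevin equation\<close>

lemma set_nn_integral_eq_integral_cont:
  fixes u :: "real \<Rightarrow> real"
  assumes "continuous_on {a..b} u" "\<And>r. r \<in> {a..b} \<Longrightarrow> 0 \<le> u r"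
  shows "(\<integral>\<^sup>+r\<in>{a..b}. ennreal (u r) \<partial>lborel) = ennreal (integral {a..b} u)"
proof -
  have i: "integrable lborel (\<lambda>r. indicator {a..b} r *\<^sub>R u r)"
    using assms(1) by (intro borel_integrable_compact) auto
  have "(\<integral>\<^sup>+r\<in>{a..b}. ennreal (u r) \<partial>lborel) = (\<integral>\<^sup>+r. ennreal (indicator {a..b} r *\<^sub>R u r) \<partial>lborel)"
    by (intro nn_integral_cong) (auto simp: indicator_def)
  also have "\<dots> = ennreal (LINT r:{a..b}|lborel. u r)"
    unfolding set_lebesgue_integral_def using i assms(2)
    by (intro nn_integral_eq_integral) (auto simp: indicator_def)
  also have "\<dots> = ennreal (integral {a..b} u)"
    using i by (subst set_borel_integral_eq_integral(2)) (auto simp: set_integrable_def)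
  finally show ?thesis .
qed

text \<open>One fixed \<open>eps\<close>; the coefficients enter through a common Lipschitz constant
  \<open>L\<close>, the bound \<open>c0\<close> at the origin and the bound \<open>S\<close>. All
  constants derived here are explicit, so that uniformity in \<open>eps\<close> can be checked at
  the end.\<close>

locale langevin = wiener_process M F \<beta>
  for M :: "'a measure" and F and \<beta> :: "real \<Rightarrow> 'a \<Rightarrow> real ^ 'd" +
  fixes f :: "real ^ 'd \<Rightarrow> real ^ 'd" and \<sigma> :: "real ^ 'd \<Rightarrow> real ^ 'd ^ 'd"
    and L c0 S eps T :: real and a b :: "real ^ 'd" and q p :: "real \<Rightarrow> 'a \<Rightarrow> real ^ 'd"
  assumes pos: "0 \<le> L" "0 \<le> c0" "0 \<le> S" "0 < eps" "0 < T"
    and f_lip: "norm (f x - f y) \<le> L * norm (x - y)"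
    and \<sigma>_lip: "norm (\<sigma> x - \<sigma> y) \<le> L * norm (x - y)"
    and f_0: "norm (f 0) \<le> c0" and \<sigma>_bound: "norm (\<sigma> x) \<le> S"
    and sol: "langevin_solution M F \<beta> f \<sigma> eps a b q p"
begin

lemma f_cont: "continuous_on UNIV f" and \<sigma>_cont: "continuous_on UNIV \<sigma>"
  using lipschitz_imp_continuous[OF f_lip pos(1)] lipschitz_imp_continuous[OF \<sigma>_lip pos(1)] .

lemma nsq_f_le: "nsq (f x) \<le> ennreal (2 * c0\<^sup>2) + ennreal (2 * L\<^sup>2) * nsq x"
proof -
  have "nsq (f x) \<le> 2 * nsq (f 0) + 2 * nsq (f x - f 0)"
    using nsq_add_le[of "f 0" "f x - f 0"] by simp
  also have "\<dots> \<le> 2 * ennreal (c0\<^sup>2) + 2 * ennreal ((L * norm x)\<^sup>2)"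
    using f_lip[of x 0] f_0 by (intro add_mono mult_left_mono ennreal_leI power_mono) auto
  also have "\<dots> = ennreal (2 * c0\<^sup>2) + ennreal (2 * L\<^sup>2) * nsq x"
    by (simp add: ennreal_mult' ennreal_mult power_mult_distrib mult.assoc)
  finally show ?thesis .
qed

lemma nsq_f_diff_le: "nsq (f x - f y) \<le> ennreal (L\<^sup>2) * nsq (x - y)"
  using f_lip[of x y] pos by (simp flip: ennreal_mult power_mult_distrib add: power_mono ennreal_leI)

lemma nsq_\<sigma>_diff_le: "nsq (\<sigma> x - \<sigma> y) \<le> ennreal (L\<^sup>2) * nsq (x - y)"
  using \<sigma>_lip[of x y] pos by (simp flip: ennreal_mult power_mult_distrib add: power_mono ennreal_leI)

lemma nsq_\<sigma>_le: "nsq (\<sigma> x) \<le> ennreal (S\<^sup>2)"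
  using \<sigma>_bound[of x] by (intro ennreal_leI power_mono) auto

lemma q_measurable: "0 \<le> t \<Longrightarrow> q t \<in> borel_measurable M"
  and p_measurable: "0 \<le> t \<Longrightarrow> p t \<in> borel_measurable M"
  using sol measurable_F_M[of t "q t" borel] measurable_F_M[of t "p t" borel]
  unfolding langevin_solution_def by blast+

lemma q_cont: "w \<in> space M \<Longrightarrow> continuous_on {0..} (\<lambda>t. q t w)"
  and p_cont: "w \<in> space M \<Longrightarrow> continuous_on {0..} (\<lambda>t. p t w)"
  using sol unfolding langevin_solution_def by blast+

definition Y :: "real \<Rightarrow> 'a \<Rightarrow> real ^ 'd"
  where "Y t w = eps *\<^sub>R p (max t 0) w - eps *\<^sub>R b + q (max t 0) w - a"

lemma Y_measurable [measurable]: "Y t \<in> borel_measurable M"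
  unfolding Y_def by (intro borel_measurable_diff borel_measurable_add borel_measurable_scaleR
    borel_measurable_const q_measurable p_measurable) auto

lemma q_max_cont: "w \<in> space M \<Longrightarrow> continuous_on UNIV (\<lambda>t. q (max t 0) w)"
  by (rule continuous_on_compose2[OF q_cont]) (auto intro!: continuous_intros)

lemma Y_cont: "w \<in> space M \<Longrightarrow> continuous_on UNIV (\<lambda>t. Y t w)"
  unfolding Y_def
  by (intro continuous_intros q_max_cont continuous_on_compose2[OF p_cont]) auto

lemma Y_joint: "(\<lambda>(w, t). Y t w) \<in> borel_measurable MT"
  by (intro continuous_process_joint_measurable Y_cont) auto

lemma q_joint: "(\<lambda>(w, t). q (max t 0) w) \<in> borel_measurable MT"
  by (intro continuous_process_joint_measurable q_max_cont q_measurable) auto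

lemma Y_max: "Y (max t 0) = Y t"
  by (simp add: Y_def fun_eq_iff)

text \<open>The equation holds almost surely at each fixed time, hence on a countable grid at once,
  and then at all times because both sides have continuous paths.\<close>

lemma AE_q_eq:
  "AE w in M. \<forall>t\<ge>0. q t w = a + integral {0..t} (\<lambda>r. (1 / eps) *\<^sub>R p r w)"
proof -
  have "AE w in M. \<forall>k n. q (real k / real (Suc n)) w
      = a + integral {0..real k / real (Suc n)} (\<lambda>r. (1 / eps) *\<^sub>R p r w)"
    using sol unfolding langevin_solution_def by (intro AE_all_countable[THEN iffD2] allI) auto
  then show ?thesis
    using AE_space
  proof eventually_elim
    case (elim w)
    show ?case
    proof (intro allI impI)
      fix t :: real assume t: "0 \<le> t"
      let ?I = "\<lambda>t. a + integral {0..t} (\<lambda>r. (1 / eps) *\<^sub>R p r w)"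
      let ?s = "\<lambda>n. real_of_int \<lfloor>t * real (Suc n)\<rfloor> / real (Suc n)"
      have s: "?s n \<in> {0..t}" for n
        using t by (auto simp: divide_le_eq simp del: of_nat_Suc)
      have lim: "?s \<longlonglongrightarrow> t" by (rule floor_grid_tendsto)
      have qc: "continuous_on {0..t} (\<lambda>t. q t w)"
        using q_cont[OF elim(2)] by (rule continuous_on_subset) auto
      have Ic: "continuous_on {0..t} ?I"
        using p_cont[OF elim(2)]
        by (intro continuous_intros indefinite_integral_continuous_1 integrable_continuous_real)
          (auto intro: continuous_on_subset)
      have "(\<lambda>n. q (?s n) w) \<longlonglongrightarrow> q t w"
        using t s by (intro continuous_on_tendsto_compose[OF qc lim]) auto
      moreover have "(\<lambda>n. ?I (?s n)) \<longlonglongrightarrow> ?I t"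
        using t s by (intro continuous_on_tendsto_compose[OF Ic lim]) auto
      moreover have "q (?s n) w = ?I (?s n)" for n
        using elim(1)[rule_format, of "nat \<lfloor>t * real (Suc n)\<rfloor>" n] t by (simp del: of_nat_Suc)
      ultimately show "q t w = ?I t" by (auto intro: LIMSEQ_unique simp del: of_nat_Suc)
    qed
  qed
qed

abbreviation diffusion :: "real \<Rightarrow> 'a \<Rightarrow> real ^ 'd ^ 'd"
  where "diffusion \<equiv> (\<lambda>r w. (1 / eps) *\<^sub>R \<sigma> (q r w))"

text \<open>Multiplied by \<open>eps\<close>, the friction term of the momentum equation is
  \<open>- (1 / eps)\<close> times the integral of \<open>p\<close>, which cancels the displacement
  \<open>q t - a\<close>. This removal of the singular terms is the reason for
  \<open>Y\<close>.\<close>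

lemma ex_ito:
  "\<exists>J. \<forall>t\<ge>0. has_ito_integral M F \<beta> diffusion t (J t) \<and>
    (AE w in M. Y t w = integral {0..t} (\<lambda>r. f (q r w)) + eps *\<^sub>R J t w)"
proof -
  obtain J where J: "\<And>t. 0 \<le> t \<Longrightarrow> has_ito_integral M F \<beta> diffusion t (J t)"
    and eq: "\<And>t. 0 \<le> t \<Longrightarrow> AE w in M. p t w = b
          - integral {0..t} (\<lambda>r. (1 / eps\<^sup>2) *\<^sub>R p r w)
          + integral {0..t} (\<lambda>r. (1 / eps) *\<^sub>R f (q r w)) + J t w"
    using sol unfolding langevin_solution_def by blast
  have "AE w in M. Y t w = integral {0..t} (\<lambda>r. f (q r w)) + eps *\<^sub>R J t w" if t: "0 \<le> t" for t
    using eq[OF t] AE_q_eq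
  proof eventually_elim
    case (elim w)
    have 1: "q t w - a = (1 / eps) *\<^sub>R integral {0..t} (\<lambda>r. p r w)" using elim(2) t by simp
    have 2: "eps *\<^sub>R p t w = eps *\<^sub>R b - (1 / eps) *\<^sub>R integral {0..t} (\<lambda>r. p r w)
      + integral {0..t} (\<lambda>r. f (q r w)) + eps *\<^sub>R J t w"
      using pos by (subst elim(1)) (simp add: algebra_simps power2_eq_square)
    show ?case using t 1 2 by (simp add: Y_def)
  qed
  with J show ?thesis by (intro exI[of _ J]) blast
qed

text \<open>A choice of stochastic integrals, made once for the whole locale. Nothing is claimed
  about its paths.\<close>

definition ito :: "real \<Rightarrow> 'a \<Rightarrow> real ^ 'd"
  where "ito = (SOME J. \<forall>t\<ge>0. has_ito_integral M F \<beta> diffusion t (J t) \<and>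
    (AE w in M. Y t w = integral {0..t} (\<lambda>r. f (q r w)) + eps *\<^sub>R J t w))"

lemma
  assumes "0 \<le> t"
  shows has_ito: "has_ito_integral M F \<beta> diffusion t (ito t)"
    and Y_ito: "AE w in M. Y t w = integral {0..t} (\<lambda>r. f (q r w)) + eps *\<^sub>R ito t w"
  using someI_ex[OF ex_ito, folded ito_def] assms by blast+

text \<open>The initial condition, too, holds only almost surely. The Ito integral up to time 0 is
  compared with the empty elementary process; the bounding time integral runs over a null
  set.\<close>

lemma AE_Y_0: "AE w in M. Y 0 w = 0"
proof -
  note J = has_ito[OF order_refl] and Y = Y_ito[OF order_refl]
  have JM: "ito 0 \<in> borel_measurable M"
    using J by (intro measurable_F_M[of 0]) (auto simp: has_ito_integral_def)
  have e0: "elementary_process M F 0 (\<lambda>_. 0) (\<lambda>_ _. 0 :: real ^ 'd ^ 'd)"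
    by (simp add: elementary_process_def)
  have z: "(\<integral>\<^sup>+r\<in>{0..0::real}. g r \<partial>lborel) = 0" for g :: "real \<Rightarrow> ennreal"
  proof -
    have "(\<integral>\<^sup>+r\<in>{0..0::real}. g r \<partial>lborel) = (\<integral>\<^sup>+r. 0 \<partial>(lborel :: real measure))"
      using AE_lborel_singleton[of "0::real"] by (intro nn_integral_cong_AE) (auto elim!: eventually_mono)
    then show ?thesis by simp
  qed
  have "msq (\<lambda>w. ito 0 w) \<le> 0"
    using ito_integral_elementary_le[OF J order_refl e0] unfolding z by (simp add: elementary_integral_def)
  then have "AE w in M. nsq (ito 0 w) = 0"
    using JM by (subst (asm) le_zero_eq, subst (asm) nn_integral_0_iff_AE) auto
  with Y show ?thesis by eventually_elim simp
qed

lemma AE_q_average: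
  "AE w in M. \<forall>t\<ge>0. q t w - a = (1 - exp (- (t / eps\<^sup>2))) *\<^sub>R (eps *\<^sub>R b) + (\<integral>u. Y (t - eps\<^sup>2 * u) w \<partial>expo)"
  using AE_q_eq AE_Y_0 AE_space
proof eventually_elim
  case (elim w)
  then show ?case
    using pos by (intro allI impI relaxation_exponential_average[OF _ _ q_cont p_cont]) (auto simp: Y_def)
qed

lemma f_q_cont: "w \<in> space M \<Longrightarrow> A \<subseteq> {0..} \<Longrightarrow> continuous_on A (\<lambda>r. f (q r w))"
  by (intro continuous_on_compose2[OF f_cont] continuous_on_subset[OF q_cont]) auto

lemma nsq_drift_le:
  assumes "w \<in> space M" "0 \<le> s" "s \<le> t"
  shows "nsq (integral {s..t} (\<lambda>r. f (q r w))) \<le> ennreal (t - s) * (\<integral>\<^sup>+r\<in>{s..t}. nsq (f (q r w)) \<partial>lborel)"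
  using assms by (intro nsq_integral_interval_le f_q_cont) auto

lemma q_joint_set [measurable]:
  assumes "g \<in> borel_measurable borel" "A \<in> sets borel" "A \<subseteq> {0..}"
  shows "(\<lambda>(w, r). g (q r w) * indicator A r :: ennreal) \<in> borel_measurable MT"
proof -
  have "(\<lambda>x. g (case x of (w, r) \<Rightarrow> q (max r 0) w) * indicator A (snd x)) \<in> borel_measurable MT"
    using assms(2)
    by (intro borel_measurable_times_ennreal measurable_compose[OF q_joint assms(1)]
      measurable_compose[OF measurable_snd borel_measurable_indicator]) simp
  also have "(\<lambda>x. g (case x of (w, r) \<Rightarrow> q (max r 0) w) * indicator A (snd x)) = (\<lambda>(w, r). g (q r w) * indicator A r)"
    using assms(3) by (auto simp: fun_eq_iff indicator_def max_def)
  finally show ?thesis .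
qed

lemma nn_integral_q_swap:
  assumes "g \<in> borel_measurable borel" "A \<in> sets borel" "A \<subseteq> {0..}"
  shows "(\<integral>\<^sup>+w. (\<integral>\<^sup>+r\<in>A. g (q r w) \<partial>lborel) \<partial>M) = (\<integral>\<^sup>+r\<in>A. (\<integral>\<^sup>+w. g (q r w) \<partial>M) \<partial>lborel)"
proof -
  interpret pair_sigma_finite lborel M ..
  have "(\<integral>\<^sup>+w. (\<integral>\<^sup>+r\<in>A. g (q r w) \<partial>lborel) \<partial>M) = (\<integral>\<^sup>+r. (\<integral>\<^sup>+w. g (q r w) * indicator A r \<partial>M) \<partial>lborel)"
    using measurable_compose[OF measurable_pair_swap' q_joint_set[OF assms]]
    by (intro Fubini') (simp add: case_prod_beta')
  also have "\<dots> = (\<integral>\<^sup>+r\<in>A. (\<integral>\<^sup>+w. g (q r w) \<partial>M) \<partial>lborel)"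
    using assms q_measurable by (intro nn_integral_cong) (auto simp: indicator_def)
  finally show ?thesis .
qed

text \<open>The factor \<open>eps\<close> in \<open>Y\<close> compensates the \<open>1 / eps\<close>
  in \<open>diffusion\<close>; the bound on \<open>\<sigma>\<close> then gives a constant free of
  \<open>eps\<close>.\<close>

lemma ito_\<sigma>_increment_le:
  assumes "has_ito_integral M F \<beta> diffusion s Js"
    and "has_ito_integral M F \<beta> diffusion t Jt" "0 \<le> s" "s \<le> t"
  shows "msq (\<lambda>w. eps *\<^sub>R (Jt w - Js w)) \<le> ennreal (8 * S\<^sup>2 * (t - s))"
proof -
  have JM: "Jt \<in> borel_measurable M" "Js \<in> borel_measurable M"
    using assms by (auto simp: has_ito_integral_def intro: measurable_F_M[of t Jt] measurable_F_M[of s Js])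
  have "msq_on {s..t} (\<lambda>r w. (1 / eps) *\<^sub>R \<sigma> (q r w))
      \<le> (\<integral>\<^sup>+w. (\<integral>\<^sup>+r\<in>{s..t}. ennreal (S\<^sup>2 / eps\<^sup>2) \<partial>lborel) \<partial>M)"
  proof (intro nn_integral_mono mult_right_mono)
    fix r w
    have "nsq ((1 / eps) *\<^sub>R \<sigma> (q r w)) \<le> ennreal ((1 / eps)\<^sup>2) * ennreal (S\<^sup>2)"
      unfolding nsq_scaleR by (intro mult_left_mono nsq_\<sigma>_le) auto
    also have "\<dots> = ennreal (S\<^sup>2 / eps\<^sup>2)" by (simp flip: ennreal_mult add: power_divide)
    finally show "nsq ((1 / eps) *\<^sub>R \<sigma> (q r w)) \<le> ennreal (S\<^sup>2 / eps\<^sup>2)" .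
  qed auto
  also have "\<dots> = ennreal (S\<^sup>2 / eps\<^sup>2 * (t - s))"
    using assms by (simp add: nn_integral_cmult_indicator emeasure_space_1 ennreal_mult[symmetric])
  finally have 1: "msq_on {s..t} (\<lambda>r w. (1 / eps) *\<^sub>R \<sigma> (q r w)) \<le> ennreal (S\<^sup>2 / eps\<^sup>2 * (t - s))" .
  have "msq (\<lambda>w. eps *\<^sub>R (Jt w - Js w)) = ennreal (eps\<^sup>2) * msq (\<lambda>w. Jt w - Js w)"
    unfolding nsq_scaleR using JM by (intro nn_integral_cmult) auto
  also have "\<dots> \<le> ennreal (eps\<^sup>2) * (8 * ennreal (S\<^sup>2 / eps\<^sup>2 * (t - s)))"
    using order_trans[OF ito_integral_increment_le[OF assms] mult_left_mono[OF 1]]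
    by (intro mult_left_mono) auto
  also have "\<dots> = ennreal (eps\<^sup>2 * (8 * (S\<^sup>2 / eps\<^sup>2 * (t - s))))"
  proof -
    have "ennreal x * (8 * ennreal y) = ennreal (x * (8 * y))" if "0 \<le> x" "0 \<le> y" for x y
      using that by (simp add: ennreal_mult)
    then show ?thesis using assms by simp
  qed
  also have "eps\<^sup>2 * (8 * (S\<^sup>2 / eps\<^sup>2 * (t - s))) = 8 * S\<^sup>2 * (t - s)" using pos by simp
  finally show ?thesis .
qed

lemma Y_increment_le:
  assumes st: "0 \<le> s" "s \<le> t"
  shows "msq (\<lambda>w. Y t w - Y s w)
    \<le> 2 * (ennreal (t - s) * (\<integral>\<^sup>+r\<in>{s..t}. (msq (\<lambda>w. f (q r w))) \<partial>lborel)) + 2 * ennreal (8 * S\<^sup>2 * (t - s))"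
proof -
  have t: "0 \<le> t" using st by simp
  have JM [measurable]: "ito t \<in> borel_measurable M" "ito s \<in> borel_measurable M"
    using has_ito[OF t] has_ito[OF st(1)] t st by (auto simp: has_ito_integral_def intro: measurable_F_M[of t "ito t"] measurable_F_M[of s "ito s"])
  have fb: "(\<lambda>x. nsq (f x)) \<in> borel_measurable borel"
    using borel_measurable_continuous_onI[OF f_cont] by measurable
  have dm [measurable]: "(\<lambda>w. \<integral>\<^sup>+r\<in>{s..t}. nsq (f (q r w)) \<partial>lborel) \<in> borel_measurable M"
    using q_joint_set[OF fb, of "{s..t}"] st by (intro lborel.borel_measurable_nn_integral) auto
  have "msq (\<lambda>w. Y t w - Y s w)
    \<le> (\<integral>\<^sup>+w. 2 * (ennreal (t - s) * (\<integral>\<^sup>+r\<in>{s..t}. nsq (f (q r w)) \<partial>lborel)) + 2 * nsq (eps *\<^sub>R (ito t w - ito s w)) \<partial>M)"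
  proof (rule nn_integral_mono_AE)
    show "AE w in M. nsq (Y t w - Y s w)
      \<le> 2 * (ennreal (t - s) * (\<integral>\<^sup>+r\<in>{s..t}. nsq (f (q r w)) \<partial>lborel)) + 2 * nsq (eps *\<^sub>R (ito t w - ito s w))"
      using Y_ito[OF t] Y_ito[OF st(1)] AE_space
    proof eventually_elim
      case (elim w)
      have "integral {0..s} (\<lambda>r. f (q r w)) + integral {s..t} (\<lambda>r. f (q r w)) = integral {0..t} (\<lambda>r. f (q r w))"
        using st elim by (intro Henstock_Kurzweil_Integration.integral_combine integrable_continuous_real f_q_cont) auto
      then have "Y t w - Y s w = integral {s..t} (\<lambda>r. f (q r w)) + eps *\<^sub>R (ito t w - ito s w)"
        unfolding elim by (simp add: algebra_simps)
      then have "nsq (Y t w - Y s w) \<le> 2 * nsq (integral {s..t} (\<lambda>r. f (q r w))) + 2 * nsq (eps *\<^sub>R (ito t w - ito s w))"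
        using nsq_add_le by metis
      also have "\<dots> \<le> 2 * (ennreal (t - s) * (\<integral>\<^sup>+r\<in>{s..t}. nsq (f (q r w)) \<partial>lborel)) + 2 * nsq (eps *\<^sub>R (ito t w - ito s w))"
        using nsq_drift_le[OF elim(3) st] by (intro add_right_mono mult_left_mono) auto
      finally show ?case .
    qed
  qed
  also have "\<dots> = 2 * (ennreal (t - s) * msq_on {s..t} (\<lambda>r w. f (q r w)))
      + 2 * msq (\<lambda>w. eps *\<^sub>R (ito t w - ito s w))"
    by (simp add: nn_integral_add nn_integral_cmult del: norm_scaleR)
  also have "msq_on {s..t} (\<lambda>r w. f (q r w)) = (\<integral>\<^sup>+r\<in>{s..t}. (msq (\<lambda>w. f (q r w))) \<partial>lborel)"
    using st by (intro nn_integral_q_swap[OF fb]) auto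
  also have "msq (\<lambda>w. eps *\<^sub>R (ito t w - ito s w)) \<le> ennreal (8 * S\<^sup>2 * (t - s))"
    by (rule ito_\<sigma>_increment_le[OF has_ito[OF st(1)] has_ito[OF t] st])
  finally show ?thesis by (simp add: add_left_mono mult_left_mono)
qed

section \<open>Second moments of the position\<close>

definition drift :: "real \<Rightarrow> 'a \<Rightarrow> real ^ 'd"
  where "drift t w = (\<integral>r. indicator {0..max t 0} r *\<^sub>R f (q (max r 0) w) \<partial>lborel)"

lemma drift_eq:
  assumes "w \<in> space M"
  shows "drift t w = integral {0..max t 0} (\<lambda>r. f (q r w))"
proof -
  have "set_integrable lborel {0..max t 0} (\<lambda>r. f (q r w))"
    unfolding set_integrable_def using assms by (intro borel_integrable_compact f_q_cont) auto
  from set_borel_integral_eq_integral(2)[OF this]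
  have "integral {0..max t 0} (\<lambda>r. f (q r w)) = (\<integral>r. indicator {0..max t 0} r *\<^sub>R f (q r w) \<partial>lborel)"
    by (simp add: set_lebesgue_integral_def)
  also have "\<dots> = drift t w"
    unfolding drift_def by (intro Bochner_Integration.integral_cong) (auto simp: indicator_def)
  finally show ?thesis ..
qed

lemma drift_joint: "(\<lambda>x. drift (snd x) (fst x)) \<in> borel_measurable MT"
proof -
  have 1: "(\<lambda>x. f (q (max (snd x) 0) (fst (fst x)))) \<in> borel_measurable ((M \<Otimes>\<^sub>M lborel) \<Otimes>\<^sub>M lborel)"
  proof -
    have "(\<lambda>x. (fst (fst x), snd x)) \<in> measurable ((M \<Otimes>\<^sub>M lborel) \<Otimes>\<^sub>M lborel) (M \<Otimes>\<^sub>M lborel)"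
      by measurable
    from measurable_compose[OF this measurable_compose[OF q_joint borel_measurable_continuous_onI[OF f_cont]]]
    show ?thesis by simp
  qed
  have "(\<lambda>x. (if 0 \<le> snd x \<and> snd x \<le> max (snd (fst x)) 0 then 1 else (0::real)) *\<^sub>R f (q (max (snd x) 0) (fst (fst x))))
      \<in> borel_measurable ((M \<Otimes>\<^sub>M lborel) \<Otimes>\<^sub>M lborel)"
    using 1 by (rule borel_measurable_scaleR[rotated]) measurable
  then show ?thesis
    unfolding drift_def
    by (intro lborel.borel_measurable_lebesgue_integral) (simp add: case_prod_beta' indicator_def of_bool_def)
qed

text \<open>For \<open>t \<ge> 0\<close> this is \<open>eps *\<^sub>R ito t w\<close> almost surely,
  but it is defined as a difference: \<open>Y\<close> and \<open>drift\<close> are jointly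
  measurable in time and sample, which is not known of the chosen \<open>ito\<close>, and Fubini
  needs it.\<close>

definition noise :: "real \<Rightarrow> 'a \<Rightarrow> real ^ 'd"
  where "noise t w = Y t w - drift t w"

lemma noise_joint: "(\<lambda>x. noise (snd x) (fst x)) \<in> borel_measurable MT"
  unfolding noise_def using borel_measurable_diff[OF Y_joint drift_joint] by (simp add: case_prod_beta')

lemma noise_le:
  assumes "t \<le> T"
  shows "msq (\<lambda>w. noise t w) \<le> ennreal (8 * S\<^sup>2 * T)"
proof -
  let ?t = "max t 0"
  have t0: "0 \<le> ?t" by simp
  have "AE w in M. nsq (noise t w) = nsq (eps *\<^sub>R (ito ?t w - ito 0 w))"
    using Y_ito[OF t0] Y_ito[OF order_refl] AE_Y_0 AE_space
  proof eventually_elim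
    case (elim w)
    have "eps *\<^sub>R ito 0 w = 0" using elim(2,3) by simp
    then have "eps *\<^sub>R (ito ?t w - ito 0 w) = eps *\<^sub>R ito ?t w"
      by (simp only: scaleR_diff_right diff_zero)
    then show ?case
      using elim(1) drift_eq[OF elim(4), of t] by (simp only: noise_def Y_max add_diff_cancel_left')
  qed
  then have "msq (\<lambda>w. noise t w) = msq (\<lambda>w. eps *\<^sub>R (ito ?t w - ito 0 w))"
    by (rule nn_integral_cong_AE)
  also have "\<dots> \<le> ennreal (8 * S\<^sup>2 * (?t - 0))"
    by (rule ito_\<sigma>_increment_le[OF has_ito has_ito]) auto
  also have "\<dots> \<le> ennreal (8 * S\<^sup>2 * T)"
    using assms pos by (intro ennreal_leI mult_left_mono) auto
  finally show ?thesis .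
qed

text \<open>The stochastic part of the pathwise inequality for \<open>q\<close>: it is carried
  through Gronwall as a random inhomogeneity and integrated over the sample space only then.\<close>

definition noise_average :: "real \<Rightarrow> 'a \<Rightarrow> ennreal"
  where "noise_average t w = (\<integral>\<^sup>+u. nsq (noise (t - eps\<^sup>2 * u) w) \<partial>expo)"

lemma noise_shift_joint:
  "(\<lambda>x. noise (t - eps\<^sup>2 * snd x) (fst x)) \<in> borel_measurable (M \<Otimes>\<^sub>M expo)"
proof -
  have "(\<lambda>x. (fst x, t - eps\<^sup>2 * snd x)) \<in> measurable (M \<Otimes>\<^sub>M expo) (M \<Otimes>\<^sub>M lborel)" by measurable
  from measurable_compose[OF this noise_joint] show ?thesis by simp
qed

lemma noise_average_joint: "(\<lambda>x. noise_average (snd x) (fst x)) \<in> borel_measurable MT"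
proof -
  have "(\<lambda>x. (fst (fst x), snd (fst x) - eps\<^sup>2 * snd x)) \<in> measurable ((M \<Otimes>\<^sub>M lborel) \<Otimes>\<^sub>M expo) (M \<Otimes>\<^sub>M lborel)"
    by measurable
  from measurable_compose[OF this noise_joint]
  have "(\<lambda>x. noise (snd (fst x) - eps\<^sup>2 * snd x) (fst (fst x))) \<in> borel_measurable ((M \<Otimes>\<^sub>M lborel) \<Otimes>\<^sub>M expo)"
    by simp
  then show ?thesis
    unfolding noise_average_def by (intro expo.borel_measurable_nn_integral) (simp add: case_prod_beta')
qed

lemma noise_average_le:
  assumes "t \<le> T"
  shows "(\<integral>\<^sup>+w. noise_average t w \<partial>M) \<le> ennreal (8 * S\<^sup>2 * T)"
proof -
  interpret pair_sigma_finite M expo ..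
  have "(\<integral>\<^sup>+w. noise_average t w \<partial>M) = (\<integral>\<^sup>+u. (msq (\<lambda>w. noise (t - eps\<^sup>2 * u) w)) \<partial>expo)"
    unfolding noise_average_def using noise_shift_joint
    by (intro Fubini'[symmetric]) (simp add: case_prod_beta')
  also have "\<dots> \<le> (\<integral>\<^sup>+u. ennreal (8 * S\<^sup>2 * T) \<partial>expo)"
    using AE_expo_nonneg
  proof (intro nn_integral_mono_AE, eventually_elim)
    fix u :: real assume "0 \<le> u"
    then have "t - eps\<^sup>2 * u \<le> T" using assms by (auto intro: order_trans[of _ t])
    then show "msq (\<lambda>w. noise (t - eps\<^sup>2 * u) w) \<le> ennreal (8 * S\<^sup>2 * T)" by (rule noise_le)
  qed
  also have "\<dots> = ennreal (8 * S\<^sup>2 * T)"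
    using expo.emeasure_space_1 by simp
  finally show ?thesis .
qed

lemma Y_path_measurable: "w \<in> space M \<Longrightarrow> (\<lambda>u. Y (t - eps\<^sup>2 * u) w) \<in> borel_measurable expo"
  using measurable_compose[OF _ borel_measurable_continuous_onI[OF Y_cont], of "\<lambda>u. t - eps\<^sup>2 * u" expo w] by simp

definition init_bound :: real
  where "init_bound = 4 * (norm a)\<^sup>2 + 4 * (norm (eps *\<^sub>R b))\<^sup>2 + 8 * T\<^sup>2 * c0\<^sup>2"

text \<open>Jensen for the exponential average, then the splitting of \<open>Y\<close> into drift
  and noise. Only the drift is estimated by \<open>q\<close> itself, through the integral over
  \<open>[0, t]\<close> that Gronwall requires; the shifted times never exceed
  \<open>t\<close>.\<close>

lemma AE_q_le:
  "AE w in M. \<forall>t\<in>{0..T}. nsq (q t w) \<le> (ennreal init_bound + 4 * noise_average t w)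
    + ennreal (8 * T * L\<^sup>2 * integral {0..t} (\<lambda>r. (norm (q r w))\<^sup>2))"
  using AE_q_average AE_space
proof eventually_elim
  case (elim w)
  show ?case
  proof
    fix t assume t: "t \<in> {0..T}"
    define e where "e = 1 - exp (- (t / eps\<^sup>2))"
    define U where "U = integral {0..t} (\<lambda>r. (norm (q r w))\<^sup>2)"
    have e: "0 \<le> e" "e \<le> 1" using t pos by (auto simp: e_def)
    have ncont: "continuous_on {0..t} (\<lambda>r. (norm (q r w))\<^sup>2)"
      by (intro continuous_intros continuous_on_subset[OF q_cont[OF elim(2)]]) auto
    have U0: "0 \<le> U" unfolding U_def using ncont by (intro integral_nonneg integrable_continuous_real) auto
    have nm [measurable]: "(\<lambda>u. noise (t - eps\<^sup>2 * u) w) \<in> borel_measurable expo"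
      using measurable_Pair2[OF noise_shift_joint elim(2)] by simp
    have drift_le: "nsq (drift s w) \<le> ennreal (2 * T\<^sup>2 * c0\<^sup>2 + 2 * T * L\<^sup>2 * U)" if s: "s \<le> t" for s
    proof -
      have "nsq (drift s w) \<le> ennreal (max s 0 - 0) * (\<integral>\<^sup>+r\<in>{0..max s 0}. nsq (f (q r w)) \<partial>lborel)"
        unfolding drift_eq[OF elim(2)] by (rule nsq_drift_le[OF elim(2)]) auto
      also have "\<dots> \<le> ennreal T * (\<integral>\<^sup>+r\<in>{0..t}. nsq (f (q r w)) \<partial>lborel)"
        using s t by (intro mult_mono ennreal_leI nn_integral_mono mult_left_mono) (auto simp: indicator_def)
      also have "(\<integral>\<^sup>+r\<in>{0..t}. nsq (f (q r w)) \<partial>lborel)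
          \<le> (\<integral>\<^sup>+r\<in>{0..t}. ennreal (2 * c0\<^sup>2 + 2 * L\<^sup>2 * (norm (q r w))\<^sup>2) \<partial>lborel)"
        using nsq_f_le by (intro nn_integral_mono mult_right_mono) (auto simp: ennreal_mult'')
      also have "\<dots> = ennreal (integral {0..t} (\<lambda>r. 2 * c0\<^sup>2 + 2 * L\<^sup>2 * (norm (q r w))\<^sup>2))"
        using ncont
        by (intro set_nn_integral_eq_integral_cont continuous_on_add continuous_on_mult_left continuous_on_const) auto
      also have "integral {0..t} (\<lambda>r. 2 * c0\<^sup>2 + 2 * L\<^sup>2 * (norm (q r w))\<^sup>2) = 2 * c0\<^sup>2 * t + 2 * L\<^sup>2 * U"
        using integrable_continuous_real[OF ncont] t
        by (subst Henstock_Kurzweil_Integration.integral_add)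
          (auto intro!: integrable_on_mult_right simp: U_def)
      also have "ennreal T * ennreal (2 * c0\<^sup>2 * t + 2 * L\<^sup>2 * U) = ennreal (T * (2 * c0\<^sup>2 * t + 2 * L\<^sup>2 * U))"
        using pos t U0 by (intro ennreal_mult[symmetric]) auto
      also have "\<dots> \<le> ennreal (T * (2 * c0\<^sup>2 * T + 2 * L\<^sup>2 * U))"
        using pos t by (intro ennreal_leI mult_left_mono add_right_mono) auto
      also have "T * (2 * c0\<^sup>2 * T + 2 * L\<^sup>2 * U) = 2 * T\<^sup>2 * c0\<^sup>2 + 2 * T * L\<^sup>2 * U"
        by (simp add: power2_eq_square algebra_simps)
      finally show ?thesis by (simp add: mult_left_mono)
    qed
    \<comment> \<open>\<open>K\<close> bounds the squared drift at every time up to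
      \<open>t\<close>. The constant 8 in the claim is \<open>2 * 2 * 2\<close>, one factor for each
      splitting of a square: in \<open>f\<close>, in \<open>Y\<close> and in
      \<open>q\<close>.\<close>
    define K where "K = 2 * T\<^sup>2 * c0\<^sup>2 + 2 * T * L\<^sup>2 * U"
    have K0: "0 \<le> K" using pos U0 by (simp add: K_def)
    have "nsq (\<integral>u. Y (t - eps\<^sup>2 * u) w \<partial>expo) \<le> (\<integral>\<^sup>+u. nsq (Y (t - eps\<^sup>2 * u) w) \<partial>expo)"
      by (intro expo.nsq_expectation_le Y_path_measurable elim)
    also have "\<dots> \<le> (\<integral>\<^sup>+u. ennreal (2 * K) + 2 * nsq (noise (t - eps\<^sup>2 * u) w) \<partial>expo)"
      using AE_expo_nonneg
    proof (intro nn_integral_mono_AE, eventually_elim)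
      fix u :: real assume u: "0 \<le> u"
      let ?s = "t - eps\<^sup>2 * u"
      have "nsq (Y ?s w) \<le> 2 * nsq (drift ?s w) + 2 * nsq (noise ?s w)"
        using nsq_add_le[of "drift ?s w" "noise ?s w"] by (simp add: noise_def)
      also have "\<dots> \<le> 2 * ennreal K + 2 * nsq (noise ?s w)"
        using drift_le[of ?s] u by (intro add_right_mono mult_left_mono) (auto simp: K_def)
      finally show "nsq (Y ?s w) \<le> ennreal (2 * K) + 2 * nsq (noise ?s w)"
        using K0 by (simp add: ennreal_mult)
    qed
    also have "\<dots> = ennreal (2 * K) + 2 * noise_average t w"
      using expo.emeasure_space_1 by (subst nn_integral_add) (auto simp: nn_integral_cmult noise_average_def)
    finally have I: "nsq (\<integral>u. Y (t - eps\<^sup>2 * u) w \<partial>expo) \<le> ennreal (2 * K) + 2 * noise_average t w" .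
    have "(norm (a + e *\<^sub>R (eps *\<^sub>R b)))\<^sup>2 \<le> 2 * (norm a)\<^sup>2 + 2 * (norm (e *\<^sub>R (eps *\<^sub>R b)))\<^sup>2"
      by (rule norm_add_sq_le)
    also have "\<dots> \<le> 2 * (norm a)\<^sup>2 + 2 * (norm (eps *\<^sub>R b))\<^sup>2"
      unfolding norm_scaleR[of e] using e
      by (intro add_left_mono mult_left_mono power_mono) (auto intro: mult_left_le_one_le)
    finally have A: "(norm (a + e *\<^sub>R (eps *\<^sub>R b)))\<^sup>2 \<le> 2 * (norm a)\<^sup>2 + 2 * (norm (eps *\<^sub>R b))\<^sup>2" .
    have "q t w = (a + e *\<^sub>R (eps *\<^sub>R b)) + (\<integral>u. Y (t - eps\<^sup>2 * u) w \<partial>expo)"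
      using elim(1) t by (simp add: e_def algebra_simps)
    then have "nsq (q t w) \<le> 2 * nsq (a + e *\<^sub>R (eps *\<^sub>R b)) + 2 * nsq (\<integral>u. Y (t - eps\<^sup>2 * u) w \<partial>expo)"
      using nsq_add_le by metis
    also have "\<dots> \<le> 2 * ennreal (2 * (norm a)\<^sup>2 + 2 * (norm (eps *\<^sub>R b))\<^sup>2) + 2 * (ennreal (2 * K) + 2 * noise_average t w)"
      using I A by (intro add_mono mult_left_mono ennreal_leI) auto
    also have "\<dots> = ennreal (2 * (2 * (norm a)\<^sup>2 + 2 * (norm (eps *\<^sub>R b))\<^sup>2) + 2 * (2 * K)) + 4 * noise_average t w"
    proof -
      have eq: "2 * ennreal x + 2 * (ennreal y + 2 * z) = ennreal (2 * x + 2 * y) + 4 * z" if "0 \<le> x" "0 \<le> y" for x y z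
        using that by (simp add: ennreal_mult distrib_left mult.assoc[symmetric] add.assoc)
      show ?thesis by (rule eq) (use K0 in auto)
    qed
    also have "2 * (2 * (norm a)\<^sup>2 + 2 * (norm (eps *\<^sub>R b))\<^sup>2) + 2 * (2 * K) = init_bound + 8 * T * L\<^sup>2 * U"
      by (simp add: init_bound_def K_def)
    also have "ennreal (init_bound + 8 * T * L\<^sup>2 * U) = ennreal init_bound + ennreal (8 * T * L\<^sup>2 * U)"
      using pos U0 by (intro ennreal_plus) (auto simp: init_bound_def)
    finally show "nsq (q t w) \<le> (ennreal init_bound + 4 * noise_average t w)
      + ennreal (8 * T * L\<^sup>2 * integral {0..t} (\<lambda>r. (norm (q r w))\<^sup>2))"
      by (simp only: U_def add_ac)
  qed
qed

text \<open>The number \<open>8 * T * L\<^sup>2\<close> is the Gronwall rate of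
  \<open>AE_q_le\<close>. The last factor bounds the mean of the inhomogeneity at each time up to
  \<open>T\<close>, where \<open>32 = 4 * 8\<close> combines the weight of
  \<open>noise_average\<close> with the constant of the Ito increments.\<close>

definition moment_bound :: real
  where "moment_bound = (1 + 8 * T\<^sup>2 * L\<^sup>2 * exp (8 * T * L\<^sup>2 * T)) * (init_bound + 32 * S\<^sup>2 * T)"

lemma q_moment_le:
  assumes t: "t \<in> {0..T}"
  shows "msq (\<lambda>w. q t w) \<le> ennreal moment_bound"
proof -
  define c where "c = 8 * T * L\<^sup>2"
  define A where "A r w = ennreal init_bound + 4 * noise_average r w" for r w
  define B where "B = init_bound + 32 * S\<^sup>2 * T"
  have c0: "0 \<le> c" using pos by (simp add: c_def)
  have B0: "0 \<le> B" using pos by (simp add: B_def init_bound_def)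
  have A_joint: "(\<lambda>x. A (snd x) (fst x)) \<in> borel_measurable MT"
    unfolding A_def using noise_average_joint by simp
  have A_meas [measurable]: "A r \<in> borel_measurable M" for r
    using measurable_Pair1[OF A_joint, of r] by simp
  have EA: "(\<integral>\<^sup>+w. A r w \<partial>M) \<le> ennreal B" if "r \<le> T" for r
  proof -
    have [measurable]: "noise_average r \<in> borel_measurable M"
      using measurable_Pair1[OF noise_average_joint, of r] by simp
    have "(\<integral>\<^sup>+w. A r w \<partial>M) = ennreal init_bound + 4 * (\<integral>\<^sup>+w. noise_average r w \<partial>M)"
      unfolding A_def by (simp add: nn_integral_add nn_integral_cmult emeasure_space_1)
    also have "\<dots> \<le> ennreal init_bound + 4 * ennreal (8 * S\<^sup>2 * T)"
      using noise_average_le[OF that] by (intro add_left_mono mult_left_mono) auto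
    also have "\<dots> = ennreal init_bound + ennreal (4 * (8 * S\<^sup>2 * T))"
      using pos by (subst ennreal_mult) auto
    also have "\<dots> = ennreal B"
      using pos by (subst ennreal_plus[symmetric]) (auto simp: B_def init_bound_def)
    finally show ?thesis .
  qed
  have int_joint: "(\<lambda>x. A (snd x) (fst x) * indicator {0..T} (snd x)) \<in> borel_measurable MT"
    using A_joint by (intro borel_measurable_times_ennreal) auto
  then have int_meas [measurable]: "(\<lambda>w. \<integral>\<^sup>+r\<in>{0..T}. A r w \<partial>lborel) \<in> borel_measurable M"
    by (intro lborel.borel_measurable_nn_integral) (simp add: case_prod_beta')
  have EI: "(\<integral>\<^sup>+w. (\<integral>\<^sup>+r\<in>{0..T}. A r w \<partial>lborel) \<partial>M) \<le> ennreal (T * B)"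
  proof -
    interpret P: pair_sigma_finite M lborel ..
    have "(\<integral>\<^sup>+w. (\<integral>\<^sup>+r\<in>{0..T}. A r w \<partial>lborel) \<partial>M) = (\<integral>\<^sup>+r. (\<integral>\<^sup>+w. A r w * indicator {0..T} r \<partial>M) \<partial>lborel)"
      using int_joint by (intro P.Fubini'[symmetric]) (simp add: case_prod_beta')
    also have "\<dots> \<le> (\<integral>\<^sup>+r\<in>{0..T}. ennreal B \<partial>lborel)"
      using EA by (intro nn_integral_mono) (auto simp: indicator_def)
    also have "\<dots> = ennreal (T * B)"
      using pos B0 by (simp add: nn_integral_cmult_indicator ennreal_mult mult.commute)
    finally show ?thesis .
  qed
  have "AE w in M. nsq (q t w) \<le> A t w + ennreal (c * exp (c * T)) * (\<integral>\<^sup>+r\<in>{0..T}. A r w \<partial>lborel)"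
    using AE_q_le AE_space
  proof eventually_elim
    case (elim w)
    let ?u = "\<lambda>r. (norm (q r w))\<^sup>2"
    have ncont: "continuous_on {0..t} ?u"
      by (intro continuous_intros continuous_on_subset[OF q_cont[OF elim(2)]]) auto
    have "ennreal (integral {0..t} ?u) \<le> ennreal (exp (c * t)) * (\<integral>\<^sup>+r\<in>{0..t}. A r w \<partial>lborel)"
      using t elim(1) by (intro gronwall_nn_integral ncont c0) (auto simp: A_def c_def)
    also have "\<dots> \<le> ennreal (exp (c * T)) * (\<integral>\<^sup>+r\<in>{0..T}. A r w \<partial>lborel)"
      using t c0 by (intro mult_mono ennreal_leI nn_integral_mono mult_left_mono)
        (auto simp: indicator_def intro: mult_left_mono)
    finally have "ennreal c * ennreal (integral {0..t} ?u) \<le> ennreal c * (ennreal (exp (c * T)) * (\<integral>\<^sup>+r\<in>{0..T}. A r w \<partial>lborel))"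
      by (rule mult_left_mono) simp
    then have "ennreal (c * integral {0..t} ?u) \<le> ennreal (c * exp (c * T)) * (\<integral>\<^sup>+r\<in>{0..T}. A r w \<partial>lborel)"
      using c0 by (simp add: ennreal_mult' mult.assoc)
    then have "A t w + ennreal (c * integral {0..t} ?u)
        \<le> A t w + ennreal (c * exp (c * T)) * (\<integral>\<^sup>+r\<in>{0..T}. A r w \<partial>lborel)"
      by (rule add_left_mono)
    moreover have "nsq (q t w) \<le> A t w + ennreal (c * integral {0..t} ?u)"
      using elim(1) t unfolding A_def c_def by blast
    ultimately show ?case by (rule order_trans[rotated])
  qed
  then have "msq (\<lambda>w. q t w) \<le> (\<integral>\<^sup>+w. A t w + ennreal (c * exp (c * T)) * (\<integral>\<^sup>+r\<in>{0..T}. A r w \<partial>lborel) \<partial>M)"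
    by (rule nn_integral_mono_AE)
  also have "\<dots> = (\<integral>\<^sup>+w. A t w \<partial>M) + ennreal (c * exp (c * T)) * (\<integral>\<^sup>+w. (\<integral>\<^sup>+r\<in>{0..T}. A r w \<partial>lborel) \<partial>M)"
    by (simp add: nn_integral_add nn_integral_cmult)
  also have "\<dots> \<le> ennreal B + ennreal (c * exp (c * T)) * ennreal (T * B)"
    using EA EI t by (intro add_mono mult_left_mono) auto
  also have "\<dots> = ennreal (B + c * exp (c * T) * (T * B))"
    using B0 c0 pos by (simp add: ennreal_mult)
  also have "B + c * exp (c * T) * (T * B) = moment_bound"
    by (simp add: moment_bound_def B_def c_def power2_eq_square algebra_simps)
  finally show ?thesis .
qed

section \<open>Mean-square regularity of \<open>Y\<close> and of the position\<close>

definition holder_const :: real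
  where "holder_const = 2 * T * (2 * c0\<^sup>2 + 2 * L\<^sup>2 * moment_bound) + 16 * S\<^sup>2"

lemma moment_bound_nonneg: "0 \<le> moment_bound"
  using pos by (simp add: moment_bound_def init_bound_def)

lemma holder_const_nonneg: "0 \<le> holder_const"
  using pos moment_bound_nonneg by (simp add: holder_const_def)

text \<open>The drift contributes order \<open>(t - s)\<^sup>2\<close>, of which one power is
  absorbed into \<open>T\<close>, and the noise order \<open>t - s\<close>. Negative times are moved
  to 0, which does not increase distances.\<close>

lemma Y_holder:
  assumes "s \<le> T" "t \<le> T"
  shows "msq (\<lambda>w. Y t w - Y s w) \<le> ennreal (holder_const * \<bar>t - s\<bar>)"
proof -
  have le: "msq (\<lambda>w. Y t w - Y s w) \<le> ennreal (holder_const * (t - s))"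
    if st: "0 \<le> s" "s \<le> t" "t \<le> T" for s t
  proof -
    define B where "B = 2 * c0\<^sup>2 + 2 * L\<^sup>2 * moment_bound"
    have B0: "0 \<le> B" using moment_bound_nonneg by (simp add: B_def)
    have "msq (\<lambda>w. f (q r w)) \<le> ennreal B" if r: "r \<in> {0..T}" for r
    proof -
      have [measurable]: "q r \<in> borel_measurable M" using r by (intro q_measurable) auto
      have "msq (\<lambda>w. f (q r w)) \<le> (\<integral>\<^sup>+w. ennreal (2 * c0\<^sup>2) + ennreal (2 * L\<^sup>2) * nsq (q r w) \<partial>M)"
        by (intro nn_integral_mono nsq_f_le)
      also have "\<dots> = ennreal (2 * c0\<^sup>2) + ennreal (2 * L\<^sup>2) * msq (\<lambda>w. q r w)"
        by (simp add: nn_integral_add nn_integral_cmult emeasure_space_1)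
      also have "\<dots> \<le> ennreal (2 * c0\<^sup>2) + ennreal (2 * L\<^sup>2) * ennreal moment_bound"
        by (intro add_left_mono mult_left_mono q_moment_le r) auto
      also have "\<dots> = ennreal B"
        using moment_bound_nonneg by (subst ennreal_mult[symmetric]) (auto simp: B_def ennreal_plus[symmetric] simp del: ennreal_plus)
      finally show ?thesis .
    qed
    then have "(\<integral>\<^sup>+r\<in>{s..t}. (msq (\<lambda>w. f (q r w))) \<partial>lborel) \<le> (\<integral>\<^sup>+r\<in>{s..t}. ennreal B \<partial>lborel)"
      using st by (intro nn_integral_mono) (auto simp: indicator_def)
    also have "\<dots> = ennreal (B * (t - s))"
      using st B0 by (simp add: nn_integral_cmult_indicator ennreal_mult)
    finally have 1: "(\<integral>\<^sup>+r\<in>{s..t}. (msq (\<lambda>w. f (q r w))) \<partial>lborel) \<le> ennreal (B * (t - s))" .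
    have "msq (\<lambda>w. Y t w - Y s w) \<le> 2 * (ennreal (t - s) * ennreal (B * (t - s))) + 2 * ennreal (8 * S\<^sup>2 * (t - s))"
      by (rule order_trans[OF Y_increment_le[OF st(1,2)]]) (intro add_right_mono mult_left_mono 1; simp)
    also have "\<dots> = ennreal (2 * ((t - s) * (B * (t - s))) + 2 * (8 * S\<^sup>2 * (t - s)))"
    proof -
      have "2 * (ennreal x * ennreal y) + 2 * ennreal z = ennreal (2 * (x * y) + 2 * z)" if "0 \<le> x" "0 \<le> y" "0 \<le> z" for x y z
        using that by (simp add: ennreal_mult)
      then show ?thesis using st B0 by simp
    qed
    also have "\<dots> \<le> ennreal (holder_const * (t - s))"
    proof (intro ennreal_leI)
      have "2 * ((t - s) * (B * (t - s))) \<le> 2 * (T * (B * (t - s)))"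
        using st B0 by (intro mult_left_mono mult_right_mono) auto
      then show "2 * ((t - s) * (B * (t - s))) + 2 * (8 * S\<^sup>2 * (t - s)) \<le> holder_const * (t - s)"
        by (simp add: holder_const_def B_def algebra_simps)
    qed
    finally show ?thesis .
  qed
  have le': "msq (\<lambda>w. Y t w - Y s w) \<le> ennreal (holder_const * \<bar>t - s\<bar>)"
    if st: "s \<le> t" "t \<le> T" for s t
  proof -
    have "msq (\<lambda>w. Y t w - Y s w) \<le> ennreal (holder_const * (max t 0 - max s 0))"
      using le[of "max s 0" "max t 0"] st pos by (simp add: Y_max)
    also have "\<dots> \<le> ennreal (holder_const * \<bar>t - s\<bar>)"
      using st holder_const_nonneg by (intro ennreal_leI mult_left_mono) auto
    finally show ?thesis .
  qed
  show ?thesis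
  proof (cases "s \<le> t")
    case True
    then show ?thesis using le' assms by simp
  next
    case False
    then show ?thesis using le'[of t s] assms by (simp add: norm_minus_commute abs_minus_commute)
  qed
qed

lemma Y_path_integrable:
  assumes w: "w \<in> space M"
  shows "integrable expo (\<lambda>u. Y (t - eps\<^sup>2 * u) w)"
proof -
  have "bounded ((\<lambda>s. Y s w) ` {0..max t 0})"
    by (intro compact_imp_bounded compact_continuous_image continuous_on_subset[OF Y_cont[OF w]]) auto
  then obtain B where B: "\<And>s. s \<in> {0..max t 0} \<Longrightarrow> norm (Y s w) \<le> B"
    unfolding bounded_iff by blast
  have "norm (Y (t - eps\<^sup>2 * u) w) \<le> B" if "0 \<le> u" for u
  proof -
    have "max (t - eps\<^sup>2 * u) 0 \<in> {0..max t 0}" using that by (auto intro: max.coboundedI1)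
    from B[OF this] show ?thesis by (simp add: Y_max)
  qed
  then show ?thesis
    using AE_expo_nonneg Y_path_measurable[OF w]
    by (intro expo.integrable_const_bound[where B = B]) (auto elim!: eventually_mono)
qed

text \<open>Both positions are averaged over the same \<open>u\<close>, so \<open>Y\<close> is
  always compared at distance \<open>t - s\<close>. The term in \<open>b\<close> is kept as a
  difference of exponentials: in the initial layer it is not controlled by \<open>t - s\<close>
  uniformly in \<open>eps\<close>.\<close>

lemma q_regularity:
  assumes "0 \<le> s" "s \<le> t" "t \<le> T"
  shows "msq (\<lambda>w. q t w - q s w)
    \<le> ennreal (2 * ((exp (- (s / eps\<^sup>2)) - exp (- (t / eps\<^sup>2)))\<^sup>2 * (norm (eps *\<^sub>R b))\<^sup>2) + 2 * (holder_const * (t - s)))"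
proof -
  interpret P: pair_sigma_finite M expo ..
  define e where "e = exp (- (s / eps\<^sup>2)) - exp (- (t / eps\<^sup>2))"
  let ?d = "\<lambda>u w. Y (t - eps\<^sup>2 * u) w - Y (s - eps\<^sup>2 * u) w"
  have Yj: "(\<lambda>x. Y (t - eps\<^sup>2 * snd x) (fst x)) \<in> borel_measurable (M \<Otimes>\<^sub>M expo)" for t
  proof -
    have "(\<lambda>x. (fst x, t - eps\<^sup>2 * snd x)) \<in> measurable (M \<Otimes>\<^sub>M expo) (M \<Otimes>\<^sub>M lborel)" by measurable
    from measurable_compose[OF this Y_joint] show ?thesis by simp
  qed
  have dj: "(\<lambda>x. nsq (?d (snd x) (fst x))) \<in> borel_measurable (M \<Otimes>\<^sub>M expo)"
    using Yj[of t] Yj[of s] by measurable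
  have dm [measurable]: "(\<lambda>w. \<integral>\<^sup>+u. nsq (?d u w) \<partial>expo) \<in> borel_measurable M"
    using dj by (intro expo.borel_measurable_nn_integral) (simp add: case_prod_beta')
  have "AE w in M. nsq (q t w - q s w) \<le> ennreal (2 * (e\<^sup>2 * (norm (eps *\<^sub>R b))\<^sup>2)) + 2 * (\<integral>\<^sup>+u. nsq (?d u w) \<partial>expo)"
    using AE_q_average AE_space
  proof eventually_elim
    case (elim w)
    have q: "q t w = a + (1 - exp (- (t / eps\<^sup>2))) *\<^sub>R (eps *\<^sub>R b) + (\<integral>u. Y (t - eps\<^sup>2 * u) w \<partial>expo)"
      "q s w = a + (1 - exp (- (s / eps\<^sup>2))) *\<^sub>R (eps *\<^sub>R b) + (\<integral>u. Y (s - eps\<^sup>2 * u) w \<partial>expo)"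
      using elim(1) assms by (auto simp: algebra_simps)
    have d: "q t w - q s w = e *\<^sub>R (eps *\<^sub>R b) + (\<integral>u. ?d u w \<partial>expo)"
      unfolding q Bochner_Integration.integral_diff[OF Y_path_integrable[OF elim(2)] Y_path_integrable[OF elim(2)]]
      by (simp add: e_def algebra_simps)
    have "nsq (q t w - q s w) \<le> 2 * nsq (e *\<^sub>R (eps *\<^sub>R b)) + 2 * nsq (\<integral>u. ?d u w \<partial>expo)"
      unfolding d by (rule nsq_add_le)
    also have "\<dots> \<le> 2 * nsq (e *\<^sub>R (eps *\<^sub>R b)) + 2 * (\<integral>\<^sup>+u. nsq (?d u w) \<partial>expo)"
      by (rule add_left_mono[OF mult_left_mono[OF expo.nsq_expectation_le[OF borel_measurable_diff[OF
        Y_path_measurable[OF elim(2)] Y_path_measurable[OF elim(2)]]]]]) simp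
    also have "2 * nsq (e *\<^sub>R (eps *\<^sub>R b)) = ennreal (2 * (e\<^sup>2 * (norm (eps *\<^sub>R b))\<^sup>2))"
      unfolding norm_scaleR[of e] by (simp add: power_mult_distrib ennreal_mult)
    finally show ?case .
  qed
  then have "msq (\<lambda>w. q t w - q s w)
    \<le> (\<integral>\<^sup>+w. ennreal (2 * (e\<^sup>2 * (norm (eps *\<^sub>R b))\<^sup>2)) + 2 * (\<integral>\<^sup>+u. nsq (?d u w) \<partial>expo) \<partial>M)"
    by (rule nn_integral_mono_AE)
  also have "\<dots> = ennreal (2 * (e\<^sup>2 * (norm (eps *\<^sub>R b))\<^sup>2)) + 2 * (\<integral>\<^sup>+w. (\<integral>\<^sup>+u. nsq (?d u w) \<partial>expo) \<partial>M)"
    by (simp add: nn_integral_add nn_integral_cmult emeasure_space_1)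
  also have "(\<integral>\<^sup>+w. (\<integral>\<^sup>+u. nsq (?d u w) \<partial>expo) \<partial>M) = (\<integral>\<^sup>+u. (msq (\<lambda>w. ?d u w)) \<partial>expo)"
    using dj by (intro P.Fubini'[symmetric]) (simp add: case_prod_beta')
  also have "\<dots> \<le> (\<integral>\<^sup>+u. ennreal (holder_const * (t - s)) \<partial>expo)"
    using AE_expo_nonneg
  proof (intro nn_integral_mono_AE, eventually_elim)
    fix u :: real assume u: "0 \<le> u"
    have "0 \<le> eps\<^sup>2 * u" using u by simp
    then have "t - eps\<^sup>2 * u \<le> T" "s - eps\<^sup>2 * u \<le> T" using assms by linarith+
    from Y_holder[OF this(2,1)] show "msq (\<lambda>w. ?d u w) \<le> ennreal (holder_const * (t - s))"
      using assms by simp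
  qed
  also have "\<dots> = ennreal (holder_const * (t - s))"
    using expo.emeasure_space_1 by simp
  also have "ennreal (2 * (e\<^sup>2 * (norm (eps *\<^sub>R b))\<^sup>2)) + 2 * ennreal (holder_const * (t - s))
    = ennreal (2 * (e\<^sup>2 * (norm (eps *\<^sub>R b))\<^sup>2) + 2 * (holder_const * (t - s)))"
    using holder_const_nonneg assms by (simp add: ennreal_mult)
  finally show ?thesis by (simp add: e_def add_left_mono mult_left_mono)
qed

end

section \<open>The numerical scheme\<close>

lemma nsq_sum_le:
  fixes x :: "nat \<Rightarrow> 'b::{banach, second_countable_topology}"
  shows "nsq (\<Sum>k<j. x k) \<le> of_nat j * (\<Sum>k<j. nsq (x k))"
proof -
  have "(\<Sum>k<j. x k) = (\<integral>k. x k \<partial>count_space {..<j})"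
    by (simp add: lebesgue_integral_count_space_finite)
  also have "nsq \<dots> \<le> emeasure (count_space {..<j}) (space (count_space {..<j})) * (\<integral>\<^sup>+k. nsq (x k) \<partial>count_space {..<j})"
    by (rule nsq_norm_integral_le) simp
  also have "\<dots> = of_nat j * (\<Sum>k<j. nsq (x k))"
    by (simp add: nn_integral_count_space_finite)
  finally show ?thesis .
qed

lemma sum_inverse_squares_le: "(\<Sum>k<n. 1 / (real k + 1)\<^sup>2) \<le> 2"
proof -
  \<comment> \<open>The induction needs the gain \<open>1 / real n\<close>; at \<open>n = 0\<close>
    this quotient is 0 by convention.\<close>
  have "(\<Sum>k<n. 1 / (real k + 1)\<^sup>2) \<le> 2 - 1 / real n"
  proof (induction n)
    case (Suc n)
    show ?case
    proof (cases "n = 0")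
      case False
      have "1 / (real n + 1)\<^sup>2 \<le> 1 / (real n * (real n + 1))"
        unfolding power2_eq_square using False by (intro divide_left_mono mult_right_mono) auto
      also have "\<dots> = 1 / real n - 1 / (real n + 1)" using False by (simp add: field_simps)
      finally have "1 / (real n + 1)\<^sup>2 \<le> 1 / real n - 1 / (real n + 1)" .
      then show ?thesis using Suc by (simp add: add.commute)
    qed simp
  qed simp
  also have "\<dots> \<le> 2" by simp
  finally show ?thesis .
qed

locale langevin_discrete = langevin M F \<beta> f \<sigma> L c0 S eps T a b q p
  for M :: "'a measure" and F and \<beta> :: "real \<Rightarrow> 'a \<Rightarrow> real ^ 'd"
    and f \<sigma> L c0 S eps T a b q p +
  fixes dt :: real and N :: nat and Q P :: "nat \<Rightarrow> 'a \<Rightarrow> real ^ 'd"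
  assumes dt_pos: "0 < dt" and T_eq: "T = real N * dt"
    and scheme: "langevin_scheme M \<beta> f \<sigma> eps a b dt N Q P"
begin

section \<open>Adaptedness and averaged form of the scheme\<close>

abbreviation cell :: "nat \<Rightarrow> real set"
  where "cell k \<equiv> {real k * dt..real (Suc k) * dt}"

lemma Q_0: "w \<in> space M \<Longrightarrow> Q 0 w = a"
  and P_0: "w \<in> space M \<Longrightarrow> P 0 w = b"
  and Q_Suc: "w \<in> space M \<Longrightarrow> n < N \<Longrightarrow> Q (Suc n) w = Q n w + (dt / eps) *\<^sub>R P (Suc n) w"
  and P_Suc: "w \<in> space M \<Longrightarrow> n < N \<Longrightarrow> P (Suc n) w = P n w - (dt / eps\<^sup>2) *\<^sub>R P (Suc n) w
          + (dt / eps) *\<^sub>R f (Q n w)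
          + (1 / eps) *\<^sub>R (\<sigma> (Q n w) *v (\<beta> (real (Suc n) * dt) w - \<beta> (real n * dt) w))"
  using scheme unfolding langevin_scheme_def by blast+

definition x :: real where "x = dt / eps\<^sup>2"

lemma x_pos: "0 < x"
  using dt_pos pos by (simp add: x_def)

definition increment :: "nat \<Rightarrow> 'a \<Rightarrow> real ^ 'd"
  where "increment k w = dt *\<^sub>R f (Q k w) + \<sigma> (Q k w) *v (\<beta> (real (Suc k) * dt) w - \<beta> (real k * dt) w)"

definition Yd :: "nat \<Rightarrow> 'a \<Rightarrow> real ^ 'd"
  where "Yd j w = (\<Sum>k<j. increment k w)"

lemma P_Suc_explicit:
  assumes "w \<in> space M" "n < N"
  shows "P (Suc n) w = (1 / (1 + x)) *\<^sub>R (P n w + (1 / eps) *\<^sub>R increment n w)"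
proof -
  have "(1 + x) *\<^sub>R P (Suc n) w = P n w + (1 / eps) *\<^sub>R increment n w"
    using P_Suc[OF assms] by (simp add: x_def increment_def algebra_simps)
  then have "(1 / (1 + x)) *\<^sub>R ((1 + x) *\<^sub>R P (Suc n) w) = (1 / (1 + x)) *\<^sub>R (P n w + (1 / eps) *\<^sub>R increment n w)"
    by simp
  then show ?thesis using x_pos by simp
qed

text \<open>Adaptedness is what makes the noise sum of the scheme an elementary Ito integral. For
  \<open>P (Suc n)\<close> it rests on the explicit solution of the implicit step.\<close>

lemma QP_measurable:
  "n \<le> N \<Longrightarrow> Q n \<in> borel_measurable (F (real n * dt)) \<and> P n \<in> borel_measurable (F (real n * dt))"
proof (induction n)
  case 0
  have sp: "space (F 0) = space M" by (rule space_F) simp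
  have "Q 0 \<in> borel_measurable (F 0)" "P 0 \<in> borel_measurable (F 0)"
    using measurable_cong[of "F 0" "Q 0" "\<lambda>_. a" borel] measurable_cong[of "F 0" "P 0" "\<lambda>_. b" borel]
    by (auto simp: sp Q_0 P_0)
  then show ?case by simp
next
  case (Suc n)
  let ?t = "real n * dt" and ?t' = "real (Suc n) * dt"
  have t: "0 \<le> ?t" "?t \<le> ?t'" using dt_pos by (auto intro: mult_right_mono)
  have ih: "Q n \<in> borel_measurable (F ?t)" "P n \<in> borel_measurable (F ?t)"
    using Suc.IH Suc.prems by auto
  note IH = measurable_F_mono[OF t ih(1)] measurable_F_mono[OF t ih(2)]
  have fQ: "(\<lambda>w. f (Q n w)) \<in> borel_measurable (F ?t')"
    by (rule measurable_compose[OF IH(1) borel_measurable_continuous_onI[OF f_cont]])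
  have \<sigma>Q: "(\<lambda>w. \<sigma> (Q n w)) \<in> borel_measurable (F ?t')"
    by (rule measurable_compose[OF IH(1) borel_measurable_continuous_onI[OF \<sigma>_cont]])
  have inc: "increment n \<in> borel_measurable (F ?t')"
    unfolding increment_def using fQ \<sigma>Q measurable_increment[OF t]
    by (intro borel_measurable_add borel_measurable_scaleR borel_measurable_matrix_vector_mult) auto
  have P': "(\<lambda>w. (1 / (1 + x)) *\<^sub>R (P n w + (1 / eps) *\<^sub>R increment n w)) \<in> borel_measurable (F ?t')"
    using IH inc by (intro borel_measurable_add borel_measurable_scaleR) auto
  have sp: "space (F ?t') = space M" using t by (intro space_F) auto
  have P'': "P (Suc n) \<in> borel_measurable (F ?t')"
    using Suc.prems by (subst measurable_cong[OF P_Suc_explicit]) (auto simp: sp P' simp del: of_nat_Suc)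
  have "(\<lambda>w. Q n w + (dt / eps) *\<^sub>R P (Suc n) w) \<in> borel_measurable (F ?t')"
    using IH P'' by (intro borel_measurable_add borel_measurable_scaleR) auto
  then have "Q (Suc n) \<in> borel_measurable (F ?t')"
    using Suc.prems by (subst measurable_cong[OF Q_Suc]) (auto simp: sp simp del: of_nat_Suc)
  then show ?case using P'' by simp
qed

lemma Q_measurable: "n \<le> N \<Longrightarrow> Q n \<in> borel_measurable M"
  using QP_measurable[of n] dt_pos by (intro measurable_F_M[of "real n * dt"]) auto

lemma increment_measurable:
  assumes "k < N"
  shows "increment k \<in> borel_measurable M"
proof -
  have t: "0 \<le> real k * dt" "real k * dt \<le> real (Suc k) * dt" using dt_pos by (auto intro: mult_right_mono)
  have Q: "Q k \<in> borel_measurable M" using assms by (intro Q_measurable) simp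
  have "(\<lambda>w. \<beta> (real (Suc k) * dt) w - \<beta> (real k * dt) w) \<in> borel_measurable M"
    using t by (intro measurable_F_M[OF _ measurable_increment]) auto
  then show ?thesis
    unfolding increment_def
    using measurable_compose[OF Q borel_measurable_continuous_onI[OF f_cont]]
      measurable_compose[OF Q borel_measurable_continuous_onI[OF \<sigma>_cont]]
    by (intro borel_measurable_add borel_measurable_scaleR borel_measurable_matrix_vector_mult) auto
qed

lemma Yd_measurable: "j \<le> N \<Longrightarrow> Yd j \<in> borel_measurable M"
  unfolding Yd_def by (intro borel_measurable_sum increment_measurable) auto

lemma Q_average:
  assumes w: "w \<in> space M" and n: "n \<le> N"
  shows "Q n w - a = (1 - (1 / (1 + x)) ^ n) *\<^sub>R (eps *\<^sub>R b) + (\<integral>u. Yd (n - nat \<lfloor>u / ln (1 + x)\<rfloor>) w \<partial>expo)"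
proof -
  \<comment> \<open>The discrete form of the identity for \<open>Y\<close>: the friction in
    \<open>P\<close> and the displacement in \<open>Q\<close> cancel at each step, as they do in
    continuous time.\<close>
  have inv: "eps *\<^sub>R P k w = eps *\<^sub>R b - (Q k w - a) + Yd k w" if "k \<le> N" for k
    using that
  proof (induction k)
    case (Suc k)
    have "eps *\<^sub>R P (Suc k) w = eps *\<^sub>R P k w - (dt / eps) *\<^sub>R P (Suc k) w + increment k w"
    proof -
      have "eps *\<^sub>R P (Suc k) w = eps *\<^sub>R (P k w - (dt / eps\<^sup>2) *\<^sub>R P (Suc k) w
          + (dt / eps) *\<^sub>R f (Q k w)
          + (1 / eps) *\<^sub>R (\<sigma> (Q k w) *v (\<beta> (real (Suc k) * dt) w - \<beta> (real k * dt) w)))"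
        using P_Suc[OF w, of k] Suc.prems by simp
      then show ?thesis
        using pos by (simp add: increment_def algebra_simps power2_eq_square)
    qed
    then show ?case
      using Suc Q_Suc[OF w, of k] by (simp add: Yd_def algebra_simps)
  qed (simp add: Q_0 P_0 w Yd_def)
  have e: "exp (- ln (1 + x)) = 1 / (1 + x)"
    using x_pos by (simp add: exp_minus inverse_eq_divide)
  have "Q (Suc k) w - a = exp (- ln (1 + x)) *\<^sub>R (Q k w - a) + (1 - exp (- ln (1 + x))) *\<^sub>R (eps *\<^sub>R b + Yd (Suc k) w)"
    if k: "k < n" for k
  proof -
    define D D' Z where "D = Q k w - a" and "D' = Q (Suc k) w - a" and "Z = eps *\<^sub>R b + Yd (Suc k) w"
    have "(dt / eps) *\<^sub>R P (Suc k) w = x *\<^sub>R (eps *\<^sub>R P (Suc k) w)"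
      using pos by (simp add: x_def power2_eq_square)
    also have "eps *\<^sub>R P (Suc k) w = Z - D'"
      using inv[of "Suc k"] k n by (simp add: Z_def D'_def)
    finally have "D' = D + x *\<^sub>R (Z - D')"
      using Q_Suc[OF w, of k] k n by (simp add: D_def D'_def)
    \<comment> \<open>Implicit friction makes each step a convex combination of the old displacement
      and \<open>Z\<close>, whatever the size of \<open>x > 0\<close>; the weight of the old
      displacement is \<open>1 / (1 + x) = exp (- ln (1 + x))\<close>.\<close>
    then have "(1 + x) *\<^sub>R D' = D + x *\<^sub>R Z" by (simp add: algebra_simps)
    then have "(1 / (1 + x)) *\<^sub>R ((1 + x) *\<^sub>R D') = (1 / (1 + x)) *\<^sub>R (D + x *\<^sub>R Z)" by simp
    then have "D' = (1 / (1 + x)) *\<^sub>R D + (x / (1 + x)) *\<^sub>R Z"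
      using x_pos by (simp add: scaleR_add_right)
    also have "x / (1 + x) = 1 - 1 / (1 + x)" using x_pos by (simp add: field_simps)
    finally show ?thesis by (simp only: e D_def D'_def Z_def)
  qed
  from euler_exponential_average[where D = "\<lambda>k. Q k w - a" and Y = "\<lambda>k. Yd k w", OF _ _ _ this]
  show ?thesis
    using x_pos by (simp add: e Q_0[OF w] Yd_def)
qed

section \<open>Errors within a cell and comparison of \<open>Y\<close> with
  \<open>Yd\<close>\<close>

definition err :: "nat \<Rightarrow> ennreal"
  where "err n = msq (\<lambda>w. Q n w - q (real n * dt) w)"

text \<open>The cost of freezing the coefficients at \<open>Q k\<close> throughout a cell. In the
  bounds below, both the drift and the noise of the equation are compared with those of the scheme
  through this quantity.\<close>

definition step_err :: "nat \<Rightarrow> ennreal"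
  where "step_err k = msq_on (cell k) (\<lambda>r w. q r w - Q k w)"

lemma step_joint:
  assumes "k < N"
  shows "(\<lambda>y. nsq (q (snd y) (fst y) - Q k (fst y)) * indicator (cell k) (snd y)) \<in> borel_measurable MT"
proof -
  have "(\<lambda>y. nsq (q (max (snd y) 0) (fst y) - Q k (fst y)) * indicator (cell k) (snd y)) \<in> borel_measurable MT"
  proof -
    have "Q k \<in> borel_measurable M" using assms by (intro Q_measurable) simp
    then have [measurable]: "(\<lambda>y. q (max (snd y) 0) (fst y) - Q k (fst y)) \<in> borel_measurable MT"
      using q_joint[unfolded case_prod_beta'] by (intro borel_measurable_diff) auto
    show ?thesis by measurable
  qed
  also have "(\<lambda>y. nsq (q (max (snd y) 0) (fst y) - Q k (fst y)) * indicator (cell k) (snd y))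
    = (\<lambda>y. nsq (q (snd y) (fst y) - Q k (fst y)) * indicator (cell k) (snd y))"
  proof
    fix y :: "'a \<times> real"
    have "0 \<le> snd y" if "real k * dt \<le> snd y"
      using that dt_pos by (meson mult_nonneg_nonneg of_nat_0_le_iff order_less_imp_le order_trans)
    then show "nsq (q (max (snd y) 0) (fst y) - Q k (fst y)) * indicator (cell k) (snd y)
      = nsq (q (snd y) (fst y) - Q k (fst y)) * indicator (cell k) (snd y)"
      by (auto simp: indicator_def max_def)
  qed
  finally show ?thesis .
qed

lemma step_measurable:
  "k < N \<Longrightarrow> (\<lambda>w. \<integral>\<^sup>+r\<in>cell k. nsq (q r w - Q k w) \<partial>lborel) \<in> borel_measurable M"
  using step_joint[of k] by (intro lborel.borel_measurable_nn_integral) (simp add: case_prod_beta')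

lemma step_err_swap:
  assumes "k < N"
  shows "step_err k = (\<integral>\<^sup>+r\<in>cell k. (msq (\<lambda>w. q r w - Q k w)) \<partial>lborel)"
proof -
  interpret P: pair_sigma_finite M lborel ..
  have "step_err k = (\<integral>\<^sup>+r. (\<integral>\<^sup>+w. nsq (q r w - Q k w) * indicator (cell k) r \<partial>M) \<partial>lborel)"
    unfolding step_err_def using step_joint[OF assms] by (intro P.Fubini'[symmetric]) (simp add: case_prod_beta')
  also have "\<dots> = (\<integral>\<^sup>+r\<in>cell k. (msq (\<lambda>w. q r w - Q k w)) \<partial>lborel)"
    by (intro nn_integral_cong) (auto simp: indicator_def)
  finally show ?thesis .
qed

lemma grid_interval_unique:
  assumes "r \<in> {real k * dt<..real (Suc k) * dt}" "r \<in> {real i * dt<..real (Suc i) * dt}"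
  shows "i = k"
proof -
  have "real k * dt < real (Suc i) * dt" "real i * dt < real (Suc k) * dt" using assms by auto
  then have "real k < real (Suc i)" "real i < real (Suc k)"
    using dt_pos by (auto simp: mult_less_cancel_right simp del: of_nat_Suc)
  then show ?thesis by auto
qed

lemma grid_interval_ex:
  assumes "0 < r" "r \<le> real j * dt"
  obtains k where "k < j" "r \<in> {real k * dt<..real (Suc k) * dt}"
  using assms(2)
proof (induction j arbitrary: thesis)
  case (Suc j)
  show ?case
  proof (cases "r \<le> real j * dt")
    case True
    then show ?thesis using Suc.IH Suc.prems(1) less_SucI by metis
  next
    case False
    then show ?thesis using Suc.prems by (intro Suc.prems(1)[of j]) auto
  qed
qed (use assms in simp)

lemma grid_le_T: "j \<le> N \<Longrightarrow> real j * dt \<le> T"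
  using dt_pos by (simp add: T_eq mult_right_mono)

text \<open>The coefficients of the scheme as an elementary process, with the same
  \<open>1 / eps\<close> as in \<open>diffusion\<close>, so that exact and discrete noise become Ito
  integrals of comparable integrands.\<close>

definition coeff :: "nat \<Rightarrow> 'a \<Rightarrow> real ^ 'd ^ 'd"
  where "coeff k w = (1 / eps) *\<^sub>R \<sigma> (Q k w)"

lemma elementary_coeff:
  assumes "j \<le> N"
  shows "elementary_process M F j (\<lambda>k. real k * dt) coeff"
  unfolding elementary_process_def
proof (intro conjI allI impI)
  fix k assume k: "k < j"
  show "real k * dt \<le> real (Suc k) * dt" using dt_pos by (intro mult_right_mono) auto
  have "Q k \<in> borel_measurable (F (real k * dt))" using QP_measurable[of k] k assms by auto
  from measurable_compose[OF this borel_measurable_continuous_onI[OF \<sigma>_cont]]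
  show "coeff k \<in> borel_measurable (F (real k * dt))"
    unfolding coeff_def by (intro borel_measurable_scaleR) auto
  show "bounded (coeff k ` space M)"
    unfolding bounded_iff
  proof (intro exI[of _ "S / eps"] ballI)
    fix y assume "y \<in> coeff k ` space M"
    then obtain w where "y = (1 / eps) *\<^sub>R \<sigma> (Q k w)" by (auto simp: coeff_def)
    then show "norm y \<le> S / eps"
      using \<sigma>_bound[of "Q k w"] pos by (simp add: divide_right_mono)
  qed
qed simp

lemma elementary_integral_coeff:
  "elementary_integral \<beta> j (\<lambda>k. real k * dt) coeff (real j * dt) w
    = (1 / eps) *\<^sub>R (\<Sum>k<j. \<sigma> (Q k w) *v (\<beta> (real (Suc k) * dt) w - \<beta> (real k * dt) w))"
proof -
  have "min (real i * dt) (real j * dt) = real i * dt" if "i \<le> j" for i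
    using that dt_pos by (auto simp: min_def mult_right_mono)
  then show ?thesis
    unfolding elementary_integral_def scaleR_sum_right coeff_def
    by (intro sum.cong) (auto simp: scaleR_matrix_vector_assoc Suc_le_eq simp del: of_nat_Suc)
qed

lemma elementary_value_coeff:
  assumes "k < j" "r \<in> {real k * dt<..real (Suc k) * dt}"
  shows "elementary_value j (\<lambda>k. real k * dt) coeff r w = coeff k w"
proof -
  have "r \<in> {real i * dt<..real (Suc i) * dt} \<longleftrightarrow> i = k" for i
    using grid_interval_unique[OF assms(2)] assms(2) by blast
  then have "elementary_value j (\<lambda>k. real k * dt) coeff r w = (\<Sum>i<j. if i = k then coeff i w else 0)"
    unfolding elementary_value_def indicator_def by (intro sum.cong refl) (simp del: of_nat_Suc greaterThanAtMost_iff)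
  then show ?thesis using assms(1) by simp
qed

text \<open>The noise sum of the scheme is \<open>eps\<close> times an elementary integral, so
  \<open>ito_integral_elementary_le\<close> applies with its factor 4; on each cell the Lipschitz
  bound for \<open>\<sigma>\<close> compares the integrands.\<close>

lemma ito_scheme_le:
  assumes J: "has_ito_integral M F \<beta> diffusion (real j * dt) J" and j: "j \<le> N"
  shows "msq (\<lambda>w. eps *\<^sub>R J w - (\<Sum>k<j. \<sigma> (Q k w) *v (\<beta> (real (Suc k) * dt) w - \<beta> (real k * dt) w)))
    \<le> ennreal (4 * L\<^sup>2) * (\<Sum>k<j. step_err k)"
proof -
  let ?t = "real j * dt"
  let ?I = "elementary_integral \<beta> j (\<lambda>k. real k * dt) coeff ?t"
  let ?V = "elementary_value j (\<lambda>k. real k * dt) coeff"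
  have t0: "0 \<le> ?t" using dt_pos by simp
  have JM: "J \<in> borel_measurable M"
    using J t0 by (intro measurable_F_M[of ?t]) (auto simp: has_ito_integral_def)
  have IM: "?I \<in> borel_measurable M"
    using elementary_integral_measurable[OF elementary_coeff[OF j] t0] .
  have "msq_on {0..?t} (\<lambda>r w. (1 / eps) *\<^sub>R \<sigma> (q r w) - ?V r w)
    \<le> (\<integral>\<^sup>+w. (\<Sum>k<j. ennreal (L\<^sup>2 / eps\<^sup>2) * (\<integral>\<^sup>+r\<in>cell k. nsq (q r w - Q k w) \<partial>lborel)) \<partial>M)"
  proof (intro nn_integral_mono)
    fix w assume w: "w \<in> space M"
    have m: "(\<lambda>r. nsq (q r w - Q k w) * indicator (cell k) r) \<in> borel_measurable lborel" if "k < j" for k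
      using measurable_Pair2[OF step_joint[of k] w] that j by simp
    have "(\<integral>\<^sup>+r\<in>{0..?t}. nsq ((1 / eps) *\<^sub>R \<sigma> (q r w) - ?V r w) \<partial>lborel)
      \<le> (\<integral>\<^sup>+r. (\<Sum>k<j. ennreal (L\<^sup>2 / eps\<^sup>2) * (nsq (q r w - Q k w) * indicator (cell k) r)) \<partial>lborel)"
      \<comment> \<open>The half-open grid intervals cover only positive times; the time 0 is
        discarded as a null set.\<close>
      using AE_lborel_singleton[of 0]
    proof (intro nn_integral_mono_AE, eventually_elim)
      fix r :: real assume r0: "r \<noteq> 0"
      let ?g = "\<lambda>k. ennreal (L\<^sup>2 / eps\<^sup>2) * (nsq (q r w - Q k w) * indicator (cell k) r)"
      show "nsq ((1 / eps) *\<^sub>R \<sigma> (q r w) - ?V r w) * indicator {0..?t} r \<le> (\<Sum>k<j. ?g k)"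
      proof (cases "r \<in> {0..?t}")
        case True
        then obtain k where k: "k < j" "r \<in> {real k * dt<..real (Suc k) * dt}"
          using grid_interval_ex[of r j] r0 by auto
        have "nsq ((1 / eps) *\<^sub>R \<sigma> (q r w) - ?V r w) = ennreal ((1 / eps)\<^sup>2) * nsq (\<sigma> (q r w) - \<sigma> (Q k w))"
          unfolding elementary_value_coeff[OF k] coeff_def scaleR_diff_right[symmetric] by (rule nsq_scaleR)
        also have "\<dots> \<le> ennreal ((1 / eps)\<^sup>2) * (ennreal (L\<^sup>2) * nsq (q r w - Q k w))"
          by (intro mult_left_mono nsq_\<sigma>_diff_le) simp
        also have "\<dots> = ennreal (L\<^sup>2 / eps\<^sup>2) * nsq (q r w - Q k w)"
          unfolding mult.assoc[symmetric] by (subst ennreal_mult[symmetric]) (auto simp: power_divide)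
        also have "\<dots> = ?g k" using k by simp
        also have "\<dots> \<le> (\<Sum>k<j. ?g k)" using k(1) by (intro member_le_sum) auto
        finally show ?thesis using True by simp
      qed simp
    qed
    also have "\<dots> = (\<Sum>k<j. ennreal (L\<^sup>2 / eps\<^sup>2) * (\<integral>\<^sup>+r\<in>cell k. nsq (q r w - Q k w) \<partial>lborel))"
      using m by (subst nn_integral_sum) (auto intro!: sum.cong nn_integral_cmult)
    finally show "(\<integral>\<^sup>+r\<in>{0..?t}. nsq ((1 / eps) *\<^sub>R \<sigma> (q r w) - ?V r w) \<partial>lborel)
      \<le> (\<Sum>k<j. ennreal (L\<^sup>2 / eps\<^sup>2) * (\<integral>\<^sup>+r\<in>cell k. nsq (q r w - Q k w) \<partial>lborel))" .
  qed
  also have "\<dots> = (\<Sum>k<j. ennreal (L\<^sup>2 / eps\<^sup>2) * step_err k)"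
    unfolding step_err_def using step_measurable j
    by (subst nn_integral_sum) (auto intro!: sum.cong nn_integral_cmult simp del: of_nat_Suc)
  finally have D: "msq_on {0..?t} (\<lambda>r w. (1 / eps) *\<^sub>R \<sigma> (q r w) - ?V r w)
    \<le> ennreal (L\<^sup>2 / eps\<^sup>2) * (\<Sum>k<j. step_err k)" by (simp add: sum_distrib_left)
  have "msq (\<lambda>w. eps *\<^sub>R J w - (\<Sum>k<j. \<sigma> (Q k w) *v (\<beta> (real (Suc k) * dt) w - \<beta> (real k * dt) w)))
      = (\<integral>\<^sup>+w. ennreal (eps\<^sup>2) * nsq (J w - ?I w) \<partial>M)"
    unfolding nsq_scaleR[symmetric] elementary_integral_coeff scaleR_diff_right using pos by simp
  also have "\<dots> = ennreal (eps\<^sup>2) * msq (\<lambda>w. J w - ?I w)"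
    using JM IM by (intro nn_integral_cmult) auto
  also have "\<dots> \<le> ennreal (eps\<^sup>2) * (4 * (ennreal (L\<^sup>2 / eps\<^sup>2) * (\<Sum>k<j. step_err k)))"
    by (intro mult_left_mono order_trans[OF ito_integral_elementary_le[OF J t0 elementary_coeff[OF j]] mult_left_mono[OF D]]) auto
  also have "\<dots> = (ennreal (eps\<^sup>2) * (ennreal 4 * ennreal (L\<^sup>2 / eps\<^sup>2))) * (\<Sum>k<j. step_err k)"
    by (simp add: mult.assoc)
  also have "ennreal (eps\<^sup>2) * (ennreal 4 * ennreal (L\<^sup>2 / eps\<^sup>2)) = ennreal (4 * L\<^sup>2)"
  proof -
    have "ennreal u * (ennreal 4 * ennreal (v / u)) = ennreal (4 * v)" if "0 < u" "0 \<le> v" for u v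
      using that by (simp only: ennreal_mult[symmetric] zero_le_divide_iff zero_le_mult_iff zero_le_numeral less_imp_le simp_thms)
        simp
    then show ?thesis using pos by simp
  qed
  finally show ?thesis .
qed

text \<open>Cauchy-Schwarz is used for the sum over cells and within each cell; the resulting
  factors \<open>j\<close> and \<open>dt\<close> multiply to at most \<open>T\<close>.\<close>

lemma drift_scheme_le:
  assumes w: "w \<in> space M" and j: "j \<le> N"
  shows "nsq (integral {0..real j * dt} (\<lambda>r. f (q r w)) - (\<Sum>k<j. dt *\<^sub>R f (Q k w)))
    \<le> ennreal (T * L\<^sup>2) * (\<Sum>k<j. \<integral>\<^sup>+r\<in>cell k. nsq (q r w - Q k w) \<partial>lborel)"
proof -
  have A: "real k * dt \<le> real (Suc k) * dt" "cell k \<subseteq> {0..}" for k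
  proof -
    show "real k * dt \<le> real (Suc k) * dt" using dt_pos by (intro mult_right_mono) auto
    have "0 \<le> real k * dt" using dt_pos by simp
    then show "cell k \<subseteq> {0..}" by (meson atLeastAtMost_iff atLeast_iff order_trans subsetI)
  qed
  have cont: "continuous_on (cell k) (\<lambda>r. f (q r w))" for k
    using A by (intro f_q_cont w) auto
  have split: "integral {0..real i * dt} (\<lambda>r. f (q r w)) = (\<Sum>k<i. integral (cell k) (\<lambda>r. f (q r w)))" for i
  proof (induction i)
    case (Suc i)
    have "integral {0..real i * dt} (\<lambda>r. f (q r w)) + integral (cell i) (\<lambda>r. f (q r w))
        = integral {0..real (Suc i) * dt} (\<lambda>r. f (q r w))"
      using dt_pos A(1)[of i]
      by (intro Henstock_Kurzweil_Integration.integral_combine integrable_continuous_real f_q_cont w) auto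
    then show ?case using Suc by simp
  qed simp
  have "integral (cell k) (\<lambda>r. f (q r w)) - dt *\<^sub>R f (Q k w) = integral (cell k) (\<lambda>r. f (q r w) - f (Q k w))" for k
  proof -
    have "real (Suc k) * dt - real k * dt = dt" by (simp add: algebra_simps)
    then show ?thesis
      using cont A(1)[of k]
      by (subst Henstock_Kurzweil_Integration.integral_diff) (auto intro: integrable_continuous_real simp del: of_nat_Suc)
  qed
  then have eq: "integral {0..real j * dt} (\<lambda>r. f (q r w)) - (\<Sum>k<j. dt *\<^sub>R f (Q k w))
      = (\<Sum>k<j. integral (cell k) (\<lambda>r. f (q r w) - f (Q k w)))"
    unfolding split by (simp add: sum_subtractf[symmetric])
  have "nsq (integral (cell k) (\<lambda>r. f (q r w) - f (Q k w)))
      \<le> ennreal (dt * L\<^sup>2) * (\<integral>\<^sup>+r\<in>cell k. nsq (q r w - Q k w) \<partial>lborel)" if k: "k < j" for k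
  proof -
    have m: "(\<lambda>r. nsq (q r w - Q k w) * indicator (cell k) r) \<in> borel_measurable lborel"
      using measurable_Pair2[OF step_joint[of k] w] k j by simp
    have "nsq (integral (cell k) (\<lambda>r. f (q r w) - f (Q k w)))
        \<le> ennreal (real (Suc k) * dt - real k * dt) * (\<integral>\<^sup>+r\<in>cell k. nsq (f (q r w) - f (Q k w)) \<partial>lborel)"
      using cont A(1) by (intro nsq_integral_interval_le continuous_on_diff continuous_on_const) auto
    also have "real (Suc k) * dt - real k * dt = dt" by (simp add: algebra_simps)
    also have "ennreal dt * (\<integral>\<^sup>+r\<in>cell k. nsq (f (q r w) - f (Q k w)) \<partial>lborel)
        \<le> ennreal dt * (\<integral>\<^sup>+r. ennreal (L\<^sup>2) * (nsq (q r w - Q k w) * indicator (cell k) r) \<partial>lborel)"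
      unfolding mult.assoc[symmetric]
      by (intro mult_left_mono nn_integral_mono mult_right_mono nsq_f_diff_le) auto
    also have "\<dots> = ennreal dt * (ennreal (L\<^sup>2) * (\<integral>\<^sup>+r\<in>cell k. nsq (q r w - Q k w) \<partial>lborel))"
      using m by (subst nn_integral_cmult) auto
    also have "\<dots> = ennreal (dt * L\<^sup>2) * (\<integral>\<^sup>+r\<in>cell k. nsq (q r w - Q k w) \<partial>lborel)"
      using dt_pos by (simp add: ennreal_mult mult.assoc)
    finally show ?thesis .
  qed
  then have "of_nat j * (\<Sum>k<j. nsq (integral (cell k) (\<lambda>r. f (q r w) - f (Q k w))))
      \<le> of_nat j * (\<Sum>k<j. ennreal (dt * L\<^sup>2) * (\<integral>\<^sup>+r\<in>cell k. nsq (q r w - Q k w) \<partial>lborel))"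
    by (intro mult_left_mono sum_mono) (auto simp del: of_nat_Suc)
  also have "\<dots> = (of_nat j * ennreal (dt * L\<^sup>2)) * (\<Sum>k<j. \<integral>\<^sup>+r\<in>cell k. nsq (q r w - Q k w) \<partial>lborel)"
    by (simp only: sum_distrib_left mult.assoc)
  also have "of_nat j * ennreal (dt * L\<^sup>2) \<le> ennreal (T * L\<^sup>2)"
  proof -
    have "of_nat j * ennreal (dt * L\<^sup>2) = ennreal (real j * (dt * L\<^sup>2))"
      using dt_pos by (subst ennreal_mult) (auto simp: ennreal_of_nat_eq_real_of_nat)
    also have "\<dots> \<le> ennreal (T * L\<^sup>2)"
      using grid_le_T[OF j] by (intro ennreal_leI) (simp add: mult.assoc[symmetric] mult_right_mono)
    finally show ?thesis .
  qed
  finally have "of_nat j * (\<Sum>k<j. nsq (integral (cell k) (\<lambda>r. f (q r w) - f (Q k w))))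
      \<le> ennreal (T * L\<^sup>2) * (\<Sum>k<j. \<integral>\<^sup>+r\<in>cell k. nsq (q r w - Q k w) \<partial>lborel)"
    by (simp add: mult_right_mono)
  then show ?thesis
    unfolding eq by (rule order_trans[OF nsq_sum_le])
qed

text \<open>The constant consists of \<open>2 * (T * L\<^sup>2)\<close> from the drift and
  \<open>2 * (4 * L\<^sup>2)\<close> from the noise.\<close>

lemma Y_scheme_le:
  assumes j: "j \<le> N"
  shows "msq (\<lambda>w. Y (real j * dt) w - Yd j w) \<le> ennreal ((2 * T + 8) * L\<^sup>2) * (\<Sum>k<j. step_err k)"
proof -
  let ?t = "real j * dt"
  define I where "I w = (\<Sum>k<j. \<integral>\<^sup>+r\<in>cell k. nsq (q r w - Q k w) \<partial>lborel)" for w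
  define U where "U w = (\<Sum>k<j. \<sigma> (Q k w) *v (\<beta> (real (Suc k) * dt) w - \<beta> (real k * dt) w))" for w
  have t0: "0 \<le> ?t" using dt_pos by simp
  have JM: "ito ?t \<in> borel_measurable M"
    using has_ito[OF t0] t0 by (intro measurable_F_M[of ?t]) (auto simp: has_ito_integral_def)
  have "U = (\<lambda>w. eps *\<^sub>R elementary_integral \<beta> j (\<lambda>k. real k * dt) coeff ?t w)"
    unfolding elementary_integral_coeff U_def using pos by simp
  then have UM: "U \<in> borel_measurable M"
    using elementary_integral_measurable[OF elementary_coeff[OF j] t0] by simp
  have IM: "I \<in> borel_measurable M"
    unfolding I_def using j by (intro borel_measurable_sum step_measurable) auto
  have EI: "(\<integral>\<^sup>+w. I w \<partial>M) = (\<Sum>k<j. step_err k)"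
    unfolding I_def step_err_def using j by (intro nn_integral_sum step_measurable) auto
  have "AE w in M. nsq (Y ?t w - Yd j w) \<le> 2 * (ennreal (T * L\<^sup>2) * I w) + 2 * nsq (eps *\<^sub>R ito ?t w - U w)"
    using Y_ito[OF t0] AE_space
  proof eventually_elim
    case (elim w)
    let ?D = "integral {0..?t} (\<lambda>r. f (q r w)) - (\<Sum>k<j. dt *\<^sub>R f (Q k w))"
    have eq: "Y ?t w - Yd j w = ?D + (eps *\<^sub>R ito ?t w - U w)"
      unfolding elim(1) Yd_def increment_def U_def sum.distrib by (simp add: algebra_simps)
    have "nsq (Y ?t w - Yd j w) \<le> 2 * nsq ?D + 2 * nsq (eps *\<^sub>R ito ?t w - U w)"
      unfolding eq by (rule nsq_add_le)
    also have "\<dots> \<le> 2 * (ennreal (T * L\<^sup>2) * I w) + 2 * nsq (eps *\<^sub>R ito ?t w - U w)"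
      unfolding I_def by (rule add_right_mono[OF mult_left_mono[OF drift_scheme_le[OF elim(2) j]]]) simp
    finally show ?case .
  qed
  then have "msq (\<lambda>w. Y ?t w - Yd j w)
      \<le> (\<integral>\<^sup>+w. 2 * (ennreal (T * L\<^sup>2) * I w) + 2 * nsq (eps *\<^sub>R ito ?t w - U w) \<partial>M)"
    by (rule nn_integral_mono_AE)
  also have "\<dots> = 2 * (ennreal (T * L\<^sup>2) * (\<Sum>k<j. step_err k)) + 2 * msq (\<lambda>w. eps *\<^sub>R ito ?t w - U w)"
    using JM UM IM unfolding EI[symmetric] by (simp add: nn_integral_add nn_integral_cmult)
  also have "\<dots> \<le> 2 * (ennreal (T * L\<^sup>2) * (\<Sum>k<j. step_err k)) + 2 * (ennreal (4 * L\<^sup>2) * (\<Sum>k<j. step_err k))"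
    unfolding U_def by (rule add_left_mono[OF mult_left_mono[OF ito_scheme_le[OF has_ito[OF t0] j]]]) simp
  also have "\<dots> = (2 * ennreal (T * L\<^sup>2) + 2 * ennreal (4 * L\<^sup>2)) * (\<Sum>k<j. step_err k)"
    by (simp only: distrib_right mult.assoc)
  also have "2 * ennreal (T * L\<^sup>2) + 2 * ennreal (4 * L\<^sup>2) = ennreal ((2 * T + 8) * L\<^sup>2)"
  proof -
    have eq: "2 * ennreal u + 2 * ennreal v = ennreal (2 * u + 2 * v)" if "0 \<le> u" "0 \<le> v" for u v
      using that by (simp add: ennreal_mult)
    show ?thesis using pos by (subst eq) (auto simp: algebra_simps)
  qed
  finally show ?thesis .
qed

end

text \<open>\<open>\<mu>\<close> bounds the second moments of the position and \<open>h\<close> the mean-square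
  Hoelder constant of \<open>Y\<close>, both relative to \<open>1 + \<bar>q\<^sub>0\<^sup>0\<bar>\<^sup>2\<close>.\<close>

definition error_const :: "real \<Rightarrow> real \<Rightarrow> real \<Rightarrow> real \<Rightarrow> real \<Rightarrow> real \<Rightarrow> real" where
  "error_const L c0 S T A R =
    (let \<mu> = (1 + 8 * T\<^sup>2 * L\<^sup>2 * exp (8 * T * L\<^sup>2 * T)) * (4 * A + 4 * R + 8 * T\<^sup>2 * c0\<^sup>2 + 32 * S\<^sup>2 * T);
         h = 2 * T * (2 * c0\<^sup>2 + 2 * L\<^sup>2 * \<mu>) + 16 * S\<^sup>2;
         B = 8 * h + 4 * ((2 * T + 8) * L\<^sup>2) * (4 * R + 4 * h * T);
         G = 8 * ((2 * T + 8) * L\<^sup>2)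
     in 72 * R + B + G * exp (G * T) * (144 * R + B * T))"

section \<open>Error recursion and explicit constants\<close>

context langevin_discrete
begin

abbreviation "R \<equiv> (norm (eps *\<^sub>R b))\<^sup>2"
abbreviation "H \<equiv> holder_const"
abbreviation "scheme_const \<equiv> (2 * T + 8) * L\<^sup>2"

lemma scheme_const_nonneg: "0 \<le> scheme_const"
  using pos by simp

text \<open>Within the cell, \<open>q r\<close> departs from its value at the left end as in
  \<open>q_regularity\<close>, and the rest is \<open>err k\<close>. The layer term grows with
  \<open>r\<close>, so its value at the right end serves for the whole cell.\<close>

lemma step_err_le:
  assumes k: "k < N"
  shows "step_err k \<le> ennreal (2 * dt) * err k
    + ennreal (2 * dt * (2 * ((exp (- (real k * x)) - exp (- (real (Suc k) * x)))\<^sup>2 * R) + 2 * (H * dt)))"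
proof -
  define d where "d = exp (- (real k * x)) - exp (- (real (Suc k) * x))"
  define t where "t = real k * dt"
  define t' where "t' = real (Suc k) * dt"
  have t: "0 \<le> t" "t \<le> t'" "t' - t = dt" using dt_pos by (auto simp: t_def t'_def algebra_simps)
  have t'T: "t' \<le> T" using grid_le_T[of "Suc k"] k by (simp add: t'_def)
  have Qm: "Q k \<in> borel_measurable M" using k by (intro Q_measurable) simp
  define Z where "Z = 2 * (d\<^sup>2 * R) + 2 * (H * dt)"
  have Z0: "0 \<le> Z" using holder_const_nonneg dt_pos by (simp add: Z_def)
  have le: "msq (\<lambda>w. q r w - Q k w) \<le> 2 * ennreal Z + 2 * err k" if r: "r \<in> {t..t'}" for r
  proof -
    have r0: "0 \<le> r" using r t by simp
    have "msq (\<lambda>w. q r w - Q k w)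
      \<le> 2 * msq (\<lambda>w. q r w - q t w) + 2 * msq (\<lambda>w. q t w - Q k w)"
      using q_measurable[OF r0] q_measurable[OF t(1)] Qm by (intro nn_integral_nsq_triangle) auto
    also have "msq (\<lambda>w. q t w - Q k w) = err k"
      by (simp add: err_def t_def norm_minus_commute)
    finally have 1: "msq (\<lambda>w. q r w - Q k w) \<le> 2 * msq (\<lambda>w. q r w - q t w) + 2 * err k" .
    have "msq (\<lambda>w. q r w - q t w)
      \<le> ennreal (2 * ((exp (- (t / eps\<^sup>2)) - exp (- (r / eps\<^sup>2)))\<^sup>2 * R) + 2 * (H * (r - t)))"
      using r t t'T by (intro q_regularity) auto
    also have "\<dots> \<le> ennreal Z"
    proof -
      have e: "exp (- (r / eps\<^sup>2)) \<le> exp (- (t / eps\<^sup>2))" "exp (- (t' / eps\<^sup>2)) \<le> exp (- (r / eps\<^sup>2))"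
        using r by (auto intro!: divide_right_mono)
      have d: "d = exp (- (t / eps\<^sup>2)) - exp (- (t' / eps\<^sup>2))"
        by (simp add: d_def t_def t'_def x_def)
      have "(exp (- (t / eps\<^sup>2)) - exp (- (r / eps\<^sup>2)))\<^sup>2 \<le> d\<^sup>2"
        unfolding d using e by (intro power_mono) auto
      moreover have "r - t \<le> dt" using r t(3) by simp
      ultimately show ?thesis
        unfolding Z_def using holder_const_nonneg by (intro ennreal_leI add_mono mult_left_mono mult_right_mono) auto
    qed
    finally have 2: "msq (\<lambda>w. q r w - q t w) \<le> ennreal Z" .
    show ?thesis by (rule order_trans[OF 1 add_right_mono[OF mult_left_mono[OF 2]]]) simp
  qed
  have "step_err k \<le> (\<integral>\<^sup>+r\<in>{t..t'}. (2 * ennreal Z + 2 * err k) \<partial>lborel)"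
    unfolding step_err_swap[OF k] t_def[symmetric] t'_def[symmetric]
    using le by (intro nn_integral_mono) (auto simp: indicator_def)
  also have "\<dots> = (2 * ennreal Z + 2 * err k) * ennreal dt"
    using t by (simp add: nn_integral_cmult_indicator)
  also have "\<dots> = ennreal (2 * dt) * err k + ennreal (2 * dt * Z)"
  proof -
    have "ennreal (2 * dt) = 2 * ennreal dt" "ennreal (2 * dt * Z) = 2 * ennreal dt * ennreal Z"
      using dt_pos Z0 by (simp_all add: ennreal_mult)
    then show ?thesis by (simp only: distrib_left distrib_right mult_ac add_ac)
  qed
  finally show ?thesis by (simp only: Z_def d_def)
qed

text \<open>The layer term of cell \<open>k\<close> is the squared drop of
  \<open>exp (- t / eps\<^sup>2)\<close> across the cell. The drops lie between 0 and 1, so their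
  squares are at most the drops, whose sum telescopes to at most 1. The initial layer thus costs
  \<open>4 * R * dt\<close> altogether, however the cell width compares with
  \<open>eps\<^sup>2\<close>.\<close>

lemma sum_step_err_le:
  assumes n: "n \<le> N"
  shows "(\<Sum>k<n. step_err k) \<le> ennreal (2 * dt) * (\<Sum>k<n. err k) + ennreal (dt * (4 * R + 4 * H * T))"
proof -
  define d where "d k = exp (- (real k * x)) - exp (- (real (Suc k) * x))" for k
  have d01: "0 \<le> d k" "d k \<le> 1" for k
  proof -
    have "real k * x \<le> real (Suc k) * x" using x_pos by (intro mult_right_mono) auto
    then show "0 \<le> d k" by (simp add: d_def)
    have "exp (- (real k * x)) \<le> 1" using x_pos by simp
    then show "d k \<le> 1" unfolding d_def using exp_ge_zero[of "- (real (Suc k) * x)"] by linarith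
  qed
  have "(\<Sum>k<n. (d k)\<^sup>2) \<le> (\<Sum>k<n. d k)"
    using d01 by (intro sum_mono) (simp add: power2_eq_square mult_left_le)
  also have "\<dots> = 1 - exp (- (real n * x))"
    unfolding d_def by (induction n) (auto simp del: of_nat_Suc)
  also have "\<dots> \<le> 1" by simp
  finally have sd: "(\<Sum>k<n. (d k)\<^sup>2) \<le> 1" .
  let ?z = "\<lambda>k. 2 * dt * (2 * ((d k)\<^sup>2 * R) + 2 * (H * dt))"
  have z0: "0 \<le> ?z k" for k using holder_const_nonneg dt_pos by simp
  have "(\<Sum>k<n. step_err k) \<le> (\<Sum>k<n. ennreal (2 * dt) * err k + ennreal (?z k))"
    using step_err_le n by (intro sum_mono) (auto simp: d_def simp del: of_nat_Suc)
  also have "\<dots> = ennreal (2 * dt) * (\<Sum>k<n. err k) + ennreal (\<Sum>k<n. ?z k)"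
    using z0 by (subst sum_ennreal[symmetric]) (simp_all add: sum.distrib sum_distrib_left)
  also have "ennreal (\<Sum>k<n. ?z k) \<le> ennreal (dt * (4 * R + 4 * H * T))"
  proof (intro ennreal_leI)
    have "(\<Sum>k<n. ?z k) = dt * (4 * R * (\<Sum>k<n. (d k)\<^sup>2) + 4 * H * (real n * dt))"
      by (simp add: sum.distrib sum_distrib_left algebra_simps)
    also have "\<dots> \<le> dt * (4 * R * 1 + 4 * H * T)"
      using sd grid_le_T[OF n] holder_const_nonneg dt_pos by (intro mult_left_mono add_mono) auto
    finally show "(\<Sum>k<n. ?z k) \<le> dt * (4 * R + 4 * H * T)" by simp
  qed
  finally show ?thesis by (simp add: add_left_mono)
qed

lemma Yd_path_integrable: "integrable expo (\<lambda>u. Yd (n - nat \<lfloor>u / l\<rfloor>) w)"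
proof (rule expo.integrable_const_bound[where B = "\<Sum>i\<le>n. norm (Yd i w)"])
  show "AE u in expo. norm (Yd (n - nat \<lfloor>u / l\<rfloor>) w) \<le> (\<Sum>i\<le>n. norm (Yd i w))"
    by (intro AE_I2 member_le_sum) auto
  show "(\<lambda>u. Yd (n - nat \<lfloor>u / l\<rfloor>) w) \<in> borel_measurable expo" by measurable
qed

text \<open>Truncation of the index at 0 and the constant extension of \<open>Y\<close> agree, so
  the coupled times can be subtracted without distinguishing cases.\<close>

lemma Y_floor:
  assumes "0 \<le> u" "0 < l"
  shows "Y (real (n - nat \<lfloor>u / l\<rfloor>) * dt) = Y (real n * dt - dt * real_of_int \<lfloor>u / l\<rfloor>)"
proof -
  have f0: "0 \<le> \<lfloor>u / l\<rfloor>" using assms by simp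
  have "real (n - nat \<lfloor>u / l\<rfloor>) * dt = max (real n * dt - dt * real_of_int \<lfloor>u / l\<rfloor>) 0"
  proof (cases "nat \<lfloor>u / l\<rfloor> \<le> n")
    case True
    then have "real_of_int \<lfloor>u / l\<rfloor> \<le> real n" using f0 by (simp add: nat_le_iff)
    then have "dt * real_of_int \<lfloor>u / l\<rfloor> \<le> dt * real n" using dt_pos by (intro mult_left_mono) auto
    then show ?thesis using True f0 by (simp add: of_nat_diff algebra_simps)
  next
    case False
    then have "int n < \<lfloor>u / l\<rfloor>" by linarith
    then have "real n \<le> real_of_int \<lfloor>u / l\<rfloor>" by linarith
    then have "dt * real n \<le> dt * real_of_int \<lfloor>u / l\<rfloor>" using dt_pos by (intro mult_left_mono) auto
    then show ?thesis using False by (simp add: mult.commute)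
  qed
  then show ?thesis by (simp add: Y_max)
qed

text \<open>The difference of the averages is split at the grid time of index \<open>J u\<close>:
  there \<open>Y_scheme_le\<close> compares scheme and equation, and \<open>Y_holder\<close> covers
  the move to \<open>t - eps\<^sup>2 * u\<close>. The constants are
  \<open>72 = 2 * 6\<^sup>2\<close>, with 6 from \<open>exp_euler_power_diff\<close>, and
  \<open>8 = 2 * 2 * 2\<close>, where one factor is the mean of \<open>1 + u\<close>.\<close>

lemma err_le_step_err:
  assumes n: "n \<le> N"
  shows "err n \<le> ennreal (72 * R / (real n + 1)\<^sup>2 + 8 * (H * dt)) + 4 * (ennreal scheme_const * (\<Sum>k<n. step_err k))"
proof -
  interpret PP: pair_sigma_finite M expo ..
  define l where "l = ln (1 + x)"
  have l: "0 < l" using x_pos by (simp add: l_def)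
  define t where "t = real n * dt"
  have t: "0 \<le> t" "t \<le> T" using dt_pos grid_le_T[OF n] by (auto simp: t_def)
  define e where "e = exp (- (real n * x)) - (1 / (1 + x)) ^ n"
  define J where "J u = n - nat \<lfloor>u / l\<rfloor>" for u :: real
  define D where "D u w = Yd (J u) w - Y (t - eps\<^sup>2 * u) w" for u w
  define G where "G = ennreal scheme_const * (\<Sum>k<n. step_err k)"
  have Jn: "J u \<le> n" for u by (simp add: J_def)
  have D_joint: "(\<lambda>y. nsq (D (snd y) (fst y))) \<in> borel_measurable (M \<Otimes>\<^sub>M expo)"
  proof -
    have "(\<lambda>y. (fst y, t - eps\<^sup>2 * snd y)) \<in> measurable (M \<Otimes>\<^sub>M expo) (M \<Otimes>\<^sub>M lborel)" by measurable
    from measurable_compose[OF this Y_joint]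
    have 1: "(\<lambda>y. Y (t - eps\<^sup>2 * snd y) (fst y)) \<in> borel_measurable (M \<Otimes>\<^sub>M expo)" by simp
    \<comment> \<open>Measurability of \<open>Yd i\<close> is available for
      \<open>i \<le> N\<close>; the minimum keeps the countable family in this range and changes
      nothing, as \<open>J u \<le> n\<close>.\<close>
    have [measurable]: "Yd (min n i) \<in> borel_measurable M" for i using n by (intro Yd_measurable) simp
    have "(\<lambda>y. Yd (min n (J (snd y))) (fst y)) \<in> borel_measurable (M \<Otimes>\<^sub>M expo)"
      unfolding J_def by (rule measurable_compose_countable[where f = "\<lambda>i y. Yd (min n i) (fst y)"]) measurable
    then have 2: "(\<lambda>y. Yd (J (snd y)) (fst y)) \<in> borel_measurable (M \<Otimes>\<^sub>M expo)"
      using Jn by (simp add: min_absorb2)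
    show ?thesis unfolding D_def using borel_measurable_diff[OF 2 1] by measurable
  qed
  then have D_meas [measurable]: "(\<lambda>w. \<integral>\<^sup>+u. nsq (D u w) \<partial>expo) \<in> borel_measurable M"
    by (intro expo.borel_measurable_nn_integral) (simp add: case_prod_beta')
  have e_le: "e\<^sup>2 \<le> 36 / (real n + 1)\<^sup>2"
  proof -
    have "\<bar>e\<bar>\<^sup>2 \<le> (6 / (real n + 1))\<^sup>2"
      unfolding e_def using x_pos by (intro power_mono exp_euler_power_diff) auto
    then show ?thesis by (simp add: power_divide)
  qed
  have "AE w in M. nsq (Q n w - q t w) \<le> ennreal (72 * R / (real n + 1)\<^sup>2) + 2 * (\<integral>\<^sup>+u. nsq (D u w) \<partial>expo)"
    using AE_q_average AE_space
  proof eventually_elim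
    case (elim w)
    have tx: "t / eps\<^sup>2 = real n * x" by (simp add: t_def x_def)
    have q: "q t w = a + (1 - exp (- (real n * x))) *\<^sub>R (eps *\<^sub>R b) + (\<integral>u. Y (t - eps\<^sup>2 * u) w \<partial>expo)"
      using elim(1)[rule_format, OF t(1)] unfolding tx by (simp add: diff_eq_eq add_ac)
    have Q: "Q n w = a + (1 - (1 / (1 + x)) ^ n) *\<^sub>R (eps *\<^sub>R b) + (\<integral>u. Yd (J u) w \<partial>expo)"
      using Q_average[OF elim(2) n] unfolding J_def l_def by (simp add: diff_eq_eq add_ac)
    have int: "integrable expo (\<lambda>u. Yd (J u) w)" "integrable expo (\<lambda>u. Y (t - eps\<^sup>2 * u) w)"
      unfolding J_def by (intro Yd_path_integrable Y_path_integrable elim)+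
    have d: "Q n w - q t w = e *\<^sub>R (eps *\<^sub>R b) + (\<integral>u. D u w \<partial>expo)"
      unfolding D_def q Q Bochner_Integration.integral_diff[OF int] by (simp add: e_def algebra_simps)
    have "nsq (Q n w - q t w) \<le> 2 * nsq (e *\<^sub>R (eps *\<^sub>R b)) + 2 * nsq (\<integral>u. D u w \<partial>expo)"
      unfolding d by (rule nsq_add_le)
    also have "\<dots> \<le> 2 * nsq (e *\<^sub>R (eps *\<^sub>R b)) + 2 * (\<integral>\<^sup>+u. nsq (D u w) \<partial>expo)"
      using int unfolding D_def
      by (intro add_left_mono[OF mult_left_mono[OF expo.nsq_expectation_le]] borel_measurable_diff) auto
    also have "\<dots> \<le> ennreal (72 * R / (real n + 1)\<^sup>2) + 2 * (\<integral>\<^sup>+u. nsq (D u w) \<partial>expo)"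
    proof (rule add_right_mono)
      have "2 * nsq (e *\<^sub>R (eps *\<^sub>R b)) = ennreal (2 * (e\<^sup>2 * R))"
        unfolding norm_scaleR[of e] by (simp add: power_mult_distrib ennreal_mult)
      also have "\<dots> \<le> ennreal (2 * (36 / (real n + 1)\<^sup>2 * R))"
        using e_le by (intro ennreal_leI mult_left_mono mult_right_mono) auto
      finally show "2 * nsq (e *\<^sub>R (eps *\<^sub>R b)) \<le> ennreal (72 * R / (real n + 1)\<^sup>2)" by simp
    qed
    finally show ?case .
  qed
  then have "err n \<le> (\<integral>\<^sup>+w. ennreal (72 * R / (real n + 1)\<^sup>2) + 2 * (\<integral>\<^sup>+u. nsq (D u w) \<partial>expo) \<partial>M)"
    unfolding err_def t_def by (rule nn_integral_mono_AE)
  also have "\<dots> = ennreal (72 * R / (real n + 1)\<^sup>2) + 2 * (\<integral>\<^sup>+w. (\<integral>\<^sup>+u. nsq (D u w) \<partial>expo) \<partial>M)"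
    using D_meas by (subst nn_integral_add) (auto simp: nn_integral_cmult emeasure_space_1)
  finally have 1: "err n \<le> ennreal (72 * R / (real n + 1)\<^sup>2) + 2 * (\<integral>\<^sup>+w. (\<integral>\<^sup>+u. nsq (D u w) \<partial>expo) \<partial>M)" .
  have "(\<integral>\<^sup>+w. (\<integral>\<^sup>+u. nsq (D u w) \<partial>expo) \<partial>M) = (\<integral>\<^sup>+u. (msq (\<lambda>w. D u w)) \<partial>expo)"
    using D_joint by (intro PP.Fubini'[symmetric]) (simp add: case_prod_beta')
  also have "\<dots> \<le> (\<integral>\<^sup>+u. 2 * G + ennreal (2 * (H * dt)) * ennreal (1 + u) \<partial>expo)"
    using AE_expo_nonneg
  proof (intro nn_integral_mono_AE, eventually_elim)
    fix u :: real assume u: "0 \<le> u"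
    define s where "s = t - dt * real_of_int \<lfloor>u / l\<rfloor>"
    have Ys: "Y (real (J u) * dt) = Y s"
      unfolding J_def s_def t_def by (rule Y_floor[OF u l])
    have "0 \<le> dt * real_of_int \<lfloor>u / l\<rfloor>" "0 \<le> eps\<^sup>2 * u" using dt_pos u l by simp_all
    then have sT: "s \<le> T" "t - eps\<^sup>2 * u \<le> T" using t unfolding s_def by linarith+
    \<comment> \<open>By \<open>eps\<^sup>2 = dt / x\<close>, both shifts are expressed in units of
      the step, where \<open>abs_floor_div_ln_diff\<close> compares them.\<close>
    have "s - (t - eps\<^sup>2 * u) = dt * (u / x - real_of_int \<lfloor>u / l\<rfloor>)"
      using dt_pos pos by (simp add: s_def x_def algebra_simps)
    then have "\<bar>s - (t - eps\<^sup>2 * u)\<bar> = dt * \<bar>u / x - real_of_int \<lfloor>u / l\<rfloor>\<bar>"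
      using dt_pos by (simp add: abs_mult)
    also have "\<dots> \<le> dt * (1 + u)"
      unfolding l_def using dt_pos by (intro mult_left_mono abs_floor_div_ln_diff x_pos u) simp
    finally have dist: "\<bar>s - (t - eps\<^sup>2 * u)\<bar> \<le> dt * (1 + u)" .
    have Ym: "Yd (J u) \<in> borel_measurable M" using Jn n by (intro Yd_measurable) (metis order_trans)
    have A: "msq (\<lambda>w. Yd (J u) w - Y s w) \<le> G"
    proof -
      have "msq (\<lambda>w. Yd (J u) w - Y s w) = msq (\<lambda>w. Y (real (J u) * dt) w - Yd (J u) w)"
        unfolding Ys by (simp add: norm_minus_commute)
      also have "\<dots> \<le> ennreal scheme_const * (\<Sum>k<J u. step_err k)"
        using Jn[of u] n by (intro Y_scheme_le) linarith
      also have "\<dots> \<le> G"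
        unfolding G_def using Jn[of u] by (intro mult_left_mono sum_mono2) auto
      finally show ?thesis .
    qed
    have B: "msq (\<lambda>w. Y s w - Y (t - eps\<^sup>2 * u) w) \<le> ennreal (H * (dt * (1 + u)))"
      using dist holder_const_nonneg
      by (intro order_trans[OF Y_holder[OF sT(2,1)] ennreal_leI] mult_left_mono) auto
    have "msq (\<lambda>w. D u w) \<le> 2 * msq (\<lambda>w. Yd (J u) w - Y s w)
        + 2 * msq (\<lambda>w. Y s w - Y (t - eps\<^sup>2 * u) w)"
      unfolding D_def using Ym by (intro nn_integral_nsq_triangle) auto
    also have "\<dots> \<le> 2 * G + 2 * ennreal (H * (dt * (1 + u)))"
      by (rule add_mono[OF mult_left_mono[OF A] mult_left_mono[OF B]]) auto
    also have "2 * ennreal (H * (dt * (1 + u))) = ennreal (2 * (H * dt)) * ennreal (1 + u)"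
      using holder_const_nonneg dt_pos u by (simp add: ennreal_mult mult.assoc)
    finally show "msq (\<lambda>w. D u w) \<le> 2 * G + ennreal (2 * (H * dt)) * ennreal (1 + u)" .
  qed
  also have "\<dots> = 2 * G + ennreal (2 * (H * dt)) * 2"
    using expo.emeasure_space_1 nn_integral_expo_1_plus
    by (subst nn_integral_add) (auto simp: nn_integral_cmult)
  finally have 2: "(\<integral>\<^sup>+w. (\<integral>\<^sup>+u. nsq (D u w) \<partial>expo) \<partial>M) \<le> 2 * G + ennreal (2 * (H * dt)) * 2" .
  have "err n \<le> ennreal (72 * R / (real n + 1)\<^sup>2) + 2 * (2 * G + ennreal (2 * (H * dt)) * 2)"
    by (rule order_trans[OF 1 add_left_mono[OF mult_left_mono[OF 2]]]) simp
  also have "\<dots> = ennreal (72 * R / (real n + 1)\<^sup>2 + 8 * (H * dt)) + 4 * G"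
  proof -
    have "ennreal u + 2 * (2 * g + ennreal (2 * v) * 2) = ennreal (u + 8 * v) + 4 * g" if "0 \<le> u" "0 \<le> v" for u v g
    proof -
      have "ennreal (u + 8 * v) = ennreal u + 8 * ennreal v" using that by (simp add: ennreal_mult)
      moreover have "ennreal (2 * v) = 2 * ennreal v" using that by (simp add: ennreal_mult)
      moreover have "2 * (2 * g + 2 * V * 2) = 4 * g + 8 * V" for V :: ennreal
      proof -
        have "2 * V * 2 = (2 * 2) * V" by (simp only: mult_ac)
        then show ?thesis by (simp add: distrib_left mult.assoc[symmetric])
      qed
      ultimately show ?thesis by (simp only: add_ac)
    qed
    from this[of "72 * R / (real n + 1)\<^sup>2" "H * dt" G] show ?thesis
      using holder_const_nonneg dt_pos by simp
  qed
  finally show ?thesis by (simp only: G_def)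
qed

text \<open>The term \<open>72 * R / (k + 1)\<^sup>2\<close> need not be small for small
  \<open>k\<close>, but Gronwall retains it once, at index \<open>n\<close>; otherwise it enters
  through its sum, at most \<open>144 * R\<close>, times \<open>G * dt\<close>. All other
  contributions are proportional to \<open>dt\<close>.\<close>

lemma err_le:
  assumes n: "n \<le> N"
    and B: "B = 8 * H + 4 * scheme_const * (4 * R + 4 * H * T)" and G: "G = 8 * scheme_const"
  shows "err n \<le> ennreal (72 * R / (real n + 1)\<^sup>2 + dt * (B + G * exp (G * T) * (144 * R + B * T)))"
proof -
  define bb where "bb k = 72 * R / (real k + 1)\<^sup>2 + B * dt" for k :: nat
  have B0: "0 \<le> B" unfolding B
    using holder_const_nonneg scheme_const_nonneg pos by (intro add_nonneg_nonneg mult_nonneg_nonneg) auto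
  have G0: "0 \<le> G" unfolding G using scheme_const_nonneg by simp
  \<comment> \<open>The factor 8 in \<open>G\<close> is 4 from \<open>err_le_step_err\<close> times
    2 from \<open>sum_step_err_le\<close>.\<close>
  have rec: "err k \<le> ennreal (bb k) + ennreal (G * dt) * (\<Sum>i<k. err i)" if k: "k \<le> N" for k
  proof -
    have "err k \<le> ennreal (72 * R / (real k + 1)\<^sup>2 + 8 * (H * dt))
        + 4 * (ennreal scheme_const * (ennreal (2 * dt) * (\<Sum>i<k. err i) + ennreal (dt * (4 * R + 4 * H * T))))"
      by (rule order_trans[OF err_le_step_err[OF k] add_left_mono[OF mult_left_mono[OF mult_left_mono[OF sum_step_err_le[OF k]]]]]) auto
    also have "\<dots> = ennreal (bb k) + ennreal (G * dt) * (\<Sum>i<k. err i)"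
    proof -
      have eq: "ennreal u + 4 * (ennreal v * (ennreal (2 * dt) * w + ennreal z))
          = ennreal (u + 4 * v * z) + ennreal (8 * v * dt) * w" if "0 \<le> u" "0 \<le> v" "0 \<le> z" for u v z w
      proof -
        have "ennreal (8 * v * dt) = 4 * (ennreal v * ennreal (2 * dt))"
          "ennreal (u + 4 * v * z) = ennreal u + 4 * (ennreal v * ennreal z)"
          using that dt_pos by (simp_all add: ennreal_mult mult_ac)
        then show ?thesis by (simp only: distrib_left mult.assoc add_ac)
      qed
      have bbeq: "72 * R / (real k + 1)\<^sup>2 + 8 * (H * dt) + 4 * scheme_const * (dt * (4 * R + 4 * H * T)) = bb k"
        by (simp add: bb_def B algebra_simps)
      show ?thesis
        unfolding bbeq[symmetric] G
        by (rule eq) (use holder_const_nonneg dt_pos pos scheme_const_nonneg in auto)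
    qed
    finally show ?thesis .
  qed
  have "err n \<le> ennreal (bb n + (G * dt) * exp ((G * dt) * real n) * (\<Sum>k<n. bb k))"
    using B0 G0 dt_pos n by (intro discrete_gronwall_ennreal[OF rec]) (auto simp: bb_def)
  also have "\<dots> \<le> ennreal (72 * R / (real n + 1)\<^sup>2 + dt * (B + G * exp (G * T) * (144 * R + B * T)))"
  proof (intro ennreal_leI)
    have nT: "dt * real n \<le> T" using grid_le_T[OF n] by (simp add: mult.commute)
    have "(\<Sum>k<n. bb k) = 72 * R * (\<Sum>k<n. 1 / (real k + 1)\<^sup>2) + B * (dt * real n)"
      by (simp add: bb_def sum.distrib sum_distrib_left)
    also have "\<dots> \<le> 72 * R * 2 + B * T"
      using sum_inverse_squares_le nT B0 by (intro add_mono mult_left_mono) auto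
    finally have s: "(\<Sum>k<n. bb k) \<le> 144 * R + B * T" by simp
    have e: "exp ((G * dt) * real n) \<le> exp (G * T)"
      using nT G0 by (simp add: mult.assoc mult_left_mono)
    have s0: "0 \<le> (\<Sum>k<n. bb k)" using B0 dt_pos by (intro sum_nonneg) (auto simp: bb_def)
    have "(G * dt) * exp ((G * dt) * real n) * (\<Sum>k<n. bb k) \<le> (G * dt) * exp (G * T) * (144 * R + B * T)"
      using e s s0 G0 dt_pos by (intro mult_mono) auto
    then show "bb n + (G * dt) * exp ((G * dt) * real n) * (\<Sum>k<n. bb k)
      \<le> 72 * R / (real n + 1)\<^sup>2 + dt * (B + G * exp (G * T) * (144 * R + B * T))"
      by (simp add: bb_def algebra_simps)
  qed
  finally show ?thesis .
qed

text \<open>Constants built from \<open>a\<close>, \<open>b\<close> and \<open>eps\<close> are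
  exchanged for ones built from the bounds \<open>A\<close> and \<open>R'\<close>. Each is affine in
  the data with nonnegative coefficients, hence at most \<open>w\<close> times its value at the
  bounds. The term in \<open>1 / (n + 1)\<^sup>2\<close> involves only \<open>R\<close> and so
  carries no factor \<open>w\<close>.\<close>

lemma err_uniform:
  assumes n: "n \<le> N" and A: "(norm a)\<^sup>2 \<le> A * w" "0 \<le> A" and R: "R \<le> R'" and w: "1 \<le> w"
  shows "err n \<le> ennreal (error_const L c0 S T A R' * w * dt + error_const L c0 S T A R' / (real n + 1)\<^sup>2)"
proof -
  define m where "m = 1 + 8 * T\<^sup>2 * L\<^sup>2 * exp (8 * T * L\<^sup>2 * T)"
  define \<mu> where "\<mu> = m * (4 * A + 4 * R' + 8 * T\<^sup>2 * c0\<^sup>2 + 32 * S\<^sup>2 * T)"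
  define h where "h = 2 * T * (2 * c0\<^sup>2 + 2 * L\<^sup>2 * \<mu>) + 16 * S\<^sup>2"
  define B' where "B' = 8 * h + 4 * scheme_const * (4 * R' + 4 * h * T)"
  define G where "G = 8 * scheme_const"
  define B where "B = 8 * H + 4 * scheme_const * (4 * R + 4 * H * T)"
  define E where "E = G * exp (G * T)"
  have C: "error_const L c0 S T A R' = 72 * R' + B' + E * (144 * R' + B' * T)"
    unfolding error_const_def Let_def \<mu>_def m_def h_def B'_def G_def E_def by (rule refl)
  have R0: "0 \<le> R'" using R zero_le_power2 order_trans by blast
  have m0: "0 \<le> m" by (simp add: m_def)
  have \<mu>0: "0 \<le> \<mu>" unfolding \<mu>_def using m0 A(2) R0 pos by (intro mult_nonneg_nonneg add_nonneg_nonneg) auto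
  have h0: "0 \<le> h" unfolding h_def using \<mu>0 pos by simp
  have B'0: "0 \<le> B'" unfolding B'_def using h0 R0 pos scheme_const_nonneg by (intro add_nonneg_nonneg mult_nonneg_nonneg) auto
  have G0: "0 \<le> G" unfolding G_def using scheme_const_nonneg by simp
  have E0: "0 \<le> E" using G0 by (simp add: E_def)
  have up: "z \<le> z * w" if "0 \<le> z" for z using mult_left_mono[OF w that] by simp
  have Rw: "R \<le> R' * w" using R up[OF R0] by simp
  have "init_bound + 32 * S\<^sup>2 * T \<le> 4 * (A * w) + 4 * (R' * w) + (8 * T\<^sup>2 * c0\<^sup>2) * w + (32 * S\<^sup>2 * T) * w"
    unfolding init_bound_def using A(1) Rw pos by (intro add_mono mult_left_mono up) auto
  also have "\<dots> = (4 * A + 4 * R' + 8 * T\<^sup>2 * c0\<^sup>2 + 32 * S\<^sup>2 * T) * w" by (simp add: algebra_simps)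
  finally have "moment_bound \<le> m * ((4 * A + 4 * R' + 8 * T\<^sup>2 * c0\<^sup>2 + 32 * S\<^sup>2 * T) * w)"
    unfolding moment_bound_def m_def[symmetric] using m0 by (rule mult_left_mono)
  then have mb: "moment_bound \<le> \<mu> * w" by (simp add: \<mu>_def mult.assoc)
  have "H \<le> 2 * T * (2 * c0\<^sup>2 * w + 2 * L\<^sup>2 * (\<mu> * w)) + 16 * S\<^sup>2 * w"
    unfolding holder_const_def using mb pos by (intro add_mono mult_left_mono up) auto
  also have "\<dots> = h * w" by (simp add: h_def algebra_simps)
  finally have Hw: "H \<le> h * w" .
  have "B \<le> 8 * (h * w) + 4 * scheme_const * (4 * (R' * w) + 4 * (h * w) * T)"
    unfolding B_def using Hw Rw pos scheme_const_nonneg by (intro add_mono mult_left_mono mult_right_mono) auto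
  also have "\<dots> = B' * w" by (simp add: B'_def algebra_simps)
  finally have Bw: "B \<le> B' * w" .
  have "B + E * (144 * R + B * T) \<le> B' * w + E * (144 * (R' * w) + (B' * w) * T)"
    using Bw Rw E0 pos by (intro add_mono mult_left_mono mult_right_mono) auto
  also have "\<dots> = (B' + E * (144 * R' + B' * T)) * w" by (simp add: algebra_simps)
  also have "\<dots> \<le> error_const L c0 S T A R' * w"
    unfolding C using R0 w by (intro mult_right_mono) auto
  finally have 1: "B + E * (144 * R + B * T) \<le> error_const L c0 S T A R' * w" .
  have "0 \<le> E * (144 * R' + B' * T)" using E0 R0 B'0 pos by simp
  then have 2: "72 * R \<le> error_const L c0 S T A R'"
    unfolding C using R B'0 by linarith
  have "err n \<le> ennreal (72 * R / (real n + 1)\<^sup>2 + dt * (B + E * (144 * R + B * T)))"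
    using err_le[OF n B_def G_def] by (simp only: E_def)
  also have "\<dots> \<le> ennreal (error_const L c0 S T A R' / (real n + 1)\<^sup>2 + dt * (error_const L c0 S T A R' * w))"
    using 1 2 dt_pos by (intro ennreal_leI add_mono mult_left_mono divide_right_mono) auto
  also have "error_const L c0 S T A R' / (real n + 1)\<^sup>2 + dt * (error_const L c0 S T A R' * w)
      = error_const L c0 S T A R' * w * dt + error_const L c0 S T A R' / (real n + 1)\<^sup>2"
    by (simp add: algebra_simps)
  finally show ?thesis .
qed

end

section \<open>Lipschitz constants and conclusion\<close>

lemma C3_bounded_derivs_lipschitz:
  assumes "C3_bounded_derivs g"
  obtains L where "0 \<le> L" "\<And>x y. norm (g x - g y) \<le> L * norm (x - y)"
proof -
  obtain g1 g2 g3 where "(\<forall>x. (g has_derivative blinfun_apply (g1 x)) (at x)) \<and>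
      (\<forall>x. (g1 has_derivative blinfun_apply (g2 x)) (at x)) \<and>
      (\<forall>x. (g2 has_derivative blinfun_apply (g3 x)) (at x)) \<and>
      continuous_on UNIV g3 \<and> bounded (range g1) \<and> bounded (range g2) \<and> bounded (range g3)"
    using assms unfolding C3_bounded_derivs_def by (elim exE) (rule that)
  then have d: "(g has_derivative blinfun_apply (g1 x)) (at x)" and b: "bounded (range g1)" for x
    by auto
  obtain L where L: "\<And>x. norm (g1 x) \<le> L" "0 < L"
    using b by (auto simp: bounded_pos)
  have "norm (g x - g y) \<le> L * norm (x - y)" for x y
    using d L(1)
    by (intro differentiable_bound[where S = UNIV and f' = "\<lambda>x. blinfun_apply (g1 x)"])
      (auto simp: norm_blinfun.rep_eq)
  then show thesis using that[of L] L(2) by simp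
qed

theorem theorem3p1:
  fixes M :: "'a measure" and F :: "real \<Rightarrow> 'a measure"
    and \<beta> :: "real \<Rightarrow> 'a \<Rightarrow> real ^ 'd"
    and f :: "real ^ 'd \<Rightarrow> real ^ 'd" and \<sigma> :: "real ^ 'd \<Rightarrow> real ^ 'd ^ 'd"
    and \<epsilon>\<^sub>0 \<Delta>t\<^sub>0 K P :: real
  assumes "wiener_process M F \<beta>"
    and "C3_bounded_derivs f" and "C3_bounded_derivs \<sigma>" and "bounded (range \<sigma>)"
    and "0 < \<epsilon>\<^sub>0" and "0 < \<Delta>t\<^sub>0"
  shows "\<forall>T>0. \<exists>C>0. \<forall>q0 p0 q00 q p.
    admissible_initial \<epsilon>\<^sub>0 K P q0 p0 q00 \<longrightarrow>
    (\<forall>\<epsilon>\<in>{0<..<\<epsilon>\<^sub>0}. langevin_solution M F \<beta> f \<sigma> \<epsilon> (q0 \<epsilon>) (p0 \<epsilon>) (q \<epsilon>) (p \<epsilon>)) \<longrightarrow>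
    (\<forall>N\<ge>1. \<forall>\<Delta>t qn pn.
      \<Delta>t = T / real N \<longrightarrow> \<Delta>t < \<Delta>t\<^sub>0 \<longrightarrow>
      (\<forall>\<epsilon>\<in>{0<..<\<epsilon>\<^sub>0}.
        langevin_scheme M \<beta> f \<sigma> \<epsilon> (q0 \<epsilon>) (p0 \<epsilon>) \<Delta>t N (qn \<epsilon>) (pn \<epsilon>)) \<longrightarrow>
      (\<forall>n\<in>{1..N}.
        (SUP \<epsilon>\<in>{0<..<\<epsilon>\<^sub>0}.
          \<integral>\<^sup>+\<omega>. ennreal ((norm (qn \<epsilon> n \<omega> - q \<epsilon> (real n * \<Delta>t) \<omega>))\<^sup>2) \<partial>M)
        \<le> ennreal (C * (1 + (norm q00)\<^sup>2) * \<Delta>t + C / (real n + 1)\<^sup>2)))"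
proof (intro allI impI)
  fix T :: real assume T: "0 < T"
  obtain L1 where L1: "0 \<le> L1" "\<And>x y. norm (f x - f y) \<le> L1 * norm (x - y)"
    using C3_bounded_derivs_lipschitz[OF assms(2)] by blast
  obtain L2 where L2: "0 \<le> L2" "\<And>x y. norm (\<sigma> x - \<sigma> y) \<le> L2 * norm (x - y)"
    using C3_bounded_derivs_lipschitz[OF assms(3)] by blast
  define L where "L = max L1 L2"
  have L: "0 \<le> L" "norm (f x - f y) \<le> L * norm (x - y)" "norm (\<sigma> x - \<sigma> y) \<le> L * norm (x - y)" for x y
    using L1 L2 order_trans[OF L1(2) mult_right_mono[of L1 L "norm (x - y)"]]
      order_trans[OF L2(2) mult_right_mono[of L2 L "norm (x - y)"]] by (auto simp: L_def)
  obtain S where S: "0 < S" "\<And>x. norm (\<sigma> x) \<le> S"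
    using assms(4) by (auto simp: bounded_pos)
  \<comment> \<open>Chosen before the initial data, \<open>\<epsilon>\<close>, \<open>N\<close> and
    the solutions. The entry \<open>2 * K\<^sup>2\<close> comes from
    \<open>(1 + norm q00)\<^sup>2 \<le> 2 * (1 + (norm q00)\<^sup>2)\<close>, and
    \<open>\<epsilon>\<^sub>0\<^sup>2 * P\<^sup>2\<close> bounds the squared norm of
    \<open>\<epsilon> *\<^sub>R p0 \<epsilon>\<close>. The maximum with 1 makes \<open>C\<close>
    positive.\<close>
  define C where "C = max 1 (error_const L (norm (f 0)) S T (2 * K\<^sup>2) (\<epsilon>\<^sub>0\<^sup>2 * P\<^sup>2))"
  show "\<exists>C>0. \<forall>q0 p0 q00 q p.
    admissible_initial \<epsilon>\<^sub>0 K P q0 p0 q00 \<longrightarrow>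
    (\<forall>\<epsilon>\<in>{0<..<\<epsilon>\<^sub>0}. langevin_solution M F \<beta> f \<sigma> \<epsilon> (q0 \<epsilon>) (p0 \<epsilon>) (q \<epsilon>) (p \<epsilon>)) \<longrightarrow>
    (\<forall>N\<ge>1. \<forall>\<Delta>t qn pn.
      \<Delta>t = T / real N \<longrightarrow> \<Delta>t < \<Delta>t\<^sub>0 \<longrightarrow>
      (\<forall>\<epsilon>\<in>{0<..<\<epsilon>\<^sub>0}.
        langevin_scheme M \<beta> f \<sigma> \<epsilon> (q0 \<epsilon>) (p0 \<epsilon>) \<Delta>t N (qn \<epsilon>) (pn \<epsilon>)) \<longrightarrow>
      (\<forall>n\<in>{1..N}.
        (SUP \<epsilon>\<in>{0<..<\<epsilon>\<^sub>0}. \<integral>\<^sup>+\<omega>. nsq (qn \<epsilon> n \<omega> - q \<epsilon> (real n * \<Delta>t) \<omega>) \<partial>M)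
        \<le> ennreal (C * (1 + (norm q00)\<^sup>2) * \<Delta>t + C / (real n + 1)\<^sup>2)))"
  proof (intro exI[of _ C] conjI allI impI ballI SUP_least)
    show "0 < C" by (simp add: C_def)
    fix q0 p0 :: "real \<Rightarrow> real ^ 'd" and q00 :: "real ^ 'd" and q p :: "real \<Rightarrow> real \<Rightarrow> 'a \<Rightarrow> real ^ 'd"
      and N :: nat and \<Delta>t :: real and qn pn :: "real \<Rightarrow> nat \<Rightarrow> 'a \<Rightarrow> real ^ 'd" and n :: nat and \<epsilon> :: real
    assume adm: "admissible_initial \<epsilon>\<^sub>0 K P q0 p0 q00"
      and sol: "\<forall>\<epsilon>\<in>{0<..<\<epsilon>\<^sub>0}. langevin_solution M F \<beta> f \<sigma> \<epsilon> (q0 \<epsilon>) (p0 \<epsilon>) (q \<epsilon>) (p \<epsilon>)"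
      and N: "1 \<le> N" and \<Delta>t: "\<Delta>t = T / real N"
      and scheme: "\<forall>\<epsilon>\<in>{0<..<\<epsilon>\<^sub>0}. langevin_scheme M \<beta> f \<sigma> \<epsilon> (q0 \<epsilon>) (p0 \<epsilon>) \<Delta>t N (qn \<epsilon>) (pn \<epsilon>)"
      and n: "n \<in> {1..N}" and \<epsilon>: "\<epsilon> \<in> {0<..<\<epsilon>\<^sub>0}"
    interpret wiener_process M F \<beta> by (rule assms(1))
    interpret langevin_discrete M F \<beta> f \<sigma> L "norm (f 0)" S \<epsilon> T "q0 \<epsilon>" "p0 \<epsilon>" "q \<epsilon>" "p \<epsilon>" \<Delta>t N "qn \<epsilon>" "pn \<epsilon>"
    proof unfold_locales
      show "langevin_solution M F \<beta> f \<sigma> \<epsilon> (q0 \<epsilon>) (p0 \<epsilon>) (q \<epsilon>) (p \<epsilon>)" using sol \<epsilon> by blast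
      show "langevin_scheme M \<beta> f \<sigma> \<epsilon> (q0 \<epsilon>) (p0 \<epsilon>) \<Delta>t N (qn \<epsilon>) (pn \<epsilon>)" using scheme \<epsilon> by blast
      show "0 < \<Delta>t" "T = real N * \<Delta>t" using T N \<Delta>t by auto
    qed (use L S T \<epsilon> in auto)
    have P: "norm (p0 \<epsilon>) \<le> P" and K: "norm (q0 \<epsilon>) \<le> K * (1 + norm q00)"
      using adm \<epsilon> by (auto simp: admissible_initial_def)
    have "(norm (q0 \<epsilon>))\<^sup>2 \<le> (K * (1 + norm q00))\<^sup>2"
      using K by (intro power_mono) auto
    also have "\<dots> \<le> 2 * K\<^sup>2 * (1 + (norm q00)\<^sup>2)"
      using mult_left_mono[OF zero_le_power2[of "1 - norm q00"] zero_le_power2[of K]]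
      by (simp add: power2_eq_square algebra_simps)
    finally have A: "(norm (q0 \<epsilon>))\<^sup>2 \<le> 2 * K\<^sup>2 * (1 + (norm q00)\<^sup>2)" .
    have R: "(norm (\<epsilon> *\<^sub>R p0 \<epsilon>))\<^sup>2 \<le> \<epsilon>\<^sub>0\<^sup>2 * P\<^sup>2"
      using P \<epsilon> by (auto simp: power_mult_distrib intro!: mult_mono power_mono)
    have "(\<integral>\<^sup>+\<omega>. nsq (qn \<epsilon> n \<omega> - q \<epsilon> (real n * \<Delta>t) \<omega>) \<partial>M) = err n"
      by (simp add: err_def)
    also have "\<dots> \<le> ennreal (error_const L (norm (f 0)) S T (2 * K\<^sup>2) (\<epsilon>\<^sub>0\<^sup>2 * P\<^sup>2) * (1 + (norm q00)\<^sup>2) * \<Delta>t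
        + error_const L (norm (f 0)) S T (2 * K\<^sup>2) (\<epsilon>\<^sub>0\<^sup>2 * P\<^sup>2) / (real n + 1)\<^sup>2)"
      using n A R by (intro err_uniform) auto
    also have "\<dots> \<le> ennreal (C * (1 + (norm q00)\<^sup>2) * \<Delta>t + C / (real n + 1)\<^sup>2)"
      using dt_pos by (intro ennreal_leI add_mono mult_right_mono divide_right_mono) (auto simp: C_def)
    finally show "(\<integral>\<^sup>+\<omega>. nsq (qn \<epsilon> n \<omega> - q \<epsilon> (real n * \<Delta>t) \<omega>) \<partial>M)
      \<le> ennreal (C * (1 + (norm q00)\<^sup>2) * \<Delta>t + C / (real n + 1)\<^sup>2)" .
  qed
qed

end
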